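(* Let $0<a<1$ and let $\phi(z)=az+(1-a)$ and $\sigma(z)=\frac{az}{-(1-a)z+1}$, which are maps from $\mathbb{D}$ into itself. For $\alpha>-1$ and $j\in\mathbb{N}\cup\{0\}$, let $$\gamma_\alpha(j)=\sqrt{\frac{j!\,\Gamma(\alpha+2)}{\Gamma(j+\alpha+2)}},\qquad \beta_\alpha(j)=\begin{cases}1,& j=0,\\ \dfrac{1}{\gamma_\alpha(j-1)}=\sqrt{\dfrac{\Gamma(j+\alpha+1)}{(j-1)!\,\Gamma(\alpha+2)}},& j\ge1.\end{cases}$$ For each non-negative integer $n$, the $n$th iterated Aluthge transform of the composition operator $C_\sigma$ on $H^2(\beta_\alpha)$ is given by $$\widetilde{C_\sigma}^{(n)}=1\oplus V\left(a\,\widetilde{C_\phi^*}^{(n)}\right)V^*$$ with respect to the decomposition $H^2(\beta_\alpha)=(zH^2(\beta_\alpha))^\perp\oplus(zH^2(\beta_\alpha))$, where $\widetilde{C_\phi^*}^{(n)}$ is the $n$th iterated Aluthge transform of the adjoint $C_\phi^*$ of $C_\phi$ acting on $\mathcal{A}_\alpha^2(\mathbb{D})=H^2(\gamma_\alpha)$, and $V:H^2(\gamma_\alpha)\to zH^2(\beta_\alpha)$ is the unitary operator given by $$Vz^j=\frac{\gamma_\alpha(j)}{\beta_\alpha(j+1)}z^{j+1}\qquad (j\ge0).$$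
   Context: $\mathbb{D}$ is the open unit disk in $\mathbb{C}$. For a sequence $\beta(n)$ of positive numbers with $\beta(0)=1$ and $\lim_{n\to\infty}\beta(n)^{1/n}=1$, the weighted Hardy space $H^2(\beta)$ is the Hilbert space of analytic functions $f(z)=\sum_{n\ge0}a_nz^n$ on $\mathbb{D}$ with $\|f\|^2=\sum_n|a_n|^2\beta(n)^2<\infty$, and inner product $\langle\sum a_nz^n,\sum b_nz^n\rangle=\sum_n a_n\overline{b_n}\beta(n)^2$. Here $zH^2(\beta)=\{zf:f\in H^2(\beta)\}$. For $\alpha>-1$ the weighted Bergman space $\mathcal{A}_\alpha^2(\mathbb{D})$ is the Hilbert space of analytic functions on $\mathbb{D}$ with inner product $\langle \sum a_nz^n,\sum b_nz^n\rangle=\sum_{n}\frac{n!\,\Gamma(\alpha+2)}{\Gamma(n+\alpha+2)}a_n\overline{b_n}$. For an analytic self-map $\phi$ of $\mathbb{D}$, $C_\phi h=h\circ\phi$. For a bounded operator $T$ on a Hilbert space $H$, let $|T|=(T^*T)^{1/2}$ and let $T=U|T|$ be the polar decomposition, $U$ being the partial isometry with $\ker U=\ker T=\ker|T|$. The Aluthge transform of $T$ is $\widetilde{T}=|T|^{1/2}U|T|^{1/2}$. The iterated Aluthge transforms are $\widetilde{T}^{(0)}=T$ and $\widetilde{T}^{(n+1)}=\widetilde{(\widetilde{T}^{(n)})}$ for every integer $n\ge0$. *)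

theory Defs
  imports "HOL-Complex_Analysis.Complex_Analysis"
begin

section \<open>Operators on Hilbert spaces of complex-valued functions\<close>

text \<open>
  A Hilbert space is given by a set of complex-valued functions, with pointwise linear structure,
  and an inner product that is linear in the first argument. Operators are extensional, that is
  \<^const>\<open>undefined\<close> off the domain, so that equality of operators is HOL equality.
  The definite descriptions below characterise extensional operators uniquely whenever the space
  is complete and the given operator is bounded (and positive, for the square root).
\<close>

record 'x fspace =
  elems :: "('x \<Rightarrow> complex) set"
  ip :: "('x \<Rightarrow> complex) \<Rightarrow> ('x \<Rightarrow> complex) \<Rightarrow> complex"

type_synonym 'x fop = "('x \<Rightarrow> complex) \<Rightarrow> ('x \<Rightarrow> complex)"

definition hnorm :: "'x fspace \<Rightarrow> ('x \<Rightarrow> complex) \<Rightarrow> real" where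
  "hnorm H f = sqrt (Re (ip H f f))"

definition bounded_ops :: "'x fspace \<Rightarrow> 'x fspace \<Rightarrow> 'x fop set" where
  "bounded_ops H K = {T \<in> elems H \<rightarrow>\<^sub>E elems K.
     (\<forall>f\<in>elems H. \<forall>g\<in>elems H. T (\<lambda>x. f x + g x) = (\<lambda>x. T f x + T g x)) \<and>
     (\<forall>c. \<forall>f\<in>elems H. T (\<lambda>x. c * f x) = (\<lambda>x. c * T f x)) \<and>
     (\<exists>M. \<forall>f\<in>elems H. hnorm K (T f) \<le> M * hnorm H f)}"

definition adj :: "'x fspace \<Rightarrow> 'x fspace \<Rightarrow> 'x fop \<Rightarrow> 'x fop" where
  "adj H K T = (THE S. S \<in> bounded_ops K H \<and>
     (\<forall>f\<in>elems H. \<forall>g\<in>elems K. ip K (T f) g = ip H f (S g)))"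

definition unitary_ops :: "'x fspace \<Rightarrow> 'x fspace \<Rightarrow> 'x fop set" where
  "unitary_ops H K = {V \<in> bounded_ops H K. V ` elems H = elems K \<and>
     (\<forall>f\<in>elems H. \<forall>g\<in>elems H. ip K (V f) (V g) = ip H f g)}"

definition scale_op :: "'x fspace \<Rightarrow> complex \<Rightarrow> 'x fop \<Rightarrow> 'x fop" where
  "scale_op H c T = (\<lambda>f\<in>elems H. \<lambda>x. c * T f x)"

definition id_op :: "('x \<Rightarrow> complex) set \<Rightarrow> 'x fop" where
  "id_op M = (\<lambda>f\<in>M. f)"

definition ker_op :: "'x fspace \<Rightarrow> 'x fop \<Rightarrow> ('x \<Rightarrow> complex) set" where
  "ker_op H T = {f \<in> elems H. T f = (\<lambda>x. 0)}"

definition ortho :: "'x fspace \<Rightarrow> ('x \<Rightarrow> complex) set \<Rightarrow> ('x \<Rightarrow> complex) set" where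
  "ortho H M = {f \<in> elems H. \<forall>g\<in>M. ip H f g = 0}"

text \<open>
  The operator \<open>A \<oplus> B\<close> on \<open>H = M \<oplus> N\<close>, for \<open>A\<close> acting on \<open>M\<close> and \<open>B\<close> acting on \<open>N\<close>.
\<close>

definition direct_sum_op ::
  "'x fspace \<Rightarrow> ('x \<Rightarrow> complex) set \<Rightarrow> ('x \<Rightarrow> complex) set \<Rightarrow> 'x fop \<Rightarrow> 'x fop \<Rightarrow> 'x fop" where
  "direct_sum_op H M N A B = (\<lambda>f\<in>elems H. THE k. \<exists>g\<in>M. \<exists>h\<in>N.
     f = (\<lambda>x. g x + h x) \<and> k = (\<lambda>x. A g x + B h x))"

definition positive_ops :: "'x fspace \<Rightarrow> 'x fop set" where
  "positive_ops H = {P \<in> bounded_ops H H. \<forall>f\<in>elems H. ip H (P f) f \<in> \<real>\<^sub>\<ge>\<^sub>0}"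

definition sqrt_op :: "'x fspace \<Rightarrow> 'x fop \<Rightarrow> 'x fop" where
  "sqrt_op H P = (THE S. S \<in> positive_ops H \<and> compose (elems H) S S = P)"

definition abs_op :: "'x fspace \<Rightarrow> 'x fop \<Rightarrow> 'x fop" where
  "abs_op H T = sqrt_op H (compose (elems H) (adj H H T) T)"

definition partial_isometries :: "'x fspace \<Rightarrow> 'x fop set" where
  "partial_isometries H = {U \<in> bounded_ops H H.
     \<forall>f\<in>ortho H (ker_op H U). hnorm H (U f) = hnorm H f}"

definition polar_op :: "'x fspace \<Rightarrow> 'x fop \<Rightarrow> 'x fop" where
  "polar_op H T = (THE U. U \<in> partial_isometries H \<and>
     T = compose (elems H) U (abs_op H T) \<and>
     ker_op H U = ker_op H T \<and> ker_op H T = ker_op H (abs_op H T))"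

definition aluthge :: "'x fspace \<Rightarrow> 'x fop \<Rightarrow> 'x fop" where
  "aluthge H T = compose (elems H) (sqrt_op H (abs_op H T))
     (compose (elems H) (polar_op H T) (sqrt_op H (abs_op H T)))"

definition iter_aluthge :: "'x fspace \<Rightarrow> nat \<Rightarrow> 'x fop \<Rightarrow> 'x fop" where
  "iter_aluthge H n T = (aluthge H ^^ n) T"

section \<open>Weighted Hardy spaces\<close>

text \<open>
  An analytic function on the unit disk is represented by the function on \<^typ>\<open>complex\<close> that
  extends it by 0, so that equality of elements is HOL equality.
\<close>

definition taylor_coeff :: "(complex \<Rightarrow> complex) \<Rightarrow> nat \<Rightarrow> complex" where
  "taylor_coeff f n = fps_nth (fps_expansion f 0) n"

definition H2 :: "(nat \<Rightarrow> real) \<Rightarrow> complex fspace" where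
  "H2 \<beta> = \<lparr>
     elems = {f. f holomorphic_on ball 0 1 \<and> (\<forall>z. z \<notin> ball 0 1 \<longrightarrow> f z = 0) \<and>
                 summable (\<lambda>n. (cmod (taylor_coeff f n))\<^sup>2 * (\<beta> n)\<^sup>2)},
     ip = (\<lambda>f g. \<Sum>n. taylor_coeff f n * cnj (taylor_coeff g n) * of_real ((\<beta> n)\<^sup>2)) \<rparr>"

definition zH2 :: "(nat \<Rightarrow> real) \<Rightarrow> complex fspace" where
  "zH2 \<beta> = \<lparr> elems = (\<lambda>f z. z * f z) ` elems (H2 \<beta>), ip = ip (H2 \<beta>) \<rparr>"

definition disk_monom :: "nat \<Rightarrow> complex \<Rightarrow> complex" where
  "disk_monom j = (\<lambda>z. if z \<in> ball 0 1 then z ^ j else 0)"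

definition comp_op :: "complex fspace \<Rightarrow> (complex \<Rightarrow> complex) \<Rightarrow> complex fop" where
  "comp_op H \<phi> = (\<lambda>h\<in>elems H. \<lambda>z. if z \<in> ball 0 1 then h (\<phi> z) else 0)"

definition phi_map :: "real \<Rightarrow> complex \<Rightarrow> complex" where
  "phi_map a z = of_real a * z + (1 - of_real a)"

definition sigma_map :: "real \<Rightarrow> complex \<Rightarrow> complex" where
  "sigma_map a z = of_real a * z / (- (1 - of_real a) * z + 1)"

text \<open>
  The squares of these weights are the coefficients in the inner product of the weighted Bergman
  space of parameter \<open>\<alpha>\<close>, so that this space is \<open>H2 (gamma_wt \<alpha>)\<close>.
\<close>

definition gamma_wt :: "real \<Rightarrow> nat \<Rightarrow> real" where
  "gamma_wt \<alpha> j = sqrt (fact j * Gamma (\<alpha> + 2) / Gamma (real j + \<alpha> + 2))"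

definition beta_wt :: "real \<Rightarrow> nat \<Rightarrow> real" where
  "beta_wt \<alpha> j = (if j = 0 then 1 else 1 / gamma_wt \<alpha> (j - 1))"

definition shift_unitary :: "real \<Rightarrow> complex fop \<Rightarrow> bool" where
  "shift_unitary \<alpha> V \<longleftrightarrow> V \<in> unitary_ops (H2 (gamma_wt \<alpha>)) (zH2 (beta_wt \<alpha>)) \<and>
     (\<forall>j. V (disk_monom j) =
        (\<lambda>z. of_real (gamma_wt \<alpha> j / beta_wt \<alpha> (j + 1)) * disk_monom (j + 1) z))"

end

theory Submission
  imports Defs "HOL-Library.Function_Algebras"
begin

text \<open>
  The iterated Aluthge transform commutes with multiplication by a positive number and with
  \<open>X \<mapsto> 1 \<oplus> V X V\<^sup>*\<close> for a unitary \<open>V\<close> onto a subspace. So the identity for all \<open>n\<close> follows from the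
  case \<open>n = 0\<close>, which says \<open>C\<^sub>\<sigma> = 1 \<oplus> V (a C\<^sub>\<phi>\<^sup>*) V\<^sup>*\<close>.

  For the first point, write \<open>J\<close> for \<open>V\<close> seen as an isometry into the large space. Then
  \<open>1 \<oplus> V X V\<^sup>* = 1 + J (X - 1) J\<^sup>*\<close>, and this map is multiplicative, preserves adjoints and
  positivity, and acts on kernels in a controlled way (locale \<open>isometric_embedding\<close>). Positive square
  roots and polar decompositions are characterised by exactly such data, so the map carries
  them along (\<open>sqrt_extend_op\<close>, \<open>polar_extend_op\<close>, \<open>aluthge_extend_op\<close>). As all of these operators are
  definite descriptions, this argument needs existence and uniqueness of adjoints, square roots and
  polar decompositions on an arbitrary Hilbert space. Adjoints come from the Riesz representation
  theorem. The square root of \<open>1 - B\<close> is \<open>1 - Y\<close>, where \<open>Y\<close> is the limit of the iteration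
  \<open>Y \<mapsto> (B + Y\<^sup>2) / 2\<close>; the same iteration for the number 1 bounds its increments in norm
  (\<open>exists_sqrt\<close>). For the polar decomposition, the partial isometry is the strong limit of \<open>T W\<^sub>n\<close>, where
  the operators \<open>W\<^sub>n\<close> are partial sums of a Neumann series, approximate inverses of \<open>|T|\<close> off its kernel
  (\<open>exists_polar_op\<close>).

  The case \<open>n = 0\<close> is tested on reproducing kernels \<open>K\<^sub>z\<close>. Taking the matrix of the adjoint of \<open>C\<^sub>\<phi>\<close> as
  the definition of an operator \<open>S\<close>, a weighted Schur test gives \<open>\<parallel>S\<parallel>\<^sup>2 \<le> a\<^bsup>-(\<alpha>+2)\<^esup>\<close>
  (\<open>adj_coeff_bound\<close>), and the finite binomial theorem gives \<open>S K\<^sub>z = K\<^bsub>\<phi>(z)\<^esub>\<close>. Hence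
  \<open>S\<^sup>* f = f \<circ> \<phi>\<close>, which shows at once that \<open>C\<^sub>\<phi>\<close> is bounded and that \<open>C\<^sub>\<phi>\<^sup>* = S\<close>. In the same way,
  summing geometric series shows that \<open>1 \<oplus> V (a C\<^sub>\<phi>) V\<^sup>*\<close> maps the kernel \<open>K\<^sub>z\<close> of \<open>H\<^sup>2(\<beta>\<^sub>\<alpha>)\<close> to
  \<open>K\<^bsub>\<sigma>(z)\<^esub>\<close>, so its adjoint \<open>1 \<oplus> V (a S) V\<^sup>*\<close> is composition with \<open>\<sigma>\<close> (\<open>comp_op_sigma\<close>).
\<close>

section \<open>Hilbert spaces of functions\<close>

definition smul :: "complex \<Rightarrow> ('x \<Rightarrow> complex) \<Rightarrow> 'x \<Rightarrow> complex" (infixr "\<cdot>" 75) where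
  "c \<cdot> f = (\<lambda>x. c * f x)"

lemma smul_apply [simp]: "(c \<cdot> f) x = c * f x"
  by (simp add: smul_def)

lemma smul_algebra:
  shows smul_add: "c \<cdot> (f + g) = c \<cdot> f + c \<cdot> g"
    and smul_smul [simp]: "c \<cdot> (d \<cdot> f) = (c * d) \<cdot> f"
    and smul_one [simp]: "1 \<cdot> f = f"
    and smul_zero_left [simp]: "0 \<cdot> f = 0"
    and smul_zero_right [simp]: "c \<cdot> (0::'x \<Rightarrow> complex) = 0"
  by (simp_all add: fun_eq_iff algebra_simps)

text \<open>
  The argument behind the Cauchy--Schwarz inequality and behind the characterisation of minimisers
  in the Riesz theorem: choose \<open>t\<close> as the minimiser \<open>- cnj b / C\<close>, or let it tend to infinity
  if \<open>C = 0\<close>.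
\<close>

lemma quadratic_discriminant:
  fixes A C :: real and b :: complex
  assumes quad: "\<And>t. 0 \<le> A + 2 * Re (t * b) + (cmod t)\<^sup>2 * C" and "0 \<le> C"
  shows "(cmod b)\<^sup>2 \<le> A * C"
proof (cases "C = 0")
  case True
  have "b = 0"
  proof (rule ccontr)
    assume "b \<noteq> 0"
    hence p: "(cmod b)\<^sup>2 > 0" by simp
    \<comment> \<open>The value of k for which the right-hand side of the hypothesis becomes -1.\<close>
    define k where "k = (A + 1) / (2 * (cmod b)\<^sup>2)"
    have "Re (- of_real k * cnj b * b) = - k * (cmod b)\<^sup>2"
      unfolding cmod_power2 by (simp add: power2_eq_square algebra_simps)
    hence "0 \<le> A - 2 * k * (cmod b)\<^sup>2" using quad[of "- of_real k * cnj b"] True by simp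
    moreover have "2 * k * (cmod b)\<^sup>2 = A + 1" using p by (simp add: k_def)
    ultimately show False by simp
  qed
  thus ?thesis using True by simp
next
  case False
  hence C: "C > 0" using assms(2) by simp
  have "- (cnj b / of_real C) * b = of_real (- (cmod b)\<^sup>2 / C)"
    by (simp add: complex_norm_square mult.commute del: of_real_power)
  hence "Re (- (cnj b / of_real C) * b) = - (cmod b)\<^sup>2 / C"
    by (metis Re_complex_of_real)
  moreover have "(cmod (- (cnj b / of_real C)))\<^sup>2 * C = (cmod b)\<^sup>2 / C"
    using C by (simp add: norm_divide power_divide power2_eq_square)
  ultimately have "0 \<le> A - (cmod b)\<^sup>2 / C"
    using quad[of "- (cnj b / of_real C)"] by (simp only:)
  thus ?thesis using C by (simp add: field_simps)
qed

text \<open>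
  Stated for a general form because it is applied to the inner product and to
  \<open>\<langle>P f, g\<rangle>\<close> for a positive operator \<open>P\<close>.
\<close>

lemma positive_form_cauchy_schwarz:
  fixes q :: "('x \<Rightarrow> complex) \<Rightarrow> ('x \<Rightarrow> complex) \<Rightarrow> complex"
  assumes mem: "\<And>c. f + c \<cdot> g \<in> E" "\<And>c. c \<cdot> g \<in> E" "f \<in> E" "g \<in> E"
    and add: "\<And>u v w. u \<in> E \<Longrightarrow> v \<in> E \<Longrightarrow> w \<in> E \<Longrightarrow> q (u + v) w = q u w + q v w"
    and smul: "\<And>c u w. u \<in> E \<Longrightarrow> w \<in> E \<Longrightarrow> q (c \<cdot> u) w = c * q u w"
    and herm: "\<And>u v. u \<in> E \<Longrightarrow> v \<in> E \<Longrightarrow> q v u = cnj (q u v)"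
    and nonneg: "\<And>u. u \<in> E \<Longrightarrow> 0 \<le> Re (q u u)"
  shows "(cmod (q f g))\<^sup>2 \<le> Re (q f f) * Re (q g g)"
proof -
  define A where "A = Re (q f f)"
  define C where "C = Re (q g g)"
  define b where "b = q g f"
  have add': "q w (u + v) = q w u + q w v" if "u \<in> E" "v \<in> E" "w \<in> E" "u + v \<in> E" for u v w
    using herm[of "u + v" w] herm[of u w] herm[of v w] add[of u v w] that by simp
  have smul': "q w (c \<cdot> u) = cnj c * q w u" if "u \<in> E" "w \<in> E" "c \<cdot> u \<in> E" for c u w
    using herm[of "c \<cdot> u" w] herm[of u w] smul[of u w c] that by simp
  have quad: "0 \<le> A + 2 * Re (t * b) + (cmod t)\<^sup>2 * C" for t
  proof -
    have "q (f + t \<cdot> g) (f + t \<cdot> g) = q f f + cnj t * q f g + (t * q g f + t * (cnj t * q g g))"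
      using mem by (simp add: add add' smul smul' distrib_left)
    moreover have "q f g = cnj b" unfolding b_def using herm mem by blast
    moreover have "Re (t * (cnj t * q g g)) = (cmod t)\<^sup>2 * C"
      by (simp add: C_def mult.assoc[symmetric] complex_mult_cnj cmod_power2)
    ultimately show ?thesis using nonneg[OF mem(1)[of t]]
      by (simp add: A_def b_def)
  qed
  have "(cmod b)\<^sup>2 \<le> A * C"
    using quad nonneg[OF mem(4)] by (intro quadratic_discriminant) (auto simp: C_def)
  moreover have "cmod (q f g) = cmod b"
    unfolding b_def using herm[of f g] mem by simp
  ultimately show ?thesis by (simp add: A_def C_def)
qed

locale hilbert_space =
  fixes H :: "'x fspace"
  assumes zero_mem [simp]: "0 \<in> elems H"
    and add_mem [simp]: "f \<in> elems H \<Longrightarrow> g \<in> elems H \<Longrightarrow> f + g \<in> elems H"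
    and smul_mem [simp]: "f \<in> elems H \<Longrightarrow> c \<cdot> f \<in> elems H"
    and ip_add_left: "\<lbrakk>f \<in> elems H; g \<in> elems H; h \<in> elems H\<rbrakk> \<Longrightarrow> ip H (f + g) h = ip H f h + ip H g h"
    and ip_smul_left: "\<lbrakk>f \<in> elems H; h \<in> elems H\<rbrakk> \<Longrightarrow> ip H (c \<cdot> f) h = c * ip H f h"
    and ip_commute: "\<lbrakk>f \<in> elems H; g \<in> elems H\<rbrakk> \<Longrightarrow> ip H g f = cnj (ip H f g)"
    and ip_nonneg: "f \<in> elems H \<Longrightarrow> 0 \<le> Re (ip H f f)"
    and ip_definite: "\<lbrakk>f \<in> elems H; ip H f f = 0\<rbrakk> \<Longrightarrow> f = 0"
    and complete: "\<lbrakk>\<And>n. X n \<in> elems H; \<And>e. e > 0 \<Longrightarrow> \<exists>N. \<forall>m\<ge>N. \<forall>n\<ge>N. hnorm H (X m - X n) < e\<rbrakk>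
      \<Longrightarrow> \<exists>f\<in>elems H. (\<lambda>n. hnorm H (X n - f)) \<longlonglongrightarrow> 0"
begin

lemma diff_mem [simp]: "f - g \<in> elems H" if "f \<in> elems H" "g \<in> elems H"
proof -
  have "f - g = f + (-1) \<cdot> g" by (simp add: fun_eq_iff)
  thus ?thesis using that by (metis add_mem smul_mem)
qed

lemma ip_diff_left: "ip H (f - g) h = ip H f h - ip H g h"
  if "f \<in> elems H" "g \<in> elems H" "h \<in> elems H"
proof -
  have "f - g = f + (-1) \<cdot> g" by (simp add: fun_eq_iff)
  show ?thesis unfolding \<open>f - g = _\<close> using that by (simp add: ip_add_left ip_smul_left)
qed

lemma ip_add_right: "ip H h (f + g) = ip H h f + ip H h g"
  if "f \<in> elems H" "g \<in> elems H" "h \<in> elems H"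
  using ip_commute[of "f + g" h] ip_commute[of f h] ip_commute[of g h] that
  by (simp add: ip_add_left)

lemma ip_diff_right: "ip H h (f - g) = ip H h f - ip H h g"
  if "f \<in> elems H" "g \<in> elems H" "h \<in> elems H"
  using ip_commute[of "f - g" h] ip_commute[of f h] ip_commute[of g h] that
  by (simp add: ip_diff_left)

lemma ip_smul_right: "ip H h (c \<cdot> f) = cnj c * ip H h f"
  if "f \<in> elems H" "h \<in> elems H"
  using ip_commute[of "c \<cdot> f" h] ip_commute[of f h] that
  by (simp add: ip_smul_left)

lemmas ip_linear = ip_add_left ip_add_right ip_diff_left ip_diff_right ip_smul_left ip_smul_right

lemma ip_zero [simp]: "f \<in> elems H \<Longrightarrow> ip H 0 f = 0" "f \<in> elems H \<Longrightarrow> ip H f 0 = 0"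
  using ip_smul_left[of 0 f 0] ip_smul_right[of 0 f 0] by simp_all

lemma hnorm_nonneg [simp]: "f \<in> elems H \<Longrightarrow> 0 \<le> hnorm H f"
  using ip_nonneg by (simp add: hnorm_def)

lemma hnorm_sq: "f \<in> elems H \<Longrightarrow> (hnorm H f)\<^sup>2 = Re (ip H f f)"
  using ip_nonneg by (simp add: hnorm_def)

lemma ip_self: "f \<in> elems H \<Longrightarrow> ip H f f = of_real ((hnorm H f)\<^sup>2)"
  using ip_commute[of f f] by (simp add: hnorm_sq complex_eq_iff)

lemma hnorm_zero [simp]: "hnorm H 0 = 0"
  by (simp add: hnorm_def)

lemma hnorm_eq_0: "f \<in> elems H \<Longrightarrow> hnorm H f = 0 \<longleftrightarrow> f = 0"
  using ip_self[of f] ip_definite[of f] by auto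

lemma hnorm_smul: "f \<in> elems H \<Longrightarrow> hnorm H (c \<cdot> f) = cmod c * hnorm H f"
proof -
  assume f: "f \<in> elems H"
  have "ip H (c \<cdot> f) (c \<cdot> f) = c * cnj c * of_real ((hnorm H f)\<^sup>2)"
    using f by (simp add: ip_linear ip_self[OF f])
  also have "\<dots> = of_real ((cmod c)\<^sup>2 * (hnorm H f)\<^sup>2)"
    by (simp add: complex_norm_square flip: of_real_power)
  finally have "(hnorm H (c \<cdot> f))\<^sup>2 = (cmod c * hnorm H f)\<^sup>2"
    using f hnorm_sq[of "c \<cdot> f"] by (simp add: power_mult_distrib)
  thus ?thesis using f by (simp add: power2_eq_iff_nonneg)
qed

lemma hnorm_minus_commute: "f \<in> elems H \<Longrightarrow> g \<in> elems H \<Longrightarrow> hnorm H (f - g) = hnorm H (g - f)"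
proof -
  assume "f \<in> elems H" "g \<in> elems H"
  moreover have "f - g = (-1) \<cdot> (g - f)" by (simp add: fun_eq_iff)
  ultimately show ?thesis using hnorm_smul[of "g - f" "-1"] by simp
qed

lemma cauchy_schwarz:
  assumes "f \<in> elems H" "g \<in> elems H"
  shows "cmod (ip H f g) \<le> hnorm H f * hnorm H g"
proof -
  have "(cmod (ip H f g))\<^sup>2 \<le> Re (ip H f f) * Re (ip H g g)"
    by (rule positive_form_cauchy_schwarz[where q = "ip H" and E = "elems H"])
       (use assms in \<open>auto simp: ip_linear ip_nonneg intro: ip_commute\<close>)
  hence "(cmod (ip H f g))\<^sup>2 \<le> (hnorm H f * hnorm H g)\<^sup>2"
    using assms by (simp add: hnorm_sq power_mult_distrib)
  thus ?thesis using assms by (meson hnorm_nonneg mult_nonneg_nonneg power2_le_imp_le)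
qed

lemma hnorm_triangle:
  assumes "f \<in> elems H" "g \<in> elems H"
  shows "hnorm H (f + g) \<le> hnorm H f + hnorm H g"
proof -
  have "Re (ip H (f + g) (f + g)) = (hnorm H f)\<^sup>2 + 2 * Re (ip H f g) + (hnorm H g)\<^sup>2"
    using assms ip_commute[of f g] by (simp add: ip_linear hnorm_sq)
  also have "\<dots> \<le> (hnorm H f)\<^sup>2 + 2 * (hnorm H f * hnorm H g) + (hnorm H g)\<^sup>2"
    using cauchy_schwarz[OF assms] complex_Re_le_cmod[of "ip H f g"] by simp
  finally have "(hnorm H (f + g))\<^sup>2 \<le> (hnorm H f + hnorm H g)\<^sup>2"
    using assms by (simp add: hnorm_sq[of "f + g"] power2_sum)
  thus ?thesis using assms by (meson add_nonneg_nonneg hnorm_nonneg power2_le_imp_le)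
qed

lemma hnorm_triangle_diff:
  assumes "f \<in> elems H" "g \<in> elems H" "h \<in> elems H"
  shows "hnorm H (f - h) \<le> hnorm H (f - g) + hnorm H (g - h)"
  using hnorm_triangle[of "f - g" "g - h"] assms by simp

lemma eq_if_ip_eq:
  assumes "f \<in> elems H" "g \<in> elems H" "\<And>h. h \<in> elems H \<Longrightarrow> ip H h f = ip H h g"
  shows "f = g"
proof -
  have "ip H (f - g) (f - g) = 0" using assms by (simp add: ip_diff_right)
  thus ?thesis using ip_definite[of "f - g"] assms by simp
qed

lemma parallelogram:
  assumes "f \<in> elems H" "g \<in> elems H"
  shows "(hnorm H (f + g))\<^sup>2 + (hnorm H (f - g))\<^sup>2 = 2 * (hnorm H f)\<^sup>2 + 2 * (hnorm H g)\<^sup>2"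
  using assms by (simp add: hnorm_sq ip_linear)

subsection \<open>Convergence in norm\<close>

definition converges :: "(nat \<Rightarrow> 'x \<Rightarrow> complex) \<Rightarrow> ('x \<Rightarrow> complex) \<Rightarrow> bool" where
  "converges X f \<longleftrightarrow> (\<forall>n. X n \<in> elems H) \<and> f \<in> elems H \<and> (\<lambda>n. hnorm H (X n - f)) \<longlonglongrightarrow> 0"

lemma converges_mem: "converges X f \<Longrightarrow> X n \<in> elems H" "converges X f \<Longrightarrow> f \<in> elems H"
  by (auto simp: converges_def)

lemma converges_const: "f \<in> elems H \<Longrightarrow> converges (\<lambda>n. f) f"
  by (simp add: converges_def)

lemma converges_add:
  assumes "converges X f" "converges Y g"
  shows "converges (\<lambda>n. X n + Y n) (f + g)"
proof -
  have "(\<lambda>n. hnorm H (X n + Y n - (f + g))) \<longlonglongrightarrow> 0"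
  proof (rule Lim_null_comparison)
    show "\<forall>\<^sub>F n in sequentially. norm (hnorm H (X n + Y n - (f + g))) \<le> hnorm H (X n - f) + hnorm H (Y n - g)"
    proof (rule always_eventually, rule allI)
      fix n
      show "norm (hnorm H (X n + Y n - (f + g))) \<le> hnorm H (X n - f) + hnorm H (Y n - g)"
        using hnorm_triangle[of "X n - f" "Y n - g"] assms
        by (simp add: converges_def add_diff_add)
    qed
    show "(\<lambda>n. hnorm H (X n - f) + hnorm H (Y n - g)) \<longlonglongrightarrow> 0"
      using assms tendsto_add[of _ 0 sequentially _ 0] by (auto simp: converges_def)
  qed
  thus ?thesis using assms by (simp add: converges_def)
qed

lemma converges_unique:
  assumes "converges X f" "converges X g"
  shows "f = g"
proof -
  have "(\<lambda>n. hnorm H (X n - f) + hnorm H (X n - g)) \<longlonglongrightarrow> 0"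
    using assms tendsto_add[of _ 0 sequentially _ 0] by (auto simp: converges_def)
  moreover have "hnorm H (f - g) \<le> hnorm H (X n - f) + hnorm H (X n - g)" for n
    using assms hnorm_triangle_diff[of f "X n" g] hnorm_minus_commute[of f "X n"]
    by (simp add: converges_def)
  ultimately have "hnorm H (f - g) \<le> 0"
    by (meson LIMSEQ_le_const)
  moreover have "f \<in> elems H" "g \<in> elems H" using assms by (auto simp: converges_def)
  ultimately show ?thesis by (metis diff_mem eq_iff_diff_eq_0 hnorm_eq_0 hnorm_nonneg order_antisym)
qed

lemma converges_ip:
  assumes "converges X f" "g \<in> elems H"
  shows "(\<lambda>n. ip H (X n) g) \<longlonglongrightarrow> ip H f g"
proof -
  have "(\<lambda>n. ip H (X n) g - ip H f g) \<longlonglongrightarrow> 0"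
  proof (rule Lim_null_comparison)
    show "\<forall>\<^sub>F n in sequentially. norm (ip H (X n) g - ip H f g) \<le> hnorm H (X n - f) * hnorm H g"
      using assms cauchy_schwarz[of "X _ - f" g] by (simp add: converges_def ip_diff_left)
    show "(\<lambda>n. hnorm H (X n - f) * hnorm H g) \<longlonglongrightarrow> 0"
      using assms by (auto simp: converges_def intro: tendsto_mult_left_zero)
  qed
  thus ?thesis by (simp add: LIM_zero_iff)
qed

lemma converges_hnorm:
  assumes "converges X f"
  shows "(\<lambda>n. hnorm H (X n)) \<longlonglongrightarrow> hnorm H f"
proof -
  have "(\<lambda>n. hnorm H (X n) - hnorm H f) \<longlonglongrightarrow> 0"
  proof (rule Lim_null_comparison)
    show "\<forall>\<^sub>F n in sequentially. norm (hnorm H (X n) - hnorm H f) \<le> hnorm H (X n - f)"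
    proof (rule always_eventually, rule allI)
      fix n
      have m: "X n \<in> elems H" "f \<in> elems H" using assms by (auto simp: converges_def)
      show "norm (hnorm H (X n) - hnorm H f) \<le> hnorm H (X n - f)"
        using m hnorm_triangle_diff[of "X n" f 0] hnorm_triangle_diff[of f "X n" 0] hnorm_minus_commute[of f "X n"]
        by (simp add: abs_le_iff)
    qed
    show "(\<lambda>n. hnorm H (X n - f)) \<longlonglongrightarrow> 0" using assms by (simp add: converges_def)
  qed
  thus ?thesis by (simp add: LIM_zero_iff)
qed

lemma converges_bounded:
  assumes "converges X f" "\<And>n. hnorm H (X n) \<le> M"
  shows "hnorm H f \<le> M"
  using converges_hnorm[OF assms(1)] assms(2) by (meson LIMSEQ_le_const2)

text \<open>
  Completeness in the form in which it is applied: the squared distances, which is what the parallelogram law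
  and expansions of inner products control, are bounded by the terms of a null sequence.
\<close>

lemma cauchy_converges:
  assumes mem: "\<And>n. X n \<in> elems H" and "s \<longlonglongrightarrow> 0"
    and le: "\<And>m n. (hnorm H (X m - X n))\<^sup>2 \<le> s m + s n"
  shows "\<exists>f. converges X f"
proof -
  have "\<exists>N. \<forall>m\<ge>N. \<forall>n\<ge>N. hnorm H (X m - X n) < e" if "e > 0" for e
  proof -
    have "e\<^sup>2 / 2 > 0" using that by simp
    then obtain N where N: "\<And>n. n \<ge> N \<Longrightarrow> \<bar>s n\<bar> < e\<^sup>2 / 2"
      using assms(2) unfolding LIMSEQ_def dist_real_def by (metis diff_zero)
    have "hnorm H (X m - X n) < e" if "m \<ge> N" "n \<ge> N" for m n
    proof -
      have "(hnorm H (X m - X n))\<^sup>2 < e\<^sup>2" using le[of m n] N[OF that(1)] N[OF that(2)] by auto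
      thus ?thesis using \<open>e > 0\<close> power_less_imp_less_base[of _ 2 e] by auto
    qed
    thus ?thesis by blast
  qed
  from complete[OF mem this] show ?thesis using mem by (auto simp: converges_def)
qed

end

section \<open>Bounded operators and their adjoints\<close>

lemma bounded_ops_mem: "T \<in> bounded_ops H K \<Longrightarrow> f \<in> elems H \<Longrightarrow> T f \<in> elems K"
  by (auto simp: bounded_ops_def)

lemma bounded_ops_add: "T (f + g) = T f + T g"
  if "T \<in> bounded_ops H K" "f \<in> elems H" "g \<in> elems H"
  using that by (simp add: bounded_ops_def plus_fun_def)

lemma bounded_ops_smul: "T (c \<cdot> f) = c \<cdot> T f" if "T \<in> bounded_ops H K" "f \<in> elems H"
  using that by (simp add: bounded_ops_def smul_def)

lemma bounded_ops_diff: "T (f - g) = T f - T g"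
  if "T \<in> bounded_ops H K" "hilbert_space H" "f \<in> elems H" "g \<in> elems H"
proof -
  interpret hilbert_space H by fact
  have "f - g = f + (-1) \<cdot> g" by (simp add: fun_eq_iff)
  hence "T (f - g) = T f + (-1) \<cdot> T g"
    using that by (simp only: bounded_ops_add[OF that(1)] bounded_ops_smul[OF that(1)] smul_mem)
  thus ?thesis by (simp add: fun_eq_iff)
qed

lemma bounded_ops_zero: "T 0 = 0" if "T \<in> bounded_ops H K" "hilbert_space H"
  using bounded_ops_diff[OF that, of 0 0] that hilbert_space.zero_mem by auto

lemmas bounded_ops_simps = bounded_ops_mem bounded_ops_add bounded_ops_smul bounded_ops_diff bounded_ops_zero

lemma bounded_ops_bound:
  assumes "hilbert_space H" "T \<in> bounded_ops H K"
  obtains M where "M > 0" "\<And>f. f \<in> elems H \<Longrightarrow> hnorm K (T f) \<le> M * hnorm H f"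
proof -
  interpret hilbert_space H by fact
  obtain M where M: "\<And>f. f \<in> elems H \<Longrightarrow> hnorm K (T f) \<le> M * hnorm H f"
    using assms unfolding bounded_ops_def by blast
  have "hnorm K (T f) \<le> (\<bar>M\<bar> + 1) * hnorm H f" if "f \<in> elems H" for f
    using M[OF that] mult_right_mono[of M "\<bar>M\<bar> + 1" "hnorm H f"] that by fastforce
  thus thesis using that[of "\<bar>M\<bar> + 1"] by simp
qed

lemma bounded_opsI:
  assumes "T \<in> extensional (elems H)" "\<And>f. f \<in> elems H \<Longrightarrow> T f \<in> elems K"
    "\<And>f g. f \<in> elems H \<Longrightarrow> g \<in> elems H \<Longrightarrow> T (f + g) = T f + T g"
    "\<And>c f. f \<in> elems H \<Longrightarrow> T (c \<cdot> f) = c \<cdot> T f"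
    "\<And>f. f \<in> elems H \<Longrightarrow> hnorm K (T f) \<le> M * hnorm H f"
  shows "T \<in> bounded_ops H K"
proof -
  have "\<exists>M. \<forall>f\<in>elems H. hnorm K (T f) \<le> M * hnorm H f" using assms(5) by blast
  thus ?thesis using assms(1-4) unfolding bounded_ops_def by (auto simp: plus_fun_def smul_def PiE_def)
qed

lemma bounded_ops_eqI:
  assumes "S \<in> bounded_ops H K" "T \<in> bounded_ops H K'" "\<And>f. f \<in> elems H \<Longrightarrow> S f = T f"
  shows "S = T"
  using assms extensionalityI[of S "elems H" T] by (auto simp: bounded_ops_def PiE_def)

lemma bounded_ops_compose:
  assumes "hilbert_space H" "hilbert_space K" "S \<in> bounded_ops K L" "T \<in> bounded_ops H K"
  shows "compose (elems H) S T \<in> bounded_ops H L"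
proof -
  interpret H: hilbert_space H by fact
  obtain M where M: "M > 0" "\<And>f. f \<in> elems K \<Longrightarrow> hnorm L (S f) \<le> M * hnorm K f"
    using bounded_ops_bound[OF assms(2,3)] by blast
  obtain N where N: "\<And>f. f \<in> elems H \<Longrightarrow> hnorm K (T f) \<le> N * hnorm H f"
    using bounded_ops_bound[OF assms(1,4)] by blast
  show ?thesis
  proof (rule bounded_opsI[where M = "M * N"])
    fix f assume f: "f \<in> elems H"
    have "hnorm L (S (T f)) \<le> M * hnorm K (T f)" using f M(2) by (simp add: bounded_ops_mem[OF assms(4)])
    also have "\<dots> \<le> M * (N * hnorm H f)" using N[OF f] M(1) by simp
    finally show "hnorm L (compose (elems H) S T f) \<le> M * N * hnorm H f"
      using f by (simp add: compose_def)
  qed (use assms in \<open>auto simp: compose_def bounded_ops_simps[OF assms(3)] bounded_ops_simps[OF assms(4)]\<close>)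
qed

lemma bounded_ops_comb:
  assumes "hilbert_space H" "hilbert_space K" "S \<in> bounded_ops H K" "T \<in> bounded_ops H K"
  shows "(\<lambda>f\<in>elems H. c \<cdot> S f + d \<cdot> T f) \<in> bounded_ops H K"
proof -
  interpret H: hilbert_space H by fact
  interpret K: hilbert_space K by fact
  obtain M where M: "\<And>f. f \<in> elems H \<Longrightarrow> hnorm K (S f) \<le> M * hnorm H f"
    using bounded_ops_bound[OF assms(1,3)] by blast
  obtain N where N: "\<And>f. f \<in> elems H \<Longrightarrow> hnorm K (T f) \<le> N * hnorm H f"
    using bounded_ops_bound[OF assms(1,4)] by blast
  show ?thesis
  proof (rule bounded_opsI[where M = "cmod c * M + cmod d * N"])
    fix f assume f: "f \<in> elems H"
    have "hnorm K (c \<cdot> S f + d \<cdot> T f) \<le> cmod c * hnorm K (S f) + cmod d * hnorm K (T f)"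
      using f K.hnorm_triangle[of "c \<cdot> S f" "d \<cdot> T f"]
      by (simp add: K.hnorm_smul bounded_ops_mem[OF assms(3)] bounded_ops_mem[OF assms(4)])
    also have "\<dots> \<le> cmod c * (M * hnorm H f) + cmod d * (N * hnorm H f)"
      using M[OF f] N[OF f] by (intro add_mono mult_left_mono) auto
    finally show "hnorm K ((\<lambda>f\<in>elems H. c \<cdot> S f + d \<cdot> T f) f) \<le> (cmod c * M + cmod d * N) * hnorm H f"
      using f by (simp add: algebra_simps)
  next
    fix f g assume "f \<in> elems H" "g \<in> elems H"
    thus "(\<lambda>f\<in>elems H. c \<cdot> S f + d \<cdot> T f) (f + g) =
        (\<lambda>f\<in>elems H. c \<cdot> S f + d \<cdot> T f) f + (\<lambda>f\<in>elems H. c \<cdot> S f + d \<cdot> T f) g"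
      by (simp add: bounded_ops_add[OF assms(3)] bounded_ops_add[OF assms(4)] smul_add)
  next
    fix e f assume "f \<in> elems H"
    thus "(\<lambda>f\<in>elems H. c \<cdot> S f + d \<cdot> T f) (e \<cdot> f) = e \<cdot> (\<lambda>f\<in>elems H. c \<cdot> S f + d \<cdot> T f) f"
      by (simp add: bounded_ops_smul[OF assms(3)] bounded_ops_smul[OF assms(4)] smul_add mult_ac)
  qed (use assms in \<open>auto simp: bounded_ops_mem[OF assms(3)] bounded_ops_mem[OF assms(4)]\<close>)
qed

lemma id_op_bounded: "hilbert_space H \<Longrightarrow> id_op (elems H) \<in> bounded_ops H H"
  by (rule bounded_opsI[where M = 1]) (auto simp: id_op_def hilbert_space.add_mem hilbert_space.smul_mem)

lemma scale_op_eq: "scale_op H c T = (\<lambda>f\<in>elems H. c \<cdot> T f)"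
  by (simp add: scale_op_def smul_def)

lemma scale_op_bounded:
  assumes "hilbert_space H" "T \<in> bounded_ops H H"
  shows "scale_op H c T \<in> bounded_ops H H"
  using bounded_ops_comb[OF assms(1,1,2,2), of c 0] by (simp add: scale_op_eq)

context hilbert_space
begin

lemma bounded_ops_converges:
  assumes "hilbert_space K" "T \<in> bounded_ops H K" "converges X f"
  shows "hilbert_space.converges K (\<lambda>n. T (X n)) (T f)"
proof -
  interpret K: hilbert_space K by fact
  obtain M where M: "\<And>f. f \<in> elems H \<Longrightarrow> hnorm K (T f) \<le> M * hnorm H f"
    using bounded_ops_bound[OF hilbert_space_axioms assms(2)] by blast
  have m: "X n \<in> elems H" "f \<in> elems H" for n using assms(3) by (auto simp: converges_def)
  have "(\<lambda>n. hnorm K (T (X n) - T f)) \<longlonglongrightarrow> 0"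
  proof (rule Lim_null_comparison)
    show "\<forall>\<^sub>F n in sequentially. norm (hnorm K (T (X n) - T f)) \<le> M * hnorm H (X n - f)"
    proof (rule always_eventually, rule allI)
      fix n
      show "norm (hnorm K (T (X n) - T f)) \<le> M * hnorm H (X n - f)"
        using m(1)[of n] m(2) M[of "X n - f"] K.hnorm_nonneg[of "T (X n - f)"] bounded_ops_mem[OF assms(2), of "X n - f"]
        by (simp add: bounded_ops_diff[OF assms(2) hilbert_space_axioms])
    qed
    show "(\<lambda>n. M * hnorm H (X n - f)) \<longlonglongrightarrow> 0"
      using assms(3) by (auto simp: converges_def intro: tendsto_mult_right_zero)
  qed
  thus ?thesis using m by (simp add: K.converges_def bounded_ops_mem[OF assms(2)])
qed

text \<open>
  Limits of operators are constructed pointwise here; the uniform bound makes the limit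
  bounded.
\<close>

lemma strong_limit_bounded:
  assumes "hilbert_space K" "\<And>n. T n \<in> bounded_ops H K"
    "\<And>f. f \<in> elems H \<Longrightarrow> hilbert_space.converges K (\<lambda>n. T n f) (S f)"
    "\<And>n f. f \<in> elems H \<Longrightarrow> hnorm K (T n f) \<le> M * hnorm H f"
  shows "restrict S (elems H) \<in> bounded_ops H K"
proof -
  interpret K: hilbert_space K by fact
  show ?thesis
  proof (rule bounded_opsI[where M = M])
    show "restrict S (elems H) f \<in> elems K" if "f \<in> elems H" for f
      using assms(3)[OF that] that by (simp add: K.converges_def)
    show "restrict S (elems H) (f + g) = restrict S (elems H) f + restrict S (elems H) g"
      if "f \<in> elems H" "g \<in> elems H" for f g
      using assms(3)[of "f + g"] K.converges_add[OF assms(3)[of f] assms(3)[of g]] that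
      by (auto simp: bounded_ops_add[OF assms(2)] intro: K.converges_unique)
    show "restrict S (elems H) (c \<cdot> f) = c \<cdot> restrict S (elems H) f" if "f \<in> elems H" for c f
    proof -
      have "(\<lambda>g\<in>elems K. c \<cdot> g + 0 \<cdot> g) \<in> bounded_ops K K"
        using bounded_ops_comb[OF assms(1,1) id_op_bounded[OF assms(1)] id_op_bounded[OF assms(1)], of c 0]
        by (simp add: id_op_def cong: restrict_cong)
      from K.bounded_ops_converges[OF assms(1) this assms(3)[OF that]]
      have "K.converges (\<lambda>n. c \<cdot> T n f) (c \<cdot> S f)"
        using bounded_ops_mem[OF assms(2) that] K.converges_mem(2)[OF assms(3)[OF that]] by simp
      moreover have "K.converges (\<lambda>n. c \<cdot> T n f) (S (c \<cdot> f))"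
        using assms(3)[of "c \<cdot> f"] that by (simp add: bounded_ops_smul[OF assms(2)])
      ultimately show ?thesis using that K.converges_unique by simp
    qed
    show "hnorm K (restrict S (elems H) f) \<le> M * hnorm H f" if "f \<in> elems H" for f
      using K.converges_bounded[OF assms(3)[OF that] assms(4)[OF that]] that by simp
  qed simp
qed

text \<open>
  The representing vector minimises \<open>J f = \<parallel>f\<parallel>\<^sup>2 - 2 Re (L f)\<close>. A minimising sequence is Cauchy
  by the parallelogram law, and the first variation of \<open>J\<close> at the minimum vanishes.
\<close>

lemma riesz_representation:
  assumes add: "\<And>f g. f \<in> elems H \<Longrightarrow> g \<in> elems H \<Longrightarrow> L (f + g) = L f + L g"
    and smul: "\<And>c f. f \<in> elems H \<Longrightarrow> L (c \<cdot> f) = c * L f"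
    and bound: "\<And>f. f \<in> elems H \<Longrightarrow> cmod (L f) \<le> M * hnorm H f"
  shows "\<exists>g\<in>elems H. \<forall>f\<in>elems H. L f = ip H f g"
proof -
  define J where "J f = (hnorm H f)\<^sup>2 - 2 * Re (L f)" for f
  define m where "m = Inf (J ` elems H)"
  have lower: "- M\<^sup>2 \<le> J f" if "f \<in> elems H" for f
  proof -
    have "Re (L f) \<le> M * hnorm H f" using bound[OF that] complex_Re_le_cmod[of "L f"] by linarith
    moreover have "0 \<le> (hnorm H f - M)\<^sup>2" by simp
    ultimately show ?thesis by (simp add: J_def power2_diff algebra_simps)
  qed
  have m_le: "m \<le> J f" if "f \<in> elems H" for f
    unfolding m_def by (rule cInf_lower) (use lower that in \<open>auto simp: bdd_below_def\<close>)
  have "\<exists>f\<in>elems H. J f < m + inverse (real (Suc n))" for n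
    using cInf_lessD[of "J ` elems H" "m + inverse (real (Suc n))"] zero_mem unfolding m_def
    by (metis (no_types, lifting) empty_iff image_iff image_is_empty inverse_positive_iff_positive less_add_same_cancel1 of_nat_0_less_iff zero_less_Suc)
  then obtain X where X: "\<And>n. X n \<in> elems H" "\<And>n. J (X n) < m + inverse (real (Suc n))" by metis
  have "\<exists>g. converges X g"
  proof (rule cauchy_converges)
    show "(\<lambda>n. 2 * inverse (real (Suc n))) \<longlonglongrightarrow> 0"
      by (intro tendsto_mult_right_zero LIMSEQ_inverse_real_of_nat)
    fix k l
    have e: "(hnorm H ((1/2) \<cdot> (X k + X l)))\<^sup>2 = (hnorm H (X k + X l))\<^sup>2 / 4"
      using X(1) by (simp add: hnorm_smul power_divide norm_divide)
    have "m \<le> J ((1/2) \<cdot> (X k + X l))" using X(1) by (simp add: m_le)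
    also have "\<dots> = (hnorm H (X k + X l))\<^sup>2 / 4 - Re (L (X k)) - Re (L (X l))"
      using X(1) by (simp add: J_def e smul add field_simps)
    finally have "(hnorm H (X k - X l))\<^sup>2 \<le> 2 * (J (X k) - m) + 2 * (J (X l) - m)"
      using parallelogram[OF X(1) X(1), of k l] by (simp add: J_def)
    also have "\<dots> \<le> 2 * inverse (real (Suc k)) + 2 * inverse (real (Suc l))"
      using less_imp_le[OF X(2)[of k]] less_imp_le[OF X(2)[of l]] by (intro add_mono mult_left_mono) auto
    finally show "(hnorm H (X k - X l))\<^sup>2 \<le> 2 * inverse (real (Suc k)) + 2 * inverse (real (Suc l))" .
  qed (use X in auto)
  then obtain g where g: "converges X g" by blast
  hence gm: "g \<in> elems H" by (simp add: converges_def)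
  have "(\<lambda>n. L (X n) - L g) \<longlonglongrightarrow> 0"
  proof (rule Lim_null_comparison)
    have "L (X n) - L g = L (X n - g)" for n
      using add[of "X n - g" g] X(1) gm by simp
    thus "\<forall>\<^sub>F n in sequentially. norm (L (X n) - L g) \<le> M * hnorm H (X n - g)"
      using bound[of "X _ - g"] X(1) gm by simp
    show "(\<lambda>n. M * hnorm H (X n - g)) \<longlonglongrightarrow> 0"
      using g by (auto simp: converges_def intro: tendsto_mult_right_zero)
  qed
  hence "(\<lambda>n. L (X n)) \<longlonglongrightarrow> L g" by (simp add: LIM_zero_iff)
  hence "(\<lambda>n. J (X n)) \<longlonglongrightarrow> J g"
    unfolding J_def by (intro tendsto_intros converges_hnorm[OF g])
  moreover have "(\<lambda>n. m + inverse (real (Suc n))) \<longlonglongrightarrow> m + 0"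
    by (intro tendsto_intros LIMSEQ_inverse_real_of_nat)
  ultimately have Jg: "J g \<le> m"
    using X(2) by (intro LIMSEQ_le[of "\<lambda>n. J (X n)" _ "\<lambda>n. m + inverse (real (Suc n))"]) (auto intro: less_imp_le)
  \<comment> \<open>First variation: the quadratic polynomial in t obtained from the minimality has no constant term.\<close>
  have "L h = ip H h g" if h: "h \<in> elems H" for h
  proof -
    have "0 \<le> 0 + 2 * Re (t * (ip H h g - L h)) + (cmod t)\<^sup>2 * (hnorm H h)\<^sup>2" for t
    proof -
      have "(hnorm H (g + t \<cdot> h))\<^sup>2 = (hnorm H g)\<^sup>2 + 2 * Re (t * ip H h g) + (hnorm H (t \<cdot> h))\<^sup>2"
        using h gm ip_commute[of h g] hnorm_sq[of "t \<cdot> h"] by (simp add: hnorm_sq ip_linear algebra_simps)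
      moreover have "J g \<le> J (g + t \<cdot> h)" using Jg m_le[of "g + t \<cdot> h"] h gm by simp
      ultimately show ?thesis using h gm
        by (simp add: J_def hnorm_smul power_mult_distrib add smul algebra_simps)
    qed
    from quadratic_discriminant[OF this] show ?thesis by simp
  qed
  thus ?thesis using gm by blast
qed

lemma adj_eqI:
  assumes "S \<in> bounded_ops K H"
    "\<And>f g. f \<in> elems H \<Longrightarrow> g \<in> elems K \<Longrightarrow> ip K (T f) g = ip H f (S g)"
  shows "adj H K T = S"
  unfolding adj_def
proof (rule the_equality)
  fix R assume R: "R \<in> bounded_ops K H \<and> (\<forall>f\<in>elems H. \<forall>g\<in>elems K. ip K (T f) g = ip H f (R g))"
  show "R = S"
  proof (rule bounded_ops_eqI)
    fix g assume g: "g \<in> elems K"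
    show "R g = S g"
      using R assms g by (intro eq_if_ip_eq bounded_ops_mem[OF _ g]) auto
  qed (use R assms in auto)
qed (use assms in auto)

text \<open>
  The bound of the adjoint comes from \<open>\<parallel>S g\<parallel>\<^sup>2 = \<langle>T (S g), g\<rangle> \<le> M \<parallel>S g\<parallel> \<parallel>g\<parallel>\<close>.
\<close>

lemma adj_exists:
  assumes "hilbert_space K" "T \<in> bounded_ops H K"
  shows "\<exists>S\<in>bounded_ops K H. \<forall>f\<in>elems H. \<forall>g\<in>elems K. ip K (T f) g = ip H f (S g)"
proof -
  interpret K: hilbert_space K by fact
  obtain M where M: "M > 0" "\<And>f. f \<in> elems H \<Longrightarrow> hnorm K (T f) \<le> M * hnorm H f"
    using bounded_ops_bound[OF hilbert_space_axioms assms(2)] by blast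
  have "\<exists>h\<in>elems H. \<forall>f\<in>elems H. ip K (T f) g = ip H f h" if g: "g \<in> elems K" for g
  proof (rule riesz_representation[where M = "M * hnorm K g"])
    fix f assume f: "f \<in> elems H"
    have "cmod (ip K (T f) g) \<le> hnorm K (T f) * hnorm K g"
      using f g by (intro K.cauchy_schwarz) (auto simp: bounded_ops_mem[OF assms(2)])
    also have "\<dots> \<le> M * hnorm H f * hnorm K g" using M(2)[OF f] g by (intro mult_right_mono) auto
    finally show "cmod (ip K (T f) g) \<le> M * hnorm K g * hnorm H f" by (simp add: mult_ac)
  qed (use g in \<open>auto simp: bounded_ops_simps[OF assms(2)] K.ip_linear\<close>)
  then obtain S where S: "\<And>g. g \<in> elems K \<Longrightarrow> S g \<in> elems H"
    "\<And>f g. f \<in> elems H \<Longrightarrow> g \<in> elems K \<Longrightarrow> ip K (T f) g = ip H f (S g)" by metis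
  have "restrict S (elems K) \<in> bounded_ops K H"
  proof (rule bounded_opsI[where M = M])
    show "restrict S (elems K) (f + g) = restrict S (elems K) f + restrict S (elems K) g"
      if "f \<in> elems K" "g \<in> elems K" for f g
      by (rule eq_if_ip_eq)
         (use that S in \<open>auto simp: ip_linear S(2)[symmetric] K.ip_linear bounded_ops_mem[OF assms(2)]\<close>)
    show "restrict S (elems K) (c \<cdot> g) = c \<cdot> restrict S (elems K) g" if "g \<in> elems K" for c g
      by (rule eq_if_ip_eq)
         (use that S in \<open>auto simp: ip_linear S(2)[symmetric] K.ip_linear bounded_ops_mem[OF assms(2)]\<close>)
    show "hnorm H (restrict S (elems K) g) \<le> M * hnorm K g" if g: "g \<in> elems K" for g
    proof (cases "hnorm H (S g) = 0")
      case False
      have p: "0 < hnorm H (S g)" using hnorm_nonneg[OF S(1)[OF g]] False by linarith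
      have "(hnorm H (S g))\<^sup>2 = Re (ip K (T (S g)) g)" using S g by (simp add: hnorm_sq)
      also have "\<dots> \<le> hnorm K (T (S g)) * hnorm K g"
        using K.cauchy_schwarz[of "T (S g)" g] complex_Re_le_cmod[of "ip K (T (S g)) g"] S(1)[OF g] g
        by (simp add: bounded_ops_mem[OF assms(2)])
      also have "\<dots> \<le> M * hnorm H (S g) * hnorm K g" using M(2) S(1) g by (intro mult_right_mono) auto
      finally have "hnorm H (S g) * hnorm H (S g) \<le> (M * hnorm K g) * hnorm H (S g)"
        by (simp add: power2_eq_square mult_ac)
      thus ?thesis using p g by simp
    qed (use g M in simp)
  qed (use S in auto)
  thus ?thesis using S by (intro bexI[of _ "restrict S (elems K)"]) auto
qed

lemma adj_spec:
  assumes "hilbert_space K" "T \<in> bounded_ops H K"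
  shows adj_bounded: "adj H K T \<in> bounded_ops K H"
    and ip_adj: "\<And>f g. f \<in> elems H \<Longrightarrow> g \<in> elems K \<Longrightarrow> ip K (T f) g = ip H f (adj H K T g)"
proof -
  obtain S where "S \<in> bounded_ops K H" "\<And>f g. f \<in> elems H \<Longrightarrow> g \<in> elems K \<Longrightarrow> ip K (T f) g = ip H f (S g)"
    using adj_exists[OF assms] by blast
  with adj_eqI[of S K T] show "adj H K T \<in> bounded_ops K H"
    "\<And>f g. f \<in> elems H \<Longrightarrow> g \<in> elems K \<Longrightarrow> ip K (T f) g = ip H f (adj H K T g)"
    by auto
qed

lemma ip_adj_left:
  assumes "hilbert_space K" "T \<in> bounded_ops H K" "f \<in> elems H" "g \<in> elems K"
  shows "ip H (adj H K T g) f = ip K g (T f)"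
  using ip_adj[OF assms] ip_commute[of f "adj H K T g"] hilbert_space.ip_commute[OF assms(1), of "T f" g]
    bounded_ops_mem[OF adj_bounded[OF assms(1,2)]] bounded_ops_mem[OF assms(2)] assms(3,4) by simp

end

section \<open>Positive operators and their square roots\<close>

context hilbert_space
begin

lemma positive_opsD:
  assumes "P \<in> positive_ops H"
  shows positive_ops_bounded: "P \<in> bounded_ops H H"
    and positive_ops_Re: "\<And>f. f \<in> elems H \<Longrightarrow> 0 \<le> Re (ip H (P f) f)"
    and positive_ops_Im: "\<And>f. f \<in> elems H \<Longrightarrow> Im (ip H (P f) f) = 0"
  using assms by (auto simp: positive_ops_def complex_nonneg_Reals_iff)

text \<open>
  Polarisation: over the complex numbers, real values of \<open>\<langle>P f, f\<rangle>\<close> already force symmetry, as one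
  sees from \<open>f + g\<close> and \<open>f + \<i> g\<close>.
\<close>

lemma positive_ops_symmetric:
  assumes P: "P \<in> positive_ops H" and m: "f \<in> elems H" "g \<in> elems H"
  shows "ip H (P f) g = ip H f (P g)"
proof -
  note lin = bounded_ops_simps[OF positive_ops_bounded[OF P]]
  have 1: "Im (ip H (P (f + g)) (f + g)) = 0" "Im (ip H (P (f + \<i> \<cdot> g)) (f + \<i> \<cdot> g)) = 0"
    using m by (auto intro!: positive_ops_Im[OF P])
  have "ip H (P f) g = cnj (ip H (P g) f)"
    using 1 positive_ops_Im[OF P m(1)] positive_ops_Im[OF P m(2)] m
    by (simp add: lin ip_linear complex_eq_iff)
  also have "\<dots> = ip H f (P g)" using m ip_commute[of "P g" f] by (simp add: lin)
  finally show ?thesis .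
qed

lemma positive_opsI:
  assumes "P \<in> bounded_ops H H" "\<And>f g. f \<in> elems H \<Longrightarrow> g \<in> elems H \<Longrightarrow> ip H (P f) g = ip H f (P g)"
    "\<And>f. f \<in> elems H \<Longrightarrow> 0 \<le> Re (ip H (P f) f)"
  shows "P \<in> positive_ops H"
proof -
  have "Im (ip H (P f) f) = 0" if "f \<in> elems H" for f
    using assms(2)[OF that that] ip_commute[of "P f" f] bounded_ops_mem[OF assms(1) that] that
    by (simp add: complex_eq_iff)
  thus ?thesis using assms by (simp add: positive_ops_def complex_nonneg_Reals_iff)
qed

lemma positive_ops_cauchy_schwarz:
  assumes P: "P \<in> positive_ops H" and m: "f \<in> elems H" "g \<in> elems H"
  shows "(cmod (ip H (P f) g))\<^sup>2 \<le> Re (ip H (P f) f) * Re (ip H (P g) g)"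
proof -
  note lin = bounded_ops_simps[OF positive_ops_bounded[OF P]]
  show ?thesis
  proof (rule positive_form_cauchy_schwarz[where q = "\<lambda>f. ip H (P f)" and E = "elems H" and f = f and g = g])
    fix u v assume uv: "u \<in> elems H" "v \<in> elems H"
    show "ip H (P v) u = cnj (ip H (P u) v)"
      using positive_ops_symmetric[OF P uv(2,1)] ip_commute[of "P u" v] uv by (simp add: lin)
  qed (use m in \<open>auto simp: lin ip_linear positive_ops_Re[OF P]\<close>)
qed

text \<open>
  The Cauchy--Schwarz inequality for \<open>\<langle>P f, g\<rangle>\<close> at \<open>g = P f\<close>. This is the operator inequality
  \<open>P\<^sup>2 \<le> P\<close>, the source of all monotonicity below.
\<close>

lemma positive_contraction:
  assumes P: "P \<in> positive_ops H" and c: "\<And>f. f \<in> elems H \<Longrightarrow> hnorm H (P f) \<le> hnorm H f" and f: "f \<in> elems H"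
  shows "(hnorm H (P f))\<^sup>2 \<le> Re (ip H (P f) f)"
proof (cases "hnorm H (P f) = 0")
  case False
  note lin = bounded_ops_simps[OF positive_ops_bounded[OF P]]
  have Pf: "P f \<in> elems H" "P (P f) \<in> elems H" using f by (auto simp: lin)
  have "((hnorm H (P f))\<^sup>2)\<^sup>2 = (cmod (ip H (P f) (P f)))\<^sup>2"
    by (simp add: ip_self Pf norm_power)
  also have "\<dots> \<le> Re (ip H (P f) f) * Re (ip H (P (P f)) (P f))"
    by (rule positive_ops_cauchy_schwarz[OF P f Pf(1)])
  also have "\<dots> \<le> Re (ip H (P f) f) * (hnorm H (P f))\<^sup>2"
  proof (rule mult_left_mono[OF _ positive_ops_Re[OF P f]])
    have "Re (ip H (P (P f)) (P f)) \<le> hnorm H (P (P f)) * hnorm H (P f)"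
      using cauchy_schwarz[OF Pf(2,1)] complex_Re_le_cmod[of "ip H (P (P f)) (P f)"] by linarith
    also have "\<dots> \<le> hnorm H (P f) * hnorm H (P f)" using c[OF Pf(1)] Pf by (intro mult_right_mono) auto
    finally show "Re (ip H (P (P f)) (P f)) \<le> (hnorm H (P f))\<^sup>2" by (simp add: power2_eq_square)
  qed
  finally have "(hnorm H (P f))\<^sup>2 * (hnorm H (P f))\<^sup>2 \<le> Re (ip H (P f) f) * (hnorm H (P f))\<^sup>2"
    by (simp only: power2_eq_square)
  moreover have "0 < (hnorm H (P f))\<^sup>2" using False by simp
  ultimately show ?thesis by (rule mult_right_le_imp_le)
qed (use positive_ops_Re[OF P f] in simp)

definition complement_op where
  "complement_op A = (\<lambda>f\<in>elems H. f - A f)"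

lemma complement_op_bounded:
  assumes "A \<in> bounded_ops H H"
  shows "complement_op A \<in> bounded_ops H H"
proof -
  have "complement_op A = (\<lambda>f\<in>elems H. 1 \<cdot> id_op (elems H) f + (-1) \<cdot> A f)"
    by (auto simp: complement_op_def id_op_def fun_eq_iff)
  thus ?thesis
    using bounded_ops_comb[OF hilbert_space_axioms hilbert_space_axioms
        id_op_bounded[OF hilbert_space_axioms] assms, of 1 "-1"] by simp
qed

lemma complement_positive_contraction:
  assumes P: "P \<in> positive_ops H" and c: "\<And>f. f \<in> elems H \<Longrightarrow> hnorm H (P f) \<le> hnorm H f"
  shows "complement_op P \<in> positive_ops H"
    and "\<And>f. f \<in> elems H \<Longrightarrow> hnorm H (complement_op P f) \<le> hnorm H f"
proof -
  note lin = bounded_ops_simps[OF positive_ops_bounded[OF P]]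
  show "complement_op P \<in> positive_ops H"
  proof (rule positive_opsI[OF complement_op_bounded[OF positive_ops_bounded[OF P]]])
    fix f assume f: "f \<in> elems H"
    have "Re (ip H (P f) f) \<le> hnorm H (P f) * hnorm H f"
      using cauchy_schwarz[of "P f" f] f complex_Re_le_cmod[of "ip H (P f) f"] by (simp add: lin)
    also have "\<dots> \<le> hnorm H f * hnorm H f" using c[OF f] f by (intro mult_right_mono) auto
    finally show "0 \<le> Re (ip H (complement_op P f) f)"
      using f hnorm_sq[OF f] by (simp add: complement_op_def lin ip_linear power2_eq_square)
  qed (auto simp: complement_op_def lin ip_linear positive_ops_symmetric[OF P])
  fix f assume f: "f \<in> elems H"
  have "(hnorm H (f - P f))\<^sup>2 = (hnorm H f)\<^sup>2 - 2 * Re (ip H (P f) f) + (hnorm H (P f))\<^sup>2"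
    using f positive_ops_symmetric[OF P f f] by (simp add: lin hnorm_sq ip_linear)
  also have "\<dots> \<le> (hnorm H f)\<^sup>2" using positive_contraction[OF P c f] positive_ops_Re[OF P f] by simp
  finally show "hnorm H (complement_op P f) \<le> hnorm H f"
    using f by (auto simp: complement_op_def intro: power2_le_imp_le)
qed

subsection \<open>Existence of square roots\<close>

text \<open>
  The iteration \<open>Y\<^sub>n\<^sub>+\<^sub>1 = (B + Y\<^sub>n\<^sup>2) / 2\<close> with \<open>Y\<^sub>0 = 0\<close>. A fixed point \<open>Y\<close> satisfies
  \<open>(1 - Y)\<^sup>2 = 1 - B\<close>. The starting value is written as a combination of \<open>B\<close> so that it is visibly
  a bounded operator.
\<close>

definition sqrt_iter where
  "sqrt_iter B n =
    ((\<lambda>Y. \<lambda>f\<in>elems H. (1/2) \<cdot> B f + (1/2) \<cdot> Y (Y f)) ^^ n) (\<lambda>f\<in>elems H. 0 \<cdot> B f + 0 \<cdot> B f)"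

end

text \<open>
  The same iteration for \<open>B = 1\<close>, a bounded increasing sequence of numbers. It dominates the
  operator iteration when \<open>B\<close> is a contraction.
\<close>

primrec sqrt_bound :: "nat \<Rightarrow> real" where
  "sqrt_bound 0 = 0"
| "sqrt_bound (Suc n) = (1 + (sqrt_bound n)\<^sup>2) / 2"

lemma sqrt_bound_range: "0 \<le> sqrt_bound n" "sqrt_bound n \<le> 1"
proof -
  have "0 \<le> sqrt_bound n \<and> sqrt_bound n \<le> 1" by (induction n) (auto simp: power_le_one)
  thus "0 \<le> sqrt_bound n" "sqrt_bound n \<le> 1" by auto
qed

lemma sqrt_bound_mono: "m \<le> n \<Longrightarrow> sqrt_bound m \<le> sqrt_bound n"
proof (rule lift_Suc_mono_le[of sqrt_bound])
  fix n
  have "0 \<le> (1 - sqrt_bound n)\<^sup>2" by simp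
  thus "sqrt_bound n \<le> sqrt_bound (Suc n)" by (simp add: power2_diff field_simps)
qed

lemma sqrt_bound_limit: "\<exists>L. sqrt_bound \<longlonglongrightarrow> L \<and> (\<forall>n. sqrt_bound n \<le> L) \<and> L \<le> 1"
proof -
  obtain L where L: "sqrt_bound \<longlonglongrightarrow> L" "\<And>n. sqrt_bound n \<le> L"
    using incseq_convergent[of sqrt_bound 1] sqrt_bound_range sqrt_bound_mono
    by (auto simp: incseq_def)
  moreover have "L \<le> 1" using L(1) sqrt_bound_range by (meson LIMSEQ_le_const2)
  ultimately show ?thesis by blast
qed

locale selfadjoint_contraction = hilbert_space +
  fixes B
  assumes bounded: "B \<in> bounded_ops H H"
    and contraction: "f \<in> elems H \<Longrightarrow> hnorm H (B f) \<le> hnorm H f"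
    and symmetric: "f \<in> elems H \<Longrightarrow> g \<in> elems H \<Longrightarrow> ip H (B f) g = ip H f (B g)"
begin

abbreviation "Y \<equiv> sqrt_iter B"

lemma Y_rec: "Y (Suc n) = (\<lambda>f\<in>elems H. (1/2) \<cdot> B f + (1/2) \<cdot> compose (elems H) (Y n) (Y n) f)"
  by (auto simp: sqrt_iter_def compose_def restrict_def)

lemma Y_0: "f \<in> elems H \<Longrightarrow> Y 0 f = 0"
  by (simp add: sqrt_iter_def)

lemma Y_bounded: "Y n \<in> bounded_ops H H"
proof (induction n)
  case 0
  show ?case using bounded_ops_comb[OF hilbert_space_axioms hilbert_space_axioms bounded bounded]
    by (simp only: sqrt_iter_def funpow.simps id_apply)
next
  case (Suc n)
  show ?case unfolding Y_rec
    by (intro bounded_ops_comb bounded_ops_compose[where K = H] hilbert_space_axioms bounded Suc)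
qed

lemmas B_lin = bounded_ops_simps[OF bounded]
lemmas Y_lin = bounded_ops_simps[OF Y_bounded]

lemma Y_Suc: "f \<in> elems H \<Longrightarrow> Y (Suc n) f = (1/2) \<cdot> (B f + Y n (Y n f))"
  by (simp add: Y_rec compose_def smul_add)

lemma Y_hnorm: "f \<in> elems H \<Longrightarrow> hnorm H (Y n f) \<le> sqrt_bound n * hnorm H f"
proof (induction n arbitrary: f)
  case (Suc n)
  have "hnorm H (Y n (Y n f)) \<le> sqrt_bound n * hnorm H (Y n f)" using Suc by (simp add: Y_lin)
  also have "\<dots> \<le> sqrt_bound n * (sqrt_bound n * hnorm H f)"
    using Suc sqrt_bound_range by (intro mult_left_mono) auto
  finally have "hnorm H (B f + Y n (Y n f)) \<le> (1 + (sqrt_bound n)\<^sup>2) * hnorm H f"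
    using hnorm_triangle[of "B f" "Y n (Y n f)"] contraction[OF Suc.prems] Suc.prems
    by (simp add: B_lin Y_lin power2_eq_square algebra_simps)
  moreover have "hnorm H (Y (Suc n) f) = hnorm H (B f + Y n (Y n f)) / 2"
    unfolding Y_Suc[OF Suc.prems] using Suc.prems by (subst hnorm_smul) (auto simp: B_lin Y_lin norm_divide)
  ultimately show ?case by simp
qed (simp add: Y_0)

lemma Y_symmetric: "f \<in> elems H \<Longrightarrow> g \<in> elems H \<Longrightarrow> ip H (Y n f) g = ip H f (Y n g)"
  by (induction n arbitrary: f g) (auto simp: Y_0 Y_Suc ip_linear B_lin Y_lin symmetric)

text \<open>
  Every \<open>Y\<^sub>n\<close> is a polynomial in \<open>B\<close>, so it commutes with whatever commutes with \<open>B\<close>. In the limit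
  this yields a square root with the same property, which is what uniqueness rests on.
\<close>

lemma Y_commute:
  assumes "R \<in> bounded_ops H H" "\<And>f. f \<in> elems H \<Longrightarrow> R (B f) = B (R f)" "f \<in> elems H"
  shows "R (Y n f) = Y n (R f)"
  using assms(3)
proof (induction n arbitrary: f)
  case 0
  thus "R (Y 0 f) = Y 0 (R f)"
    using bounded_ops_zero[OF assms(1) hilbert_space_axioms] by (simp add: Y_0 bounded_ops_mem[OF assms(1)])
next
  case (Suc n)
  thus "R (Y (Suc n) f) = Y (Suc n) (R f)"
    by (simp add: Y_Suc bounded_ops_simps[OF assms(1)] B_lin Y_lin assms(2))
qed

lemma Y_Y_commute: "f \<in> elems H \<Longrightarrow> Y m (Y n f) = Y n (Y m f)"
  by (rule Y_commute[OF Y_bounded]) (simp add: Y_commute[OF bounded])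

text \<open>
  As the iterates commute, \<open>Y\<^sub>n\<^sub>+\<^sub>2 - Y\<^sub>n\<^sub>+\<^sub>1 = (Y\<^sub>n\<^sub>+\<^sub>1 - Y\<^sub>n) (Y\<^sub>n\<^sub>+\<^sub>1 + Y\<^sub>n) / 2\<close>, and the
  numerical iteration satisfies the same identity. So convergence holds in
  operator norm and needs no monotone convergence theorem for operators.
\<close>

lemma Y_step: "f \<in> elems H \<Longrightarrow> hnorm H (Y (Suc n) f - Y n f) \<le> (sqrt_bound (Suc n) - sqrt_bound n) * hnorm H f"
proof (induction n arbitrary: f)
  case 0
  have "Y (Suc 0) f - Y 0 f = (1/2) \<cdot> B f"
    using 0 by (simp add: Y_Suc Y_0 B_lin(1) Y_lin(5)[OF hilbert_space_axioms])
  thus "hnorm H (Y (Suc 0) f - Y 0 f) \<le> (sqrt_bound (Suc 0) - sqrt_bound 0) * hnorm H f"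
    using 0 contraction[of f] by (simp add: hnorm_smul B_lin norm_divide)
next
  case (Suc n)
  let ?g = "Y (Suc n) f + Y n f"
  have g: "?g \<in> elems H" using Suc.prems Y_lin(1)[of f] by (intro add_mem) auto
  have "Y (Suc (Suc n)) f - Y (Suc n) f = (1/2) \<cdot> (Y (Suc n) (Y (Suc n) f) - Y n (Y n f))"
    unfolding Y_Suc[OF Suc.prems, of "Suc n"] Y_Suc[OF Suc.prems, of n] by (simp add: fun_eq_iff algebra_simps)
  also have "\<dots> = (1/2) \<cdot> (Y (Suc n) ?g - Y n ?g)"
    using Suc.prems Y_Y_commute[OF Suc.prems, of n "Suc n"]
    by (simp add: Y_lin(2)[OF Y_lin(1) Y_lin(1)])
  finally have "hnorm H (Y (Suc (Suc n)) f - Y (Suc n) f) = hnorm H (Y (Suc n) ?g - Y n ?g) / 2"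
    using Y_lin(1)[OF g, of n] Y_lin(1)[OF g, of "Suc n"]
    by (simp add: hnorm_smul norm_divide)
  also have "\<dots> \<le> (sqrt_bound (Suc n) - sqrt_bound n) * hnorm H ?g / 2"
    by (intro divide_right_mono Suc.IH[OF g]) simp
  also have "\<dots> \<le> (sqrt_bound (Suc n) - sqrt_bound n) * ((sqrt_bound (Suc n) + sqrt_bound n) * hnorm H f) / 2"
  proof -
    have "hnorm H ?g \<le> hnorm H (Y (Suc n) f) + hnorm H (Y n f)"
      by (rule hnorm_triangle[OF Y_lin(1) Y_lin(1)]) (use Suc.prems in auto)
    also have "\<dots> \<le> (sqrt_bound (Suc n) + sqrt_bound n) * hnorm H f"
      using Y_hnorm[OF Suc.prems, of n] Y_hnorm[OF Suc.prems, of "Suc n"] by (simp add: distrib_right del: sqrt_bound.simps)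
    finally show ?thesis using sqrt_bound_mono[of n "Suc n"]
      by (intro divide_right_mono mult_left_mono) (auto simp del: sqrt_bound.simps)
  qed
  also have "\<dots> = (sqrt_bound (Suc (Suc n)) - sqrt_bound (Suc n)) * hnorm H f"
    unfolding sqrt_bound.simps(2)[of "Suc n"] sqrt_bound.simps(2)[of n]
    by (simp add: power2_eq_square field_simps)
  finally show ?case .
qed

lemma Y_diff: "m \<le> n \<Longrightarrow> f \<in> elems H \<Longrightarrow> hnorm H (Y n f - Y m f) \<le> (sqrt_bound n - sqrt_bound m) * hnorm H f"
proof (induction n rule: dec_induct)
  case (step n)
  have "hnorm H (Y (Suc n) f - Y m f) \<le> hnorm H (Y (Suc n) f - Y n f) + hnorm H (Y n f - Y m f)"
    by (rule hnorm_triangle_diff[OF Y_lin(1) Y_lin(1) Y_lin(1)]) (use step.prems in auto)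
  moreover have "hnorm H (Y n f - Y m f) \<le> (sqrt_bound n - sqrt_bound m) * hnorm H f"
    by (rule step.IH[OF step.prems])
  ultimately show "hnorm H (Y (Suc n) f - Y m f) \<le> (sqrt_bound (Suc n) - sqrt_bound m) * hnorm H f"
    using Y_step[OF step.prems, of n] by (simp add: algebra_simps del: sqrt_bound.simps)
qed simp

lemma Y_converges:
  assumes f: "f \<in> elems H"
  shows "\<exists>g. converges (\<lambda>n. Y n f) g"
proof -
  obtain L where L: "sqrt_bound \<longlonglongrightarrow> L" "\<And>n. sqrt_bound n \<le> L" "L \<le> 1" using sqrt_bound_limit by blast
  show ?thesis
  proof (rule cauchy_converges)
    have "(\<lambda>n. (L - sqrt_bound n) * (hnorm H f)\<^sup>2) \<longlonglongrightarrow> (L - L) * (hnorm H f)\<^sup>2"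
      by (intro tendsto_intros L)
    thus "(\<lambda>n. (L - sqrt_bound n) * (hnorm H f)\<^sup>2) \<longlonglongrightarrow> 0" by simp
    have *: "(hnorm H (Y n f - Y m f))\<^sup>2 \<le> (L - sqrt_bound m) * (hnorm H f)\<^sup>2" if "m \<le> n" for m n
    proof -
      let ?d = "sqrt_bound n - sqrt_bound m"
      have d: "0 \<le> ?d" "?d \<le> 1" "?d \<le> L - sqrt_bound m"
        using sqrt_bound_mono[OF that] L(2)[of n] sqrt_bound_range[of n] sqrt_bound_range[of m] by auto
      have "(hnorm H (Y n f - Y m f))\<^sup>2 \<le> (?d * hnorm H f)\<^sup>2"
        by (rule power_mono[OF Y_diff[OF that f]]) (use f in \<open>auto simp: Y_lin\<close>)
      also have "\<dots> = (?d * ?d) * (hnorm H f)\<^sup>2" by (simp add: power2_eq_square)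
      also have "\<dots> \<le> (L - sqrt_bound m) * (hnorm H f)\<^sup>2"
        using d mult_left_le[of ?d ?d] by (intro mult_right_mono) auto
      finally show ?thesis .
    qed
    fix m n
    have nn: "0 \<le> (L - sqrt_bound k) * (hnorm H f)\<^sup>2" for k using L(2) by simp
    show "(hnorm H (Y m f - Y n f))\<^sup>2 \<le> (L - sqrt_bound m) * (hnorm H f)\<^sup>2 + (L - sqrt_bound n) * (hnorm H f)\<^sup>2"
      using *[of m n] *[of n m] nn[of m] nn[of n] hnorm_minus_commute[of "Y m f" "Y n f"] f
      by (cases "m \<le> n") (auto simp: Y_lin)
  qed (use f in \<open>auto simp: Y_lin\<close>)
qed

lemma exists_sqrt:
  "\<exists>S\<in>positive_ops H. (\<forall>f\<in>elems H. S (S f) = f - B f) \<and>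
     (\<forall>R\<in>bounded_ops H H. (\<forall>f\<in>elems H. R (B f) = B (R f)) \<longrightarrow> (\<forall>f\<in>elems H. R (S f) = S (R f)))"
proof -
  obtain Z where Z: "\<And>f. f \<in> elems H \<Longrightarrow> converges (\<lambda>n. Y n f) (Z f)" using Y_converges by metis
  define W where "W = restrict Z (elems H)"
  have hY: "hnorm H (Y n f) \<le> 1 * hnorm H f" if "f \<in> elems H" for n f
    using Y_hnorm[OF that, of n] mult_right_mono[OF sqrt_bound_range(2)[of n] hnorm_nonneg[OF that]] by linarith
  have W: "W \<in> bounded_ops H H"
    unfolding W_def by (rule strong_limit_bounded[OF hilbert_space_axioms Y_bounded Z hY])
  have cW: "converges (\<lambda>n. Y n f) (W f)" if "f \<in> elems H" for f using Z[OF that] that by (simp add: W_def)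
  note W_lin = bounded_ops_simps[OF W]
  have W_sym: "ip H (W f) g = ip H f (W g)" if "f \<in> elems H" "g \<in> elems H" for f g
  proof -
    have "(\<lambda>n. ip H (Y n f) g) \<longlonglongrightarrow> ip H (W f) g" by (rule converges_ip[OF cW]) (use that in auto)
    moreover have "(\<lambda>n. cnj (ip H (Y n g) f)) \<longlonglongrightarrow> cnj (ip H (W g) f)"
      by (intro tendsto_cnj converges_ip[OF cW]) (use that in auto)
    moreover have "cnj (ip H (Y n g) f) = ip H (Y n f) g" for n
      using Y_symmetric[of f g n] that ip_commute[of "Y n g" f] by (simp add: Y_lin)
    moreover have "cnj (ip H (W g) f) = ip H f (W g)"
      using that ip_commute[of "W g" f] by (simp add: W_lin)
    ultimately show ?thesis using LIMSEQ_unique by simp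
  qed
  have W_norm: "hnorm H (W f) \<le> hnorm H f" if "f \<in> elems H" for f
    using converges_bounded[OF cW[OF that], of "hnorm H f"] hY[OF that] by simp
  \<comment> \<open>The limit of the iteration is a fixed point; the iterates are contractions, so they may be composed
      in the limit.\<close>
  have W_eq: "W f + W f = B f + W (W f)" if f: "f \<in> elems H" for f
  proof -
    have Wf: "W f \<in> elems H" using f by (simp add: W_lin)
    have 1: "converges (\<lambda>n. Y n (Y n f)) (W (W f))"
      unfolding converges_def
    proof (intro conjI allI)
      have "(\<lambda>n. hnorm H (Y n f - W f) + hnorm H (Y n (W f) - W (W f))) \<longlonglongrightarrow> 0 + 0"
        using cW[OF f] cW[OF Wf] by (intro tendsto_intros) (auto simp: converges_def)
      hence lim: "(\<lambda>n. hnorm H (Y n f - W f) + hnorm H (Y n (W f) - W (W f))) \<longlonglongrightarrow> 0" by simp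
      show "(\<lambda>n. hnorm H (Y n (Y n f) - W (W f))) \<longlonglongrightarrow> 0"
      proof (rule Lim_null_comparison[OF always_eventually lim], rule allI)
        fix n
        have "hnorm H (Y n (Y n f) - W (W f)) \<le> hnorm H (Y n (Y n f) - Y n (W f)) + hnorm H (Y n (W f) - W (W f))"
          using f by (intro hnorm_triangle_diff) (auto simp: Y_lin W_lin)
        moreover have "hnorm H (Y n (Y n f) - Y n (W f)) \<le> hnorm H (Y n f - W f)"
          using hY[of "Y n f - W f" n] f Wf by (simp add: Y_lin Y_lin(4)[OF hilbert_space_axioms])
        ultimately show "norm (hnorm H (Y n (Y n f) - W (W f))) \<le> hnorm H (Y n f - W f) + hnorm H (Y n (W f) - W (W f))"
          using f by (simp add: Y_lin W_lin)
      qed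
    qed (use f in \<open>auto simp: Y_lin W_lin\<close>)
    have 2: "converges (\<lambda>n. Y (Suc n) f + Y (Suc n) f) (W f + W f)"
    proof -
      have "converges (\<lambda>n. Y (Suc n) f) (W f)"
        using cW[OF f] LIMSEQ_Suc[of "\<lambda>n. hnorm H (Y n f - W f)"] unfolding converges_def by blast
      thus ?thesis by (intro converges_add)
    qed
    have "Y (Suc n) f + Y (Suc n) f = B f + Y n (Y n f)" for n
      unfolding Y_Suc[OF f] by (simp add: fun_eq_iff)
    hence "converges (\<lambda>n. B f + Y n (Y n f)) (W f + W f)" using 2 by simp
    moreover have "converges (\<lambda>n. B f + Y n (Y n f)) (B f + W (W f))"
      using f by (intro converges_add converges_const 1) (auto simp: B_lin)
    ultimately show ?thesis by (rule converges_unique)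
  qed
  have S: "complement_op W \<in> positive_ops H"
  proof (rule positive_opsI[OF complement_op_bounded[OF W]])
    fix f assume f: "f \<in> elems H"
    have "Re (ip H (W f) f) \<le> hnorm H (W f) * hnorm H f"
      using cauchy_schwarz[of "W f" f] f complex_Re_le_cmod[of "ip H (W f) f"] by (simp add: W_lin)
    also have "\<dots> \<le> hnorm H f * hnorm H f" using W_norm[OF f] f by (intro mult_right_mono) auto
    finally show "0 \<le> Re (ip H (complement_op W f) f)"
      using f hnorm_sq[OF f] by (simp add: complement_op_def W_lin ip_linear power2_eq_square)
  qed (auto simp: complement_op_def W_lin ip_linear W_sym)
  have "complement_op W (complement_op W f) = f - B f" if f: "f \<in> elems H" for f
  proof -
    have "complement_op W (complement_op W f) = (f - W f) - (W f - W (W f))"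
      using f by (simp add: complement_op_def W_lin(1) W_lin(4)[OF hilbert_space_axioms])
    also have "\<dots> = f - (W f + W f) + W (W f)" by (simp add: fun_eq_iff)
    also have "\<dots> = f - B f" unfolding W_eq[OF f] by (simp add: fun_eq_iff)
    finally show ?thesis .
  qed
  moreover have "R (complement_op W f) = complement_op W (R f)"
    if R: "R \<in> bounded_ops H H" "\<forall>f\<in>elems H. R (B f) = B (R f)" and f: "f \<in> elems H" for R f
  proof -
    note R_lin = bounded_ops_simps[OF R(1)]
    have "converges (\<lambda>n. R (Y n f)) (R (W f))"
      by (rule bounded_ops_converges[OF hilbert_space_axioms R(1) cW[OF f]])
    moreover have "converges (\<lambda>n. R (Y n f)) (W (R f))"
      using cW[of "R f"] Y_commute[OF R(1) _ f] R(2) f by (simp add: R_lin(1))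
    ultimately have "R (W f) = W (R f)" by (rule converges_unique)
    thus ?thesis using f by (simp add: complement_op_def W_lin(1) R_lin(1) R_lin(4)[OF hilbert_space_axioms])
  qed
  ultimately show ?thesis using S by (intro bexI[OF _ S] conjI ballI impI) auto
qed

end

context hilbert_space
begin

lemma positive_ops_scale:
  assumes "P \<in> positive_ops H" "0 \<le> c"
  shows "scale_op H (of_real c) P \<in> positive_ops H"
proof (rule positive_opsI)
  note lin = bounded_ops_simps[OF positive_ops_bounded[OF assms(1)]]
  show "scale_op H (of_real c) P \<in> bounded_ops H H"
    by (rule scale_op_bounded[OF hilbert_space_axioms positive_ops_bounded[OF assms(1)]])
  show "ip H (scale_op H (of_real c) P f) g = ip H f (scale_op H (of_real c) P g)"
    if "f \<in> elems H" "g \<in> elems H" for f g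
    using that by (simp add: scale_op_eq ip_linear lin positive_ops_symmetric[OF assms(1)])
  show "0 \<le> Re (ip H (scale_op H (of_real c) P f) f)" if "f \<in> elems H" for f
    using that assms(2) by (simp add: scale_op_eq ip_linear lin positive_ops_Re[OF assms(1)])
qed

text \<open>
  Scaling \<open>P\<close> to a contraction \<open>A\<close>, the operator \<open>B = 1 - A\<close> is again a positive contraction, so the
  iteration applies to it.
\<close>

lemma exists_commuting_sqrt:
  assumes P: "P \<in> positive_ops H"
  shows "\<exists>S\<in>positive_ops H. (\<forall>f\<in>elems H. S (S f) = P f) \<and>
    (\<forall>R\<in>bounded_ops H H. (\<forall>f\<in>elems H. R (P f) = P (R f)) \<longrightarrow> (\<forall>f\<in>elems H. R (S f) = S (R f)))"
proof -
  note lin = bounded_ops_simps[OF positive_ops_bounded[OF P]]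
  obtain M where M: "M > 0" "\<And>f. f \<in> elems H \<Longrightarrow> hnorm H (P f) \<le> M * hnorm H f"
    using bounded_ops_bound[OF hilbert_space_axioms positive_ops_bounded[OF P]] by blast
  define A where "A = scale_op H (of_real (1 / M)) P"
  have A: "A \<in> positive_ops H" unfolding A_def using M by (intro positive_ops_scale[OF P]) auto
  have cA: "hnorm H (A f) \<le> hnorm H f" if "f \<in> elems H" for f
    using M(1) M(2)[OF that] that by (simp add: A_def scale_op_eq hnorm_smul lin norm_divide field_simps)
  note compl = complement_positive_contraction[OF A cA]
  interpret selfadjoint_contraction H "complement_op A"
    by unfold_locales (use compl in \<open>auto simp: positive_ops_bounded positive_ops_symmetric\<close>)
  obtain S where S: "S \<in> positive_ops H" "\<And>f. f \<in> elems H \<Longrightarrow> S (S f) = f - complement_op A f"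
    "\<And>R f. R \<in> bounded_ops H H \<Longrightarrow> (\<And>f. f \<in> elems H \<Longrightarrow> R (complement_op A f) = complement_op A (R f))
      \<Longrightarrow> f \<in> elems H \<Longrightarrow> R (S f) = S (R f)"
    using exists_sqrt by blast
  note S_lin = bounded_ops_simps[OF positive_ops_bounded[OF S(1)]]
  define T where "T = scale_op H (of_real (sqrt M)) S"
  have "T \<in> positive_ops H" unfolding T_def using M by (intro positive_ops_scale[OF S(1)]) auto
  moreover have "T (T f) = P f" if f: "f \<in> elems H" for f
  proof -
    have "T (T f) = (of_real (sqrt M * sqrt M)) \<cdot> S (S f)"
      using f by (simp add: T_def scale_op_eq S_lin del: real_sqrt_mult_self)
    also have "\<dots> = of_real M \<cdot> A f"
      using f M(1) by (simp add: S(2) complement_op_def)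
    also have "\<dots> = P f" using f M(1) by (simp add: A_def scale_op_eq)
    finally show ?thesis .
  qed
  moreover have "R (T f) = T (R f)"
    if R: "R \<in> bounded_ops H H" "\<forall>f\<in>elems H. R (P f) = P (R f)" and f: "f \<in> elems H" for R f
  proof -
    note R_lin = bounded_ops_simps[OF R(1)]
    have "R (complement_op A g) = complement_op A (R g)" if "g \<in> elems H" for g
      using that R(2) by (simp add: complement_op_def A_def scale_op_eq R_lin(1,3) lin(1) R_lin(4)[OF hilbert_space_axioms])
    from S(3)[OF R(1) this f] show ?thesis using f by (simp add: T_def scale_op_eq R_lin(1,3) S_lin(1))
  qed
  ultimately show ?thesis by (intro bexI[of _ T] conjI ballI impI) auto
qed

lemma positive_ops_kernel:
  assumes P: "P \<in> positive_ops H" and f: "f \<in> elems H" and 0: "Re (ip H (P f) f) = 0"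
  shows "P f = 0"
proof -
  have "(cmod (ip H (P f) (P f)))\<^sup>2 \<le> 0"
    using positive_ops_cauchy_schwarz[OF P f, of "P f"] f 0 bounded_ops_mem[OF positive_ops_bounded[OF P] f] by simp
  thus ?thesis using ip_definite[of "P f"] bounded_ops_mem[OF positive_ops_bounded[OF P] f] by simp
qed

text \<open>
  With \<open>g = S f - T f\<close>, commutation gives \<open>(S + T) g = S\<^sup>2 f - T\<^sup>2 f = 0\<close>, so both
  \<open>\<langle>S g, g\<rangle>\<close> and \<open>\<langle>T g, g\<rangle>\<close> vanish. Hence \<open>S g = T g = 0\<close> and \<open>\<parallel>g\<parallel>\<^sup>2 = \<langle>(S - T) g, f\<rangle> = 0\<close>.
\<close>

lemma positive_sqrt_unique:
  assumes S: "S \<in> positive_ops H" and T: "T \<in> positive_ops H"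
    and eq: "\<And>f. f \<in> elems H \<Longrightarrow> S (S f) = T (T f)"
    and comm: "\<And>f. f \<in> elems H \<Longrightarrow> S (T f) = T (S f)"
  shows "S = T"
proof (rule bounded_ops_eqI[OF positive_ops_bounded[OF S] positive_ops_bounded[OF T]])
  note S_lin = bounded_ops_simps[OF positive_ops_bounded[OF S]]
  note T_lin = bounded_ops_simps[OF positive_ops_bounded[OF T]]
  fix f assume f: "f \<in> elems H"
  define g where "g = S f - T f"
  have m: "g \<in> elems H" "S f \<in> elems H" "T f \<in> elems H" "S g \<in> elems H" "T g \<in> elems H"
    using f by (auto simp: g_def S_lin(1) T_lin(1))
  have "S g + T g = 0"
    using f m by (simp add: g_def S_lin(4)[OF hilbert_space_axioms] T_lin(4)[OF hilbert_space_axioms] eq comm)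
  hence "ip H (S g) g + ip H (T g) g = 0"
    using m by (simp flip: ip_add_left)
  hence "Re (ip H (S g) g) + Re (ip H (T g) g) = 0" by (metis plus_complex.sel(1) zero_complex.sel(1))
  hence "Re (ip H (S g) g) = 0" "Re (ip H (T g) g) = 0"
    using positive_ops_Re[OF S m(1)] positive_ops_Re[OF T m(1)] by auto
  hence "S g = 0" "T g = 0" using positive_ops_kernel S T m by auto
  moreover have "ip H g g = ip H (S g) f - ip H (T g) f"
    using f m positive_ops_symmetric[OF S m(1) f] positive_ops_symmetric[OF T m(1) f]
    by (simp add: g_def[symmetric] ip_diff_right[symmetric] flip: g_def)
  ultimately have "g = 0" using f m ip_definite[of g] by simp
  thus "S f = T f" by (simp add: g_def)
qed

text \<open>
  Any positive square root \<open>T\<close> of \<open>P\<close> commutes with \<open>P = T\<^sup>2\<close>, hence with the square root obtained from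
  the iteration, hence equals it.
\<close>

lemma sqrt_op_eqI:
  assumes S: "S \<in> positive_ops H" and eq: "\<And>f. f \<in> elems H \<Longrightarrow> S (S f) = P f" and P: "P \<in> positive_ops H"
  shows "sqrt_op H P = S"
proof -
  obtain R where R: "R \<in> positive_ops H" "\<And>f. f \<in> elems H \<Longrightarrow> R (R f) = P f"
    "\<And>T f. T \<in> bounded_ops H H \<Longrightarrow> (\<And>f. f \<in> elems H \<Longrightarrow> T (P f) = P (T f)) \<Longrightarrow> f \<in> elems H
       \<Longrightarrow> T (R f) = R (T f)"
    using exists_commuting_sqrt[OF P] by blast
  have unique: "T = R" if T: "T \<in> positive_ops H" and TT: "\<And>f. f \<in> elems H \<Longrightarrow> T (T f) = P f" for T
  proof (rule positive_sqrt_unique[OF T R(1)])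
    note T_mem = bounded_ops_mem[OF positive_ops_bounded[OF T]]
    fix f assume f: "f \<in> elems H"
    show "T (T f) = R (R f)" using f R TT by simp
    have "T (P g) = P (T g)" if "g \<in> elems H" for g
      using that TT[of g] TT[of "T g"] T_mem by simp
    thus "T (R f) = R (T f)" by (rule R(3)[OF positive_ops_bounded[OF T] _ f])
  qed
  have comp: "compose (elems H) T T = P \<longleftrightarrow> (\<forall>f\<in>elems H. T (T f) = P f)" for T
  proof
    assume "\<forall>f\<in>elems H. T (T f) = P f"
    moreover have "P \<in> extensional (elems H)"
      using positive_ops_bounded[OF P] by (simp add: bounded_ops_def PiE_def)
    ultimately show "compose (elems H) T T = P"
      by (intro extensionalityI[of _ "elems H"]) (auto simp: compose_def)
  qed (auto simp: compose_def)
  show ?thesis unfolding sqrt_op_def comp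
  proof (rule the_equality)
    show "S \<in> positive_ops H \<and> (\<forall>f\<in>elems H. S (S f) = P f)" using S eq by blast
    fix T assume "T \<in> positive_ops H \<and> (\<forall>f\<in>elems H. T (T f) = P f)"
    hence "T = R" by (intro unique) blast+
    moreover have "S = R" by (rule unique[OF S eq])
    ultimately show "T = S" by simp
  qed
qed

lemma sqrt_op_spec:
  assumes P: "P \<in> positive_ops H"
  shows sqrt_op_positive: "sqrt_op H P \<in> positive_ops H"
    and sqrt_op_square: "\<And>f. f \<in> elems H \<Longrightarrow> sqrt_op H P (sqrt_op H P f) = P f"
proof -
  obtain S where S: "S \<in> positive_ops H" "\<And>f. f \<in> elems H \<Longrightarrow> S (S f) = P f"
    using exists_commuting_sqrt[OF P] by blast
  have "sqrt_op H P = S" by (rule sqrt_op_eqI) (fact S P)+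
  thus "sqrt_op H P \<in> positive_ops H"
    "\<And>f. f \<in> elems H \<Longrightarrow> sqrt_op H P (sqrt_op H P f) = P f" using S by simp_all
qed

end

section \<open>Absolute values and polar decompositions\<close>

lemma ker_op_iff: "f \<in> ker_op H T \<longleftrightarrow> f \<in> elems H \<and> T f = 0"
  by (simp add: ker_op_def zero_fun_def)

context hilbert_space
begin

lemma adj_compose_positive:
  assumes T: "T \<in> bounded_ops H H"
  shows "compose (elems H) (adj H H T) T \<in> positive_ops H"
proof (rule positive_opsI)
  note A = adj_bounded[OF hilbert_space_axioms T]
  note lin = bounded_ops_mem[OF T] bounded_ops_mem[OF A]
  show "compose (elems H) (adj H H T) T \<in> bounded_ops H H"
    by (rule bounded_ops_compose[OF hilbert_space_axioms hilbert_space_axioms A T])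
  show "ip H (compose (elems H) (adj H H T) T f) g = ip H f (compose (elems H) (adj H H T) T g)"
    if "f \<in> elems H" "g \<in> elems H" for f g
    using that ip_adj[OF hilbert_space_axioms T, of f "T g"] ip_adj_left[OF hilbert_space_axioms T, of g "T f"]
    by (simp add: compose_def lin)
  show "0 \<le> Re (ip H (compose (elems H) (adj H H T) T f) f)" if "f \<in> elems H" for f
    using that ip_adj_left[OF hilbert_space_axioms T, of f "T f"] ip_nonneg[of "T f"]
    by (simp add: compose_def lin)
qed

lemma abs_op_spec:
  assumes T: "T \<in> bounded_ops H H"
  shows abs_op_positive: "abs_op H T \<in> positive_ops H"
    and abs_op_square: "\<And>f. f \<in> elems H \<Longrightarrow> abs_op H T (abs_op H T f) = adj H H T (T f)"
  using sqrt_op_spec[OF adj_compose_positive[OF T]] by (auto simp: abs_op_def compose_def)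

lemma abs_op_eqI:
  assumes T: "T \<in> bounded_ops H H" and S: "S \<in> positive_ops H"
    and eq: "\<And>f. f \<in> elems H \<Longrightarrow> S (S f) = adj H H T (T f)"
  shows "abs_op H T = S"
  unfolding abs_op_def
proof (rule sqrt_op_eqI[OF S _ adj_compose_positive[OF T]])
  fix f assume "f \<in> elems H"
  thus "S (S f) = compose (elems H) (adj H H T) T f" by (simp add: compose_def eq)
qed

lemma hnorm_abs_op:
  assumes T: "T \<in> bounded_ops H H" and f: "f \<in> elems H"
  shows "hnorm H (abs_op H T f) = hnorm H (T f)"
proof -
  let ?B = "abs_op H T"
  note B = abs_op_positive[OF T]
  note mem = bounded_ops_mem[OF positive_ops_bounded[OF B]] bounded_ops_mem[OF T]
  have "ip H (?B f) (?B f) = ip H (?B (?B f)) f"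
    using positive_ops_symmetric[OF B mem(1)[OF f] f] by simp
  also have "\<dots> = ip H (T f) (T f)"
    unfolding abs_op_square[OF T f] using ip_adj_left[OF hilbert_space_axioms T f mem(2)[OF f]] .
  finally show ?thesis by (simp add: hnorm_def)
qed

lemma ker_abs_op:
  assumes T: "T \<in> bounded_ops H H"
  shows "ker_op H (abs_op H T) = ker_op H T"
proof -
  have "abs_op H T f = 0 \<longleftrightarrow> T f = 0" if f: "f \<in> elems H" for f
    using hnorm_abs_op[OF T f] hnorm_eq_0[OF bounded_ops_mem[OF T f]]
      hnorm_eq_0[OF bounded_ops_mem[OF positive_ops_bounded[OF abs_op_positive[OF T]] f]] by simp
  thus ?thesis by (auto simp: ker_op_iff)
qed

text \<open>
  The numbers \<open>q\<^sub>k = \<langle>C\<^sup>k f, f\<rangle>\<close> are nonnegative and decreasing, by \<open>C\<^sup>2 \<le> C \<le> 1\<close>, and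
  \<open>\<parallel>C\<^sup>m f - C\<^sup>n f\<parallel>\<^sup>2 = q\<^sub>2\<^sub>m + q\<^sub>2\<^sub>n - 2 q\<^sub>m\<^sub>+\<^sub>n\<close>.
\<close>

lemma contraction_powers_converge:
  assumes C: "C \<in> positive_ops H" and c: "\<And>f. f \<in> elems H \<Longrightarrow> hnorm H (C f) \<le> hnorm H f" and f: "f \<in> elems H"
  shows "\<exists>g. converges (\<lambda>n. (C ^^ n) f) g"
proof -
  note C_mem = bounded_ops_mem[OF positive_ops_bounded[OF C]]
  have mem: "(C ^^ n) f \<in> elems H" for n using f by (induction n) (auto simp: C_mem)
  define q where "q k = Re (ip H ((C ^^ k) f) f)" for k
  have shift: "ip H ((C ^^ m) f) ((C ^^ n) f) = ip H ((C ^^ (m + n)) f) f" for m n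
  proof (induction n arbitrary: m)
    case (Suc n)
    have "ip H ((C ^^ m) f) ((C ^^ Suc n) f) = ip H ((C ^^ Suc m) f) ((C ^^ n) f)"
      using positive_ops_symmetric[OF C mem mem, of m n] by simp
    also have "\<dots> = ip H ((C ^^ (Suc m + n)) f) f" by (rule Suc.IH)
    finally show ?case by simp
  qed simp
  have norm2: "(hnorm H ((C ^^ m) f))\<^sup>2 = q (m + m)" for m
    by (simp add: hnorm_sq[OF mem] shift q_def)
  have inner: "Re (ip H (C ((C ^^ m) f)) ((C ^^ m) f)) = q (Suc (m + m))" for m
    using shift[of "Suc m" m] by (simp add: q_def)
  \<comment> \<open>Even indices use that C is a contraction, odd ones the inequality for positive contractions.\<close>
  have "0 \<le> q k \<and> q (Suc k) \<le> q k" for k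
  proof (cases "even k")
    case True
    then obtain m where k: "k = m + m" by (metis evenE mult_2)
    have "q (Suc k) \<le> hnorm H (C ((C ^^ m) f)) * hnorm H ((C ^^ m) f)"
      unfolding k inner[symmetric]
      using cauchy_schwarz[OF C_mem[OF mem] mem, of m m] complex_Re_le_cmod order_trans by blast
    also have "\<dots> \<le> hnorm H ((C ^^ m) f) * hnorm H ((C ^^ m) f)"
      using c[OF mem, of m] hnorm_nonneg[OF mem] by (intro mult_right_mono) auto
    finally show ?thesis using norm2[of m] k by (metis power2_eq_square zero_le_power2)
  next
    case False
    then obtain m where k: "k = Suc (m + m)" by (metis oddE mult_2 Suc_eq_plus1)
    have "q (Suc k) \<le> q k"
      using positive_contraction[OF C c mem, of m] norm2[of "Suc m"] inner[of m] k by simp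
    moreover have "0 \<le> q k" using positive_ops_Re[OF C mem, of m] inner[of m] k by simp
    ultimately show ?thesis by simp
  qed
  hence q: "\<And>k. 0 \<le> q k" "decseq q" by (auto simp: decseq_Suc_iff)
  have "\<forall>k. 0 \<le> q k" using q(1) by blast
  then obtain L where L: "q \<longlonglongrightarrow> L" "\<forall>k. L \<le> q k" by (rule decseq_convergent[OF q(2)])
  show ?thesis
  proof (rule cauchy_converges[OF mem])
    have "(\<lambda>n. q (2 * n) - L) \<longlonglongrightarrow> L - L"
      by (intro tendsto_intros LIMSEQ_subseq_LIMSEQ[OF L(1), unfolded o_def]) (auto simp: strict_mono_def)
    thus "(\<lambda>n. q (2 * n) - L) \<longlonglongrightarrow> 0" by simp
    fix m n
    let ?x = "(C ^^ m) f" and ?y = "(C ^^ n) f"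
    have "(hnorm H (?x - ?y))\<^sup>2 = Re (ip H ?x ?x) - Re (ip H ?y ?x) - (Re (ip H ?x ?y) - Re (ip H ?y ?y))"
      using mem[of m] mem[of n] by (simp add: hnorm_sq ip_diff_left ip_diff_right)
    also have "\<dots> = q (2 * m) + q (2 * n) - 2 * q (m + n)"
      unfolding shift q_def mult_2 add.commute[of n m] by simp
    finally have "(hnorm H (?x - ?y))\<^sup>2 = q (2 * m) + q (2 * n) - 2 * q (m + n)" .
    thus "(hnorm H ((C ^^ m) f - (C ^^ n) f))\<^sup>2 \<le> (q (2 * m) - L) + (q (2 * n) - L)"
      using L(2)[rule_format, of "m + n"] by simp
  qed
qed

text \<open>
  With \<open>C = 1 - B / M\<close> and the Neumann sums \<open>W\<^sub>n = (1 + C + \<dots> + C\<^sup>n\<^sup>-\<^sup>1) / M\<close> one has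
  \<open>B W\<^sub>n = W\<^sub>n B = 1 - C\<^sup>n\<close>. The powers \<open>C\<^sup>n\<close> converge strongly to the projection \<open>Q\<close> onto the kernel of
  \<open>B\<close>, so \<open>W\<^sub>n\<close> inverts \<open>B\<close> in the limit, off its kernel.
\<close>

lemma exists_approximate_inverse:
  assumes B: "B \<in> positive_ops H"
  obtains W Q where "\<And>n. W n \<in> bounded_ops H H"
    "\<And>n f. f \<in> elems H \<Longrightarrow> B (W n f) = W n (B f)"
    "\<And>n f. f \<in> elems H \<Longrightarrow> hnorm H (B (W n f)) \<le> 2 * hnorm H f"
    "\<And>f. f \<in> elems H \<Longrightarrow> converges (\<lambda>n. B (W n f)) (f - Q f)"
    "\<And>f. f \<in> elems H \<Longrightarrow> Q f \<in> ker_op H B"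
    "\<And>f. f \<in> ker_op H B \<Longrightarrow> Q f = f"
proof -
  note Bb = positive_ops_bounded[OF B]
  note B_lin = bounded_ops_simps[OF Bb]
  obtain M where M: "M > 0" "\<And>f. f \<in> elems H \<Longrightarrow> hnorm H (B f) \<le> M * hnorm H f"
    using bounded_ops_bound[OF hilbert_space_axioms Bb] by blast
  define A where "A = scale_op H (of_real (1 / M)) B"
  have A: "A \<in> positive_ops H" unfolding A_def using M by (intro positive_ops_scale[OF B]) auto
  have cA: "hnorm H (A f) \<le> hnorm H f" if "f \<in> elems H" for f
    using M(1) M(2)[OF that] that by (simp add: A_def scale_op_eq hnorm_smul B_lin norm_divide field_simps)
  define C where "C = complement_op A"
  have C: "C \<in> positive_ops H" "\<And>f. f \<in> elems H \<Longrightarrow> hnorm H (C f) \<le> hnorm H f"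
    unfolding C_def by (rule complement_positive_contraction[OF A cA]; assumption)+
  note Cb = positive_ops_bounded[OF C(1)]
  note C_lin = bounded_ops_simps[OF Cb]
  have C_eq: "C f = f - of_real (1 / M) \<cdot> B f" if "f \<in> elems H" for f
    using that by (simp add: C_def complement_op_def A_def scale_op_eq)
  have CB: "C (B f) = B (C f)" if "f \<in> elems H" for f
    using that by (simp add: C_eq B_lin(1,3) B_lin(4)[OF hilbert_space_axioms])
  have mem: "(C ^^ n) f \<in> elems H" if "f \<in> elems H" for n f
    using that by (induction n) (auto simp: C_lin)
  have CnB: "(C ^^ n) (B f) = B ((C ^^ n) f)" if "f \<in> elems H" for n f
  proof (induction n)
    case (Suc n)
    thus "(C ^^ Suc n) (B f) = B ((C ^^ Suc n) f)" using CB mem[OF that] by simp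
  qed simp
  have Cn: "restrict (C ^^ n) (elems H) \<in> bounded_ops H H" for n
  proof (induction n)
    case 0
    show ?case using id_op_bounded[OF hilbert_space_axioms] by (simp add: id_op_def restrict_def)
  next
    case (Suc n)
    have "restrict (C ^^ Suc n) (elems H) = compose (elems H) C (restrict (C ^^ n) (elems H))"
      by (auto simp: compose_def restrict_def)
    thus "restrict (C ^^ Suc n) (elems H) \<in> bounded_ops H H"
      using bounded_ops_compose[OF hilbert_space_axioms hilbert_space_axioms Cb Suc] by (simp only:)
  qed
  define W where "W n = (\<lambda>f\<in>elems H. of_real (1 / M) \<cdot> (\<Sum>k<n. (C ^^ k) f))" for n
  have W_Suc: "W (Suc n) f = W n f + of_real (1 / M) \<cdot> (C ^^ n) f" if "f \<in> elems H" for n f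
    using that by (simp add: W_def smul_add)
  have W_0: "W 0 f = 0" if "f \<in> elems H" for f using that by (simp add: W_def)
  have Wb: "W n \<in> bounded_ops H H" for n
  proof (induction n)
    case 0
    have "W 0 = scale_op H 0 B" unfolding W_def scale_op_eq by simp
    thus ?case using scale_op_bounded[OF hilbert_space_axioms Bb] by simp
  next
    case (Suc n)
    have "W (Suc n) = (\<lambda>f\<in>elems H. 1 \<cdot> W n f + of_real (1 / M) \<cdot> restrict (C ^^ n) (elems H) f)"
      using W_Suc by (auto simp: W_def restrict_def smul_add)
    thus "W (Suc n) \<in> bounded_ops H H"
      using bounded_ops_comb[OF hilbert_space_axioms hilbert_space_axioms Suc Cn] by (simp only:)
  qed
  note W_mem = bounded_ops_mem[OF Wb]
  have BW: "B (W n f) = f - (C ^^ n) f" if f: "f \<in> elems H" for n f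
  proof (induction n)
    case 0
    show "B (W 0 f) = f - (C ^^ 0) f" using f B_lin(5)[OF hilbert_space_axioms] by (simp add: W_0)
  next
    case (Suc n)
    have "B (W (Suc n) f) = B (W n f) + of_real (1 / M) \<cdot> B ((C ^^ n) f)"
      using f mem[OF f] W_mem[OF f] by (simp add: W_Suc B_lin)
    also have "\<dots> = f - C ((C ^^ n) f)" unfolding Suc.IH C_eq[OF mem[OF f]] by (simp add: fun_eq_iff)
    finally show "B (W (Suc n) f) = f - (C ^^ Suc n) f" by simp
  qed
  have WB: "W n (B f) = f - (C ^^ n) f" if f: "f \<in> elems H" for n f
  proof (induction n)
    case 0
    show "W 0 (B f) = f - (C ^^ 0) f" using f by (simp add: W_0 B_lin(1))
  next
    case (Suc n)
    have "W (Suc n) (B f) = W n (B f) + of_real (1 / M) \<cdot> B ((C ^^ n) f)"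
      using f by (simp add: W_Suc B_lin(1) CnB)
    also have "\<dots> = f - C ((C ^^ n) f)" unfolding Suc.IH C_eq[OF mem[OF f]] by (simp add: fun_eq_iff)
    finally show "W (Suc n) (B f) = f - (C ^^ Suc n) f" by simp
  qed
  obtain Q where Q: "\<And>f. f \<in> elems H \<Longrightarrow> converges (\<lambda>n. (C ^^ n) f) (Q f)"
    using contraction_powers_converge[OF C] by metis
  have Qm: "Q f \<in> elems H" if "f \<in> elems H" for f using Q[OF that] by (rule converges_mem)
  show thesis
  proof
    show "W n \<in> bounded_ops H H" for n by (rule Wb)
    show "B (W n f) = W n (B f)" if "f \<in> elems H" for n f using BW WB that by simp
    show "hnorm H (B (W n f)) \<le> 2 * hnorm H f" if f: "f \<in> elems H" for n f
    proof -
      have "hnorm H ((C ^^ n) f) \<le> hnorm H f"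
        using f C(2)[OF mem[OF f]] by (induction n) (auto intro: order_trans)
      moreover have "hnorm H (f - (C ^^ n) f) \<le> hnorm H f + hnorm H ((C ^^ n) f)"
        using hnorm_triangle_diff[OF f zero_mem mem[OF f]] hnorm_minus_commute[OF zero_mem mem[OF f]] by simp
      ultimately show ?thesis by (simp add: BW[OF f])
    qed
    show "converges (\<lambda>n. B (W n f)) (f - Q f)" if f: "f \<in> elems H" for f
    proof -
      have "f - (C ^^ n) f - (f - Q f) = Q f - (C ^^ n) f" for n by simp
      thus ?thesis using Q[OF f] hnorm_minus_commute[OF Qm[OF f] mem[OF f]] f Qm[OF f] mem[OF f]
        by (simp add: converges_def BW)
    qed
    show "Q f \<in> ker_op H B" if f: "f \<in> elems H" for f
    proof -
      have "converges (\<lambda>n. (C ^^ Suc n) f) (C (Q f))"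
        using bounded_ops_converges[OF hilbert_space_axioms Cb Q[OF f]] by simp
      moreover have "converges (\<lambda>n. (C ^^ Suc n) f) (Q f)"
        using Q[OF f] LIMSEQ_Suc[of "\<lambda>n. hnorm H ((C ^^ n) f - Q f)"] unfolding converges_def by blast
      ultimately have "C (Q f) = Q f" by (rule converges_unique)
      hence "of_real M \<cdot> (of_real (1 / M) \<cdot> B (Q f)) = of_real M \<cdot> (0 :: 'x \<Rightarrow> complex)"
        using C_eq[OF Qm[OF f]] by simp
      thus ?thesis using M(1) Qm[OF f] by (simp add: ker_op_iff)
    qed
    show "Q f = f" if "f \<in> ker_op H B" for f
    proof -
      have f: "f \<in> elems H" "B f = 0" using that by (auto simp: ker_op_iff)
      have "(C ^^ n) f = f" for n
      proof (induction n)
        case (Suc n)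
        thus "(C ^^ Suc n) f = f" using f by (simp add: C_eq)
      qed simp
      thus ?thesis using Q[OF f(1)] converges_const[OF f(1)] converges_unique by simp
    qed
  qed
qed

text \<open>
  With \<open>B = |T|\<close> and the approximate inverses \<open>W\<^sub>n\<close>, let \<open>U\<close> be the strong limit of \<open>T W\<^sub>n\<close>. It exists
  because \<open>\<parallel>T g\<parallel> = \<parallel>B g\<parallel>\<close> and \<open>B W\<^sub>n\<close> converges strongly; the same identity gives
  \<open>\<parallel>U f\<parallel> = \<parallel>f - Q f\<parallel>\<close>, which contains both the kernel and the isometry property. For uniqueness,
  \<open>U'\<close> is determined by \<open>U' B W\<^sub>n = T W\<^sub>n\<close> in the limit, and by its vanishing on the kernel of \<open>B\<close>.
\<close>

lemma exists_polar_op: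
  assumes T: "T \<in> bounded_ops H H"
  obtains U where "U \<in> partial_isometries H" "\<And>f. f \<in> elems H \<Longrightarrow> U (abs_op H T f) = T f"
    "ker_op H U = ker_op H T"
    "\<And>U'. \<lbrakk>U' \<in> bounded_ops H H; \<And>f. f \<in> elems H \<Longrightarrow> U' (abs_op H T f) = T f; ker_op H U' = ker_op H T\<rbrakk>
       \<Longrightarrow> U' = U"
proof -
  define B where "B = abs_op H T"
  have B: "B \<in> positive_ops H" unfolding B_def by (rule abs_op_positive[OF T])
  note B_lin = bounded_ops_simps[OF positive_ops_bounded[OF B]]
  note T_lin = bounded_ops_simps[OF T]
  have norm_T: "hnorm H (T f) = hnorm H (B f)" if "f \<in> elems H" for f
    using hnorm_abs_op[OF T that] by (simp add: B_def)
  have kerB: "ker_op H B = ker_op H T" unfolding B_def by (rule ker_abs_op[OF T])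
  obtain W Q where W: "\<And>n. W n \<in> bounded_ops H H"
    and BW: "\<And>n f. f \<in> elems H \<Longrightarrow> B (W n f) = W n (B f)"
    and BW_norm: "\<And>n f. f \<in> elems H \<Longrightarrow> hnorm H (B (W n f)) \<le> 2 * hnorm H f"
    and BW_lim: "\<And>f. f \<in> elems H \<Longrightarrow> converges (\<lambda>n. B (W n f)) (f - Q f)"
    and Q_ker: "\<And>f. f \<in> elems H \<Longrightarrow> Q f \<in> ker_op H B"
    and ker_Q: "\<And>f. f \<in> ker_op H B \<Longrightarrow> Q f = f"
    using exists_approximate_inverse[OF B] by blast
  note W_mem = bounded_ops_mem[OF W]
  have Q_mem: "Q f \<in> elems H" if "f \<in> elems H" for f using Q_ker[OF that] by (simp add: ker_op_iff)
  have "\<exists>g. converges (\<lambda>n. T (W n f)) g" if f: "f \<in> elems H" for f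
  proof (rule cauchy_converges)
    let ?s = "\<lambda>n. 2 * (hnorm H (B (W n f) - (f - Q f)))\<^sup>2"
    have "?s \<longlonglongrightarrow> 2 * 0\<^sup>2" using BW_lim[OF f] unfolding converges_def by (intro tendsto_intros) auto
    thus "?s \<longlonglongrightarrow> 0" by simp
    fix m n
    let ?x = "B (W m f) - (f - Q f)" and ?y = "B (W n f) - (f - Q f)"
    have xy: "?x \<in> elems H" "?y \<in> elems H" using f Q_mem[OF f] W_mem[OF f] by (auto simp: B_lin)
    have "hnorm H (T (W m f) - T (W n f)) = hnorm H (?x - ?y)"
      using norm_T[of "W m f - W n f"] W_mem[OF f]
      by (simp add: T_lin(4)[OF hilbert_space_axioms] B_lin(4)[OF hilbert_space_axioms])
    thus "(hnorm H (T (W m f) - T (W n f)))\<^sup>2 \<le> ?s m + ?s n"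
      using parallelogram[OF xy] by (smt (verit) zero_le_power2)
  qed (use f W_mem T_lin in auto)
  then obtain Z where Z: "\<And>f. f \<in> elems H \<Longrightarrow> converges (\<lambda>n. T (W n f)) (Z f)" by metis
  define U where "U = restrict Z (elems H)"
  have U: "converges (\<lambda>n. T (W n f)) (U f)" if "f \<in> elems H" for f
    using Z[OF that] that by (simp add: U_def)
  have Ub: "U \<in> bounded_ops H H" unfolding U_def
  proof (rule strong_limit_bounded[OF hilbert_space_axioms, where T = "\<lambda>n. compose (elems H) T (W n)" and M = 2])
    show "compose (elems H) T (W n) \<in> bounded_ops H H" for n
      by (rule bounded_ops_compose[OF hilbert_space_axioms hilbert_space_axioms T W])
    show "hnorm H (compose (elems H) T (W n) f) \<le> 2 * hnorm H f" if "f \<in> elems H" for n f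
      using BW_norm[OF that, of n] norm_T[OF W_mem[OF that]] that by (simp add: compose_def)
    show "converges (\<lambda>n. compose (elems H) T (W n) f) (Z f)" if "f \<in> elems H" for f
      using Z[OF that] that by (simp add: compose_def)
  qed
  note U_lin = bounded_ops_simps[OF Ub]
  have T_Q: "T (Q f) = 0" if "f \<in> elems H" for f
    using Q_ker[OF that] unfolding kerB by (simp add: ker_op_iff)
  have UB: "U (B f) = T f" if f: "f \<in> elems H" for f
  proof -
    have "converges (\<lambda>n. T (B (W n f))) (T (f - Q f))"
      by (rule bounded_ops_converges[OF hilbert_space_axioms T BW_lim[OF f]])
    moreover have "T (f - Q f) = T f" using f Q_mem[OF f] T_Q[OF f] by (simp add: T_lin(4)[OF hilbert_space_axioms])
    ultimately show ?thesis using U[of "B f"] f converges_unique BW[OF f] by (simp add: B_lin(1))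
  qed
  have U_norm: "hnorm H (U f) = hnorm H (f - Q f)" if f: "f \<in> elems H" for f
    using converges_hnorm[OF U[OF f]] converges_hnorm[OF BW_lim[OF f]] norm_T[OF W_mem[OF f]]
    by (simp add: LIMSEQ_unique)
  have kerU: "ker_op H U = ker_op H T"
  proof -
    have "U f = 0 \<longleftrightarrow> f \<in> ker_op H B" if f: "f \<in> elems H" for f
    proof -
      have "U f = 0 \<longleftrightarrow> hnorm H (f - Q f) = 0"
        using U_norm[OF f] hnorm_eq_0[OF U_lin(1)[OF f]] by simp
      also have "\<dots> \<longleftrightarrow> f = Q f" using f Q_mem[OF f] hnorm_eq_0[of "f - Q f"] by (metis diff_mem eq_iff_diff_eq_0)
      also have "\<dots> \<longleftrightarrow> f \<in> ker_op H B" using Q_ker[OF f] ker_Q[of f] by metis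
      finally show ?thesis .
    qed
    thus ?thesis unfolding kerB[symmetric] by (auto simp: ker_op_iff)
  qed
  have iso: "hnorm H (U f) = hnorm H f" if "f \<in> ortho H (ker_op H U)" for f
  proof -
    have f: "f \<in> elems H" and orth: "\<And>g. g \<in> ker_op H B \<Longrightarrow> ip H f g = 0"
      using that unfolding kerU kerB by (auto simp: ortho_def)
    have "converges (\<lambda>n. B (W n f)) (f - Q f)" by (rule BW_lim[OF f])
    from converges_ip[OF this Q_mem[OF f]] have "(\<lambda>n. ip H (B (W n f)) (Q f)) \<longlonglongrightarrow> ip H (f - Q f) (Q f)" .
    moreover have "ip H (B (W n f)) (Q f) = 0" for n
      using positive_ops_symmetric[OF B W_mem[OF f] Q_mem[OF f], of n] Q_ker[OF f] W_mem[OF f]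
      by (simp add: ker_op_iff)
    ultimately have "ip H (f - Q f) (Q f) = 0" by (simp add: LIMSEQ_const_iff)
    hence "ip H (Q f) (Q f) = 0" using orth[OF Q_ker[OF f]] f Q_mem[OF f] by (simp add: ip_linear)
    hence "Q f = 0" using ip_definite Q_mem[OF f] by simp
    thus ?thesis using U_norm[OF f] by simp
  qed
  show thesis
  proof
    show "U \<in> partial_isometries H" using Ub iso by (simp add: partial_isometries_def)
    show "U (abs_op H T f) = T f" if "f \<in> elems H" for f using UB[OF that] by (simp add: B_def)
    show "ker_op H U = ker_op H T" by (rule kerU)
    fix U' assume U': "U' \<in> bounded_ops H H" "\<And>f. f \<in> elems H \<Longrightarrow> U' (abs_op H T f) = T f"
      "ker_op H U' = ker_op H T"
    note U'_lin = bounded_ops_simps[OF U'(1)]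
    show "U' = U"
    proof (rule bounded_ops_eqI[OF U'(1) Ub])
      fix f assume f: "f \<in> elems H"
      have "converges (\<lambda>n. U' (B (W n f))) (U' (f - Q f))"
        by (rule bounded_ops_converges[OF hilbert_space_axioms U'(1) BW_lim[OF f]])
      moreover have "U' (B (W n f)) = T (W n f)" for n
        using U'(2)[OF W_mem[OF f]] by (simp add: B_def)
      ultimately have "U' (f - Q f) = U f" using U[OF f] converges_unique by simp
      moreover have "U' (Q f) = 0" using Q_ker[OF f] unfolding kerB U'(3)[symmetric] by (simp add: ker_op_iff)
      ultimately show "U' f = U f" using f Q_mem[OF f] by (simp add: U'_lin(4)[OF hilbert_space_axioms])
    qed
  qed
qed

text \<open>
  A factor of \<open>T\<close> through \<open>|T|\<close> with the right kernel agrees with the partial isometry of the polar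
  decomposition, so identifying the latter involves no norms.
\<close>

lemma polar_op_eqI:
  assumes T: "T \<in> bounded_ops H H" and U: "U \<in> bounded_ops H H"
    and eq: "\<And>f. f \<in> elems H \<Longrightarrow> U (abs_op H T f) = T f" and ker: "ker_op H U = ker_op H T"
  shows "polar_op H T = U"
proof -
  obtain R where R: "R \<in> partial_isometries H" "\<And>f. f \<in> elems H \<Longrightarrow> R (abs_op H T f) = T f"
    "ker_op H R = ker_op H T"
    and unique: "\<And>U'. \<lbrakk>U' \<in> bounded_ops H H; \<And>f. f \<in> elems H \<Longrightarrow> U' (abs_op H T f) = T f;
       ker_op H U' = ker_op H T\<rbrakk> \<Longrightarrow> U' = R"
    using exists_polar_op[OF T] by blast
  have T_ext: "T \<in> extensional (elems H)" using T by (simp add: bounded_ops_def PiE_def)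
  have R_polar: "polar_op H T = R" unfolding polar_op_def
  proof (rule the_equality)
    have "T = compose (elems H) R (abs_op H T)"
      by (rule extensionalityI[OF T_ext]) (auto simp: compose_def R(2))
    thus "R \<in> partial_isometries H \<and> T = compose (elems H) R (abs_op H T) \<and>
        ker_op H R = ker_op H T \<and> ker_op H T = ker_op H (abs_op H T)"
      using R ker_abs_op[OF T] by blast
    fix U' assume U': "U' \<in> partial_isometries H \<and> T = compose (elems H) U' (abs_op H T) \<and>
        ker_op H U' = ker_op H T \<and> ker_op H T = ker_op H (abs_op H T)"
    show "U' = R"
    proof (rule unique)
      fix f assume f: "f \<in> elems H"
      have "T f = compose (elems H) U' (abs_op H T) f" using U' by simp
      thus "U' (abs_op H T f) = T f" using f by (simp add: compose_def)
    qed (use U' in \<open>auto simp: partial_isometries_def\<close>)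
  qed
  have "U = R" by (rule unique[OF U eq ker])
  thus ?thesis using R_polar by simp
qed

lemma polar_op_spec:
  assumes T: "T \<in> bounded_ops H H"
  shows polar_op_bounded: "polar_op H T \<in> bounded_ops H H"
    and polar_op_abs_op: "\<And>f. f \<in> elems H \<Longrightarrow> polar_op H T (abs_op H T f) = T f"
    and ker_polar_op: "ker_op H (polar_op H T) = ker_op H T"
proof -
  obtain R where R: "R \<in> partial_isometries H" "\<And>f. f \<in> elems H \<Longrightarrow> R (abs_op H T f) = T f"
    "ker_op H R = ker_op H T"
    and "\<And>U'. \<lbrakk>U' \<in> bounded_ops H H; \<And>f. f \<in> elems H \<Longrightarrow> U' (abs_op H T f) = T f;
       ker_op H U' = ker_op H T\<rbrakk> \<Longrightarrow> U' = R"
    using exists_polar_op[OF T] by blast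
  have Rb: "R \<in> bounded_ops H H" using R by (simp add: partial_isometries_def)
  have eq: "polar_op H T = R" by (rule polar_op_eqI) (fact T Rb R)+
  show "polar_op H T \<in> bounded_ops H H" using eq Rb by simp
  show "polar_op H T (abs_op H T f) = T f" if "f \<in> elems H" for f using eq R(2)[OF that] by simp
  show "ker_op H (polar_op H T) = ker_op H T" using eq R by simp
qed

lemma aluthge_bounded:
  assumes T: "T \<in> bounded_ops H H"
  shows "aluthge H T \<in> bounded_ops H H"
  unfolding aluthge_def
  by (intro bounded_ops_compose[where K = H] hilbert_space_axioms polar_op_bounded T positive_ops_bounded
      sqrt_op_positive abs_op_positive)

lemma aluthge_apply:
  "f \<in> elems H \<Longrightarrow> aluthge H T f =
    sqrt_op H (abs_op H T) (polar_op H T (sqrt_op H (abs_op H T) f))"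
  by (simp add: aluthge_def compose_def)

lemma iter_aluthge_bounded: "T \<in> bounded_ops H H \<Longrightarrow> iter_aluthge H n T \<in> bounded_ops H H"
  by (induction n) (auto simp: iter_aluthge_def aluthge_bounded)

end

section \<open>Aluthge transforms of scaled and of extended operators\<close>

context hilbert_space
begin

lemma adj_scale_op:
  assumes T: "T \<in> bounded_ops H H"
  shows "adj H H (scale_op H (of_real c) T) = scale_op H (of_real c) (adj H H T)"
proof (rule adj_eqI)
  note A = adj_bounded[OF hilbert_space_axioms T]
  show "scale_op H (of_real c) (adj H H T) \<in> bounded_ops H H"
    by (rule scale_op_bounded[OF hilbert_space_axioms A])
  show "ip H (scale_op H (of_real c) T f) g = ip H f (scale_op H (of_real c) (adj H H T) g)"
    if "f \<in> elems H" "g \<in> elems H" for f g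
    using that ip_adj[OF hilbert_space_axioms T that]
    by (simp add: scale_op_eq ip_linear bounded_ops_mem[OF T] bounded_ops_mem[OF A])
qed

lemma abs_op_scale_op:
  assumes T: "T \<in> bounded_ops H H" and c: "0 \<le> c"
  shows "abs_op H (scale_op H (of_real c) T) = scale_op H (of_real c) (abs_op H T)"
proof (rule abs_op_eqI)
  note A_lin = bounded_ops_simps[OF adj_bounded[OF hilbert_space_axioms T]]
  note B_lin = bounded_ops_simps[OF positive_ops_bounded[OF abs_op_positive[OF T]]]
  show "scale_op H (of_real c) T \<in> bounded_ops H H" by (rule scale_op_bounded[OF hilbert_space_axioms T])
  show "scale_op H (of_real c) (abs_op H T) \<in> positive_ops H"
    by (rule positive_ops_scale[OF abs_op_positive[OF T] c])
  show "scale_op H (of_real c) (abs_op H T) (scale_op H (of_real c) (abs_op H T) f) =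
      adj H H (scale_op H (of_real c) T) (scale_op H (of_real c) T f)" if "f \<in> elems H" for f
    unfolding adj_scale_op[OF T]
    using that by (simp add: scale_op_eq bounded_ops_mem[OF T] A_lin B_lin abs_op_square[OF T])
qed

lemma sqrt_op_scale_op:
  assumes P: "P \<in> positive_ops H" and c: "0 \<le> c"
  shows "sqrt_op H (scale_op H (of_real c) P) = scale_op H (of_real (sqrt c)) (sqrt_op H P)"
proof (rule sqrt_op_eqI)
  note S_lin = bounded_ops_simps[OF positive_ops_bounded[OF sqrt_op_positive[OF P]]]
  show "scale_op H (of_real (sqrt c)) (sqrt_op H P) \<in> positive_ops H"
    by (rule positive_ops_scale[OF sqrt_op_positive[OF P]]) (use c in simp)
  show "scale_op H (of_real c) P \<in> positive_ops H" by (rule positive_ops_scale[OF P c])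
  have "of_real (sqrt c) * of_real (sqrt c) = (of_real c :: complex)"
    using c by (simp flip: of_real_mult)
  thus "scale_op H (of_real (sqrt c)) (sqrt_op H P) (scale_op H (of_real (sqrt c)) (sqrt_op H P) f) =
      scale_op H (of_real c) P f" if "f \<in> elems H" for f
    using that by (simp add: scale_op_eq S_lin sqrt_op_square[OF P])
qed

text \<open>
  Both \<open>T\<close> and \<open>|T|\<close> are multiplied by \<open>c\<close>, so the same factor \<open>U\<close> works.
\<close>

lemma polar_op_scale_op:
  assumes T: "T \<in> bounded_ops H H" and c: "0 < c"
  shows "polar_op H (scale_op H (of_real c) T) = polar_op H T"
proof -
  note U_lin = bounded_ops_simps[OF polar_op_bounded[OF T]]
  note B_mem = bounded_ops_mem[OF positive_ops_bounded[OF abs_op_positive[OF T]]]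
  show ?thesis
  proof (rule polar_op_eqI)
    show "scale_op H (of_real c) T \<in> bounded_ops H H" by (rule scale_op_bounded[OF hilbert_space_axioms T])
    show "polar_op H T \<in> bounded_ops H H" by (rule polar_op_bounded[OF T])
    show "polar_op H T (abs_op H (scale_op H (of_real c) T) f) = scale_op H (of_real c) T f"
      if "f \<in> elems H" for f
      unfolding abs_op_scale_op[OF T less_imp_le[OF c]]
      using that by (simp add: scale_op_eq U_lin B_mem polar_op_abs_op[OF T])
    have nz: "of_real c \<cdot> g = 0 \<longleftrightarrow> g = 0" for g :: "'x \<Rightarrow> complex"
      using c by (simp add: fun_eq_iff)
    show "ker_op H (polar_op H T) = ker_op H (scale_op H (of_real c) T)"
      unfolding ker_polar_op[OF T] by (rule set_eqI) (simp add: ker_op_iff scale_op_eq nz cong: conj_cong)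
  qed
qed

lemma aluthge_scale_op:
  assumes T: "T \<in> bounded_ops H H" and c: "0 < c"
  shows "aluthge H (scale_op H (of_real c) T) = scale_op H (of_real c) (aluthge H T)"
proof (rule bounded_ops_eqI)
  note cT = scale_op_bounded[OF hilbert_space_axioms T, of "of_real c"]
  note R_lin = bounded_ops_simps[OF positive_ops_bounded[OF sqrt_op_positive[OF abs_op_positive[OF T]]]]
  note U_lin = bounded_ops_simps[OF polar_op_bounded[OF T]]
  show "aluthge H (scale_op H (of_real c) T) \<in> bounded_ops H H" by (rule aluthge_bounded[OF cT])
  show "scale_op H (of_real c) (aluthge H T) \<in> bounded_ops H H"
    by (rule scale_op_bounded[OF hilbert_space_axioms aluthge_bounded[OF T]])
  have sq: "of_real (sqrt c) * of_real (sqrt c) = (of_real c :: complex)"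
    using c by (simp flip: of_real_mult)
  have rt: "sqrt_op H (abs_op H (scale_op H (of_real c) T)) = scale_op H (of_real (sqrt c)) (sqrt_op H (abs_op H T))"
    using c by (simp add: abs_op_scale_op[OF T] sqrt_op_scale_op[OF abs_op_positive[OF T]])
  fix f assume f: "f \<in> elems H"
  show "aluthge H (scale_op H (of_real c) T) f = scale_op H (of_real c) (aluthge H T) f"
    unfolding aluthge_apply[OF f] rt polar_op_scale_op[OF T c]
    using f by (simp add: scale_op_eq R_lin U_lin aluthge_apply sq)
qed

lemma iter_aluthge_scale_op:
  assumes T: "T \<in> bounded_ops H H" and c: "0 < c"
  shows "iter_aluthge H n (scale_op H (of_real c) T) = scale_op H (of_real c) (iter_aluthge H n T)"
proof (induction n)
  case (Suc n)
  show "iter_aluthge H (Suc n) (scale_op H (of_real c) T) = scale_op H (of_real c) (iter_aluthge H (Suc n) T)"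
    using Suc aluthge_scale_op[OF iter_aluthge_bounded[OF T, of n] c] by (simp add: iter_aluthge_def)
qed (simp add: iter_aluthge_def)

end

text \<open>
  An isometry \<open>J\<close> of \<open>K\<close> into \<open>H\<close> turns an operator \<open>X\<close> on \<open>K\<close> into the operator
  \<open>1 + J (X - 1) J\<^sup>*\<close> on \<open>H\<close>, which is \<open>J X J\<^sup>*\<close> on the range of \<open>J\<close> and the identity on its orthogonal
  complement. Written in this form, it needs no orthogonal projections.
\<close>

locale isometric_embedding = H: hilbert_space H + K: hilbert_space K
  for H K :: "'x fspace" +
  fixes J :: "'x fop"
  assumes J_bounded: "J \<in> bounded_ops K H"
    and J_isometric: "f \<in> elems K \<Longrightarrow> g \<in> elems K \<Longrightarrow> ip H (J f) (J g) = ip K f g"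
begin

abbreviation "J' \<equiv> adj K H J"

lemmas J'_bounded = K.adj_bounded[OF H.hilbert_space_axioms J_bounded]
lemmas J_lin = bounded_ops_simps[OF J_bounded]
lemmas J'_lin = bounded_ops_simps[OF J'_bounded]
lemmas ip_J = K.ip_adj[OF H.hilbert_space_axioms J_bounded]
lemmas ip_J' = K.ip_adj_left[OF H.hilbert_space_axioms J_bounded]

lemma J'_J: "f \<in> elems K \<Longrightarrow> J' (J f) = f"
  by (rule K.eq_if_ip_eq) (simp_all add: J_lin(1) J'_lin(1) ip_J[symmetric] J_isometric)

definition extend_op :: "'x fop \<Rightarrow> 'x fop" where
  "extend_op X = (\<lambda>f\<in>elems H. f + J (X (J' f) - J' f))"

lemma extend_op_bounded:
  assumes X: "X \<in> bounded_ops K K"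
  shows "extend_op X \<in> bounded_ops H H"
proof -
  let ?D = "\<lambda>f\<in>elems K. 1 \<cdot> X f + (-1) \<cdot> id_op (elems K) f"
  have D: "?D \<in> bounded_ops K K"
    by (intro bounded_ops_comb id_op_bounded X K.hilbert_space_axioms)
  have "?D f = X f - f" if "f \<in> elems K" for f
    using that by (simp add: id_op_def fun_eq_iff)
  hence "extend_op X = (\<lambda>f\<in>elems H. 1 \<cdot> id_op (elems H) f + 1 \<cdot> compose (elems H) J (compose (elems H) ?D J') f)"
    unfolding extend_op_def by (intro restrict_ext) (simp add: id_op_def compose_def J'_lin(1))
  moreover have "\<dots> \<in> bounded_ops H H"
    by (intro bounded_ops_comb bounded_ops_compose[where K = K] id_op_bounded D J_bounded J'_bounded
        H.hilbert_space_axioms K.hilbert_space_axioms)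
  ultimately show ?thesis by simp
qed

lemma J'_extend_op:
  assumes X: "X \<in> bounded_ops K K" and f: "f \<in> elems H"
  shows "J' (extend_op X f) = X (J' f)"
  using f bounded_ops_mem[OF X] by (simp add: extend_op_def J'_lin(1,2) J_lin(1) J'_J)

lemma extend_op_compose:
  assumes X: "X \<in> bounded_ops K K" and Y: "Y \<in> bounded_ops K K" and f: "f \<in> elems H"
  shows "extend_op X (extend_op Y f) = extend_op (compose (elems K) X Y) f"
proof -
  note X_mem = bounded_ops_mem[OF X] and Y_mem = bounded_ops_mem[OF Y]
  have "extend_op X (extend_op Y f) = extend_op Y f + J (X (Y (J' f)) - Y (J' f))"
    using J'_extend_op[OF Y f] bounded_ops_mem[OF extend_op_bounded[OF Y] f] by (simp add: extend_op_def[of X])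
  also have "\<dots> = f + (J (Y (J' f) - J' f) + J (X (Y (J' f)) - Y (J' f)))"
    using f by (simp add: extend_op_def add.assoc)
  also have "J (Y (J' f) - J' f) + J (X (Y (J' f)) - Y (J' f)) = J (X (Y (J' f)) - J' f)"
    using f by (simp add: J_lin(2)[symmetric] X_mem Y_mem J'_lin(1))
  finally have "extend_op X (extend_op Y f) = f + J (X (Y (J' f)) - J' f)" .
  moreover have "extend_op (compose (elems K) X Y) f = f + J (X (Y (J' f)) - J' f)"
    using f by (simp add: extend_op_def compose_def J'_lin(1))
  ultimately show ?thesis by (simp only:)
qed

lemma ip_extend_op:
  assumes X: "X \<in> bounded_ops K K" and Y: "Y \<in> bounded_ops K K"
    and XY: "\<And>f g. f \<in> elems K \<Longrightarrow> g \<in> elems K \<Longrightarrow> ip K (X f) g = ip K f (Y g)"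
    and f: "f \<in> elems H" and g: "g \<in> elems H"
  shows "ip H (extend_op X f) g = ip H f (extend_op Y g)"
proof -
  note X_mem = bounded_ops_mem[OF X] and Y_mem = bounded_ops_mem[OF Y]
  have "ip H (extend_op X f) g = ip H f g + ip K (X (J' f) - J' f) (J' g)"
    using f g by (simp add: extend_op_def H.ip_add_left J_lin(1) J'_lin(1) X_mem ip_J)
  also have "ip K (X (J' f) - J' f) (J' g) = ip K (J' f) (Y (J' g) - J' g)"
    using f g by (simp add: K.ip_diff_left K.ip_diff_right J'_lin(1) X_mem Y_mem XY)
  also have "ip H f g + \<dots> = ip H f (extend_op Y g)"
    using f g by (simp add: extend_op_def H.ip_add_right J_lin(1) J'_lin(1) Y_mem ip_J')
  finally show ?thesis .
qed

lemma adj_extend_op: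
  assumes X: "X \<in> bounded_ops K K"
  shows "adj H H (extend_op X) = extend_op (adj K K X)"
proof (rule H.adj_eqI)
  note A = K.adj_bounded[OF K.hilbert_space_axioms X]
  show "extend_op (adj K K X) \<in> bounded_ops H H" by (rule extend_op_bounded[OF A])
  show "ip H (extend_op X f) g = ip H f (extend_op (adj K K X) g)"
    if "f \<in> elems H" "g \<in> elems H" for f g
    by (rule ip_extend_op[OF X A _ that]) (rule K.ip_adj[OF K.hilbert_space_axioms X])
qed

text \<open>
  \<open>P = R\<^sup>2\<close> with \<open>R\<close> symmetric is carried to the square of a symmetric operator.
\<close>

lemma extend_op_positive:
  assumes P: "P \<in> positive_ops K"
  shows "extend_op P \<in> positive_ops H"
proof (rule H.positive_opsI)
  note R = K.sqrt_op_positive[OF P]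
  note Rb = K.positive_ops_bounded[OF R]
  note Pb = K.positive_ops_bounded[OF P]
  show "extend_op P \<in> bounded_ops H H" by (rule extend_op_bounded[OF Pb])
  show "ip H (extend_op P f) g = ip H f (extend_op P g)" if "f \<in> elems H" "g \<in> elems H" for f g
    by (rule ip_extend_op[OF Pb Pb _ that]) (rule K.positive_ops_symmetric[OF P])
  show "0 \<le> Re (ip H (extend_op P f) f)" if f: "f \<in> elems H" for f
  proof -
    let ?S = "extend_op (sqrt_op K P)"
    have S: "?S f \<in> elems H" by (rule bounded_ops_mem[OF extend_op_bounded[OF Rb] f])
    have eq: "extend_op P f = ?S (?S f)"
      unfolding extend_op_compose[OF Rb Rb f]
      using f by (simp add: extend_op_def compose_def J'_lin(1) K.sqrt_op_square[OF P])
    have "ip H (?S (?S f)) f = ip H (?S f) (?S f)"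
      by (rule ip_extend_op[OF Rb Rb _ S f]) (rule K.positive_ops_symmetric[OF R])
    thus ?thesis using H.ip_nonneg[OF S] by (simp only: eq)
  qed
qed

lemma extend_op_cong:
  "(\<And>f. f \<in> elems K \<Longrightarrow> X f = Y f) \<Longrightarrow> extend_op X = extend_op Y"
  unfolding extend_op_def by (intro restrict_ext) (simp add: J'_lin(1))

text \<open>
  The extension map is multiplicative and preserves positivity, so the image of the square root is a
  positive square root of the image, and there is only one.
\<close>

lemma sqrt_extend_op:
  assumes P: "P \<in> positive_ops K"
  shows "sqrt_op H (extend_op P) = extend_op (sqrt_op K P)"
proof (rule H.sqrt_op_eqI)
  note R = K.sqrt_op_positive[OF P]
  note Rb = K.positive_ops_bounded[OF R]
  show "extend_op (sqrt_op K P) \<in> positive_ops H" by (rule extend_op_positive[OF R])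
  show "extend_op P \<in> positive_ops H" by (rule extend_op_positive[OF P])
  have "extend_op (compose (elems K) (sqrt_op K P) (sqrt_op K P)) = extend_op P"
    by (rule extend_op_cong) (simp add: compose_def K.sqrt_op_square[OF P])
  thus "extend_op (sqrt_op K P) (extend_op (sqrt_op K P) f) = extend_op P f" if "f \<in> elems H" for f
    by (simp only: extend_op_compose[OF Rb Rb that])
qed

lemma abs_extend_op:
  assumes T: "T \<in> bounded_ops K K"
  shows "abs_op H (extend_op T) = extend_op (abs_op K T)"
proof (rule H.abs_op_eqI)
  note B = K.abs_op_positive[OF T]
  note Bb = K.positive_ops_bounded[OF B]
  note A = K.adj_bounded[OF K.hilbert_space_axioms T]
  show "extend_op T \<in> bounded_ops H H" by (rule extend_op_bounded[OF T])
  show "extend_op (abs_op K T) \<in> positive_ops H" by (rule extend_op_positive[OF B])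
  have "extend_op (compose (elems K) (abs_op K T) (abs_op K T)) = extend_op (compose (elems K) (adj K K T) T)"
    by (rule extend_op_cong) (simp add: compose_def K.abs_op_square[OF T])
  thus "extend_op (abs_op K T) (extend_op (abs_op K T) f) = adj H H (extend_op T) (extend_op T f)"
    if "f \<in> elems H" for f
    by (simp only: adj_extend_op[OF T] extend_op_compose[OF Bb Bb that] extend_op_compose[OF A T that])
qed

text \<open>
  The kernel of the extension depends on \<open>X\<close> only through the kernel of \<open>X\<close>. That is how the kernel
  condition of the polar decomposition is transported.
\<close>

lemma ker_extend_op:
  assumes X: "X \<in> bounded_ops K K"
  shows "ker_op H (extend_op X) = {f \<in> elems H. J' f \<in> ker_op K X \<and> J (J' f) = f}"
proof -
  have "extend_op X f = 0 \<longleftrightarrow> X (J' f) = 0 \<and> J (J' f) = f" if f: "f \<in> elems H" for f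
  proof -
    have J'f: "J' f \<in> elems K" using f by (rule J'_lin(1))
    have *: "extend_op X f = f - J (J' f)" if "X (J' f) = 0"
      using f that by (simp add: extend_op_def J_lin(4)[OF K.hilbert_space_axioms _ J'f, of 0, simplified]
          J_lin(5)[OF K.hilbert_space_axioms])
    show ?thesis
    proof
      assume 0: "extend_op X f = 0"
      hence "X (J' f) = 0"
        using J'_extend_op[OF X f] J'_lin(5)[OF H.hilbert_space_axioms] by simp
      thus "X (J' f) = 0 \<and> J (J' f) = f" using * 0 by simp
    qed (use * in simp)
  qed
  thus ?thesis using J'_lin(1) by (auto simp: ker_op_iff)
qed

lemma polar_extend_op:
  assumes T: "T \<in> bounded_ops K K"
  shows "polar_op H (extend_op T) = extend_op (polar_op K T)"
proof -
  note U = K.polar_op_bounded[OF T]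
  note B = K.positive_ops_bounded[OF K.abs_op_positive[OF T]]
  show ?thesis
  proof (rule H.polar_op_eqI)
    show "extend_op T \<in> bounded_ops H H" by (rule extend_op_bounded[OF T])
    show "extend_op (polar_op K T) \<in> bounded_ops H H" by (rule extend_op_bounded[OF U])
    have "extend_op (compose (elems K) (polar_op K T) (abs_op K T)) = extend_op T"
      by (rule extend_op_cong) (simp add: compose_def K.polar_op_abs_op[OF T])
    thus "extend_op (polar_op K T) (abs_op H (extend_op T) f) = extend_op T f" if "f \<in> elems H" for f
      by (simp only: abs_extend_op[OF T] extend_op_compose[OF U B that])
    show "ker_op H (extend_op (polar_op K T)) = ker_op H (extend_op T)"
      by (simp only: ker_extend_op[OF U] ker_extend_op[OF T] K.ker_polar_op[OF T])
  qed
qed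

lemma aluthge_extend_op:
  assumes T: "T \<in> bounded_ops K K"
  shows "aluthge H (extend_op T) = extend_op (aluthge K T)"
proof (rule bounded_ops_eqI)
  note A = K.abs_op_positive[OF T]
  note R = K.positive_ops_bounded[OF K.sqrt_op_positive[OF A]]
  note U = K.polar_op_bounded[OF T]
  note UR = bounded_ops_compose[OF K.hilbert_space_axioms K.hilbert_space_axioms U R]
  show "aluthge H (extend_op T) \<in> bounded_ops H H" by (rule H.aluthge_bounded[OF extend_op_bounded[OF T]])
  show "extend_op (aluthge K T) \<in> bounded_ops H H" by (rule extend_op_bounded[OF K.aluthge_bounded[OF T]])
  fix f assume f: "f \<in> elems H"
  show "aluthge H (extend_op T) f = extend_op (aluthge K T) f"
    unfolding H.aluthge_apply[OF f] abs_extend_op[OF T] sqrt_extend_op[OF A] polar_extend_op[OF T]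
      extend_op_compose[OF U R f] extend_op_compose[OF R UR f] aluthge_def[of K] ..
qed

lemma iter_aluthge_extend_op:
  assumes T: "T \<in> bounded_ops K K"
  shows "iter_aluthge H n (extend_op T) = extend_op (iter_aluthge K n T)"
proof (induction n)
  case (Suc n)
  show "iter_aluthge H (Suc n) (extend_op T) = extend_op (iter_aluthge K (Suc n) T)"
    using Suc aluthge_extend_op[OF K.iter_aluthge_bounded[OF T, of n]] by (simp add: iter_aluthge_def)
qed (simp add: iter_aluthge_def)

end

text \<open>
  Here the subspace \<open>N\<close> is a space of its own, as the target of \<open>V\<close>, while the isometry used for the
  extension has target \<open>H\<close>.
\<close>

locale unitary_onto_subspace = H: hilbert_space H + K: hilbert_space K
  for H K :: "'x fspace" +
  fixes N :: "'x fspace" and V :: "'x fop"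
  assumes N_subset: "elems N \<subseteq> elems H"
    and ip_N: "ip N = ip H"
    and V_unitary: "V \<in> unitary_ops K N"
begin

lemma V_bounded_N: "V \<in> bounded_ops K N" using V_unitary by (simp add: unitary_ops_def)

lemma V_bounded: "V \<in> bounded_ops K H"
proof (rule bounded_opsI[where M = 1])
  show "hnorm H (V f) \<le> 1 * hnorm K f" if "f \<in> elems K" for f
    using V_unitary that by (simp add: unitary_ops_def hnorm_def flip: ip_N)
  show "V f \<in> elems H" if "f \<in> elems K" for f using bounded_ops_mem[OF V_bounded_N that] N_subset by blast
  show "V \<in> extensional (elems K)" using V_bounded_N by (simp add: bounded_ops_def PiE_def)
qed (simp_all add: bounded_ops_add[OF V_bounded_N] bounded_ops_smul[OF V_bounded_N])

sublocale isometric_embedding H K V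
  by unfold_locales (use V_bounded V_unitary in \<open>auto simp: unitary_ops_def ip_N\<close>)

lemma adj_N: "adj K N V = restrict J' (elems N)"
proof (rule K.adj_eqI)
  show "restrict J' (elems N) \<in> bounded_ops N K"
  proof (rule bounded_opsI)
    have im: "elems N = V ` elems K" using V_unitary by (simp add: unitary_ops_def)
    show "hnorm K (restrict J' (elems N) f) \<le> 1 * hnorm N f" if "f \<in> elems N" for f
      using that unfolding im by (auto simp: J'_J hnorm_def ip_N J_isometric)
    have "f + g \<in> elems N" if "f \<in> elems N" "g \<in> elems N" for f g
      using that unfolding im by (auto simp: J_lin(2)[symmetric])
    thus "restrict J' (elems N) (f + g) = restrict J' (elems N) f + restrict J' (elems N) g"
      if "f \<in> elems N" "g \<in> elems N" for f g
      using that N_subset by (simp add: J'_lin(2) subset_iff)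
    have "c \<cdot> f \<in> elems N" if "f \<in> elems N" for c f
      using that unfolding im by (auto simp: J_lin(3)[symmetric])
    thus "restrict J' (elems N) (c \<cdot> f) = c \<cdot> restrict J' (elems N) f" if "f \<in> elems N" for c f
      using that N_subset by (simp add: J'_lin(3) subset_iff)
  qed (use N_subset J'_lin(1) in auto)
  show "ip N (V f) g = ip K f (restrict J' (elems N) g)" if "f \<in> elems K" "g \<in> elems N" for f g
    using that ip_J[of f g] N_subset by (auto simp: ip_N)
qed

lemma ortho_N: "g \<in> ortho H (elems N) \<longleftrightarrow> g \<in> elems H \<and> J' g = 0"
proof -
  have im: "elems N = V ` elems K" using V_unitary by (simp add: unitary_ops_def)
  have "(\<forall>h\<in>elems N. ip H g h = 0) \<longleftrightarrow> J' g = 0" if g: "g \<in> elems H"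
  proof
    assume "\<forall>h\<in>elems N. ip H g h = 0"
    hence "ip K (J' g) (J' g) = 0"
      using ip_J'[OF J'_lin(1)[OF g] g] J'_lin(1)[OF g] im by simp
    thus "J' g = 0" by (rule K.ip_definite[OF J'_lin(1)[OF g]])
  next
    assume "J' g = 0"
    thus "\<forall>h\<in>elems N. ip H g h = 0" using g unfolding im by (auto simp: ip_J'[symmetric])
  qed
  thus ?thesis by (auto simp: ortho_def)
qed

text \<open>
  The decomposition of \<open>f\<close> along \<open>N\<close> is \<open>f = (f - V V\<^sup>* f) + V V\<^sup>* f\<close>.
\<close>

lemma direct_sum_op_eq_extend_op:
  assumes X: "X \<in> bounded_ops K K"
  shows "direct_sum_op H (ortho H (elems N)) (elems N) (id_op (ortho H (elems N)))
      (compose (elems N) V (compose (elems N) X (adj K N V))) = extend_op X"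
  unfolding direct_sum_op_def extend_op_def
proof (rule restrict_ext)
  fix f assume f: "f \<in> elems H"
  let ?M = "ortho H (elems N)"
  let ?A = "id_op ?M" and ?B = "compose (elems N) V (compose (elems N) X (adj K N V))"
  have J'f: "J' f \<in> elems K" using f by (rule J'_lin(1))
  have X_mem: "X (J' f) \<in> elems K" by (rule bounded_ops_mem[OF X J'f])
  let ?h = "V (J' f)"
  have h: "?h \<in> elems N" using bounded_ops_mem[OF V_bounded_N J'f] .
  have hH: "?h \<in> elems H" using h N_subset by blast
  have g: "f - ?h \<in> ?M"
    using f hH J'f by (simp add: ortho_N J'_lin(4)[OF H.hilbert_space_axioms] J'_J)
  have val: "(\<lambda>x. ?A (f - ?h) x + ?B ?h x) = f + V (X (J' f) - J' f)"
    using g h J'f X_mem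
    by (simp add: id_op_def compose_def adj_N J'_J J_lin(4)[OF K.hilbert_space_axioms] fun_eq_iff)
  show "(THE k. \<exists>g\<in>?M. \<exists>h\<in>elems N. f = (\<lambda>x. g x + h x) \<and> k = (\<lambda>x. ?A g x + ?B h x)) =
      f + V (X (J' f) - J' f)"
  proof (rule the_equality)
    show "\<exists>g\<in>?M. \<exists>h\<in>elems N. f = (\<lambda>x. g x + h x) \<and> f + V (X (J' f) - J' f) = (\<lambda>x. ?A g x + ?B h x)"
      using g h val by (intro bexI[of _ "f - ?h"] bexI[of _ ?h]) (auto simp: fun_eq_iff)
    fix k assume "\<exists>g\<in>?M. \<exists>h\<in>elems N. f = (\<lambda>x. g x + h x) \<and> k = (\<lambda>x. ?A g x + ?B h x)"
    then obtain g' h' where *: "g' \<in> ?M" "h' \<in> elems N" "f = g' + h'" "k = (\<lambda>x. ?A g' x + ?B h' x)"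
      by (auto simp: plus_fun_def)
    have "h' \<in> V ` elems K" using *(2) V_unitary by (simp add: unitary_ops_def)
    then obtain u where u: "u \<in> elems K" "h' = V u" by blast
    have "J' f = J' g' + J' h'" using *(1,2,3) N_subset ortho_N by (auto simp: J'_lin(2))
    hence "J' f = u" using *(1) u by (simp add: ortho_N J'_J)
    hence "h' = ?h" using u by simp
    moreover from this have "g' = f - ?h" using *(3) by simp
    ultimately show "k = f + V (X (J' f) - J' f)" using *(4) val by simp
  qed
qed

end

section \<open>Weighted Hardy spaces as Hilbert spaces\<close>

definition disk_series :: "(nat \<Rightarrow> complex) \<Rightarrow> complex \<Rightarrow> complex" where
  "disk_series c z = (if z \<in> ball 0 1 then \<Sum>n. c n * z ^ n else 0)"

lemma taylor_coeff_unique: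
  assumes "\<And>z. z \<in> ball 0 1 \<Longrightarrow> (\<lambda>n. c n * z ^ n) sums f z"
  shows "taylor_coeff f = c"
proof -
  have "f has_fps_expansion Abs_fps c"
  proof (rule has_fps_expansionI)
    have "\<forall>\<^sub>F z in nhds 0. z \<in> ball (0::complex) 1" by (rule eventually_nhds_in_open) auto
    thus "\<forall>\<^sub>F u in nhds 0. (\<lambda>n. fps_nth (Abs_fps c) n * u ^ n) sums f u"
      by eventually_elim (simp add: assms)
  qed
  hence "fps_expansion f 0 = Abs_fps c" by (rule fps_expansion_eqI)
  thus ?thesis by (simp add: taylor_coeff_def fun_eq_iff)
qed

lemma taylor_coeff_sums:
  assumes "f holomorphic_on ball 0 1" "z \<in> ball 0 1"
  shows "(\<lambda>n. taylor_coeff f n * z ^ n) sums f z"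
  using holomorphic_power_series[OF assms] by (simp add: taylor_coeff_def fps_expansion_def)

definition sq_summable :: "(nat \<Rightarrow> real) \<Rightarrow> (nat \<Rightarrow> complex) \<Rightarrow> bool" where
  "sq_summable w c \<longleftrightarrow> summable (\<lambda>n. (cmod (c n))\<^sup>2 * (w n)\<^sup>2)"

text \<open>
  Summability of \<open>r\<^sup>n / w\<^sub>n\<^sup>2\<close> for \<open>r < 1\<close> is what the space needs twice: every weighted square
  summable coefficient sequence defines a function on the disk, and the reproducing kernels
  belong to the space.
\<close>

locale weight =
  fixes w :: "nat \<Rightarrow> real"
  assumes weight_pos [simp]: "0 < w n"
    and weight_summable: "\<And>r. 0 \<le> r \<Longrightarrow> r < 1 \<Longrightarrow> summable (\<lambda>n. r ^ n / (w n)\<^sup>2)"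
begin

lemma weight_nonzero [simp]: "w n \<noteq> 0" using weight_pos[of n] by linarith

lemma sq_summable_sums:
  assumes c: "sq_summable w c" and z: "z \<in> ball 0 1"
  shows "(\<lambda>n. c n * z ^ n) sums disk_series c z"
proof -
  have "summable (\<lambda>n. c n * z ^ n)"
  proof (rule summable_comparison_test')
    have "cmod z ^ 2 < 1" using z by (simp add: power_less_one_iff)
    from weight_summable[OF _ this] have "summable (\<lambda>n. ((cmod z)\<^sup>2) ^ n / (w n)\<^sup>2)" by simp
    from summable_add[OF c[unfolded sq_summable_def] this]
    show "summable (\<lambda>n. (cmod (c n))\<^sup>2 * (w n)\<^sup>2 + ((cmod z)\<^sup>2) ^ n / (w n)\<^sup>2)" .
    fix n
    have "0 \<le> (cmod (c n) * w n - cmod z ^ n / w n)\<^sup>2" by simp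
    hence "2 * (cmod (c n) * cmod z ^ n) \<le> (cmod (c n) * w n)\<^sup>2 + (cmod z ^ n / w n)\<^sup>2"
      by (simp add: power2_diff)
    moreover have "0 \<le> cmod (c n) * cmod z ^ n" by simp
    ultimately have "cmod (c n) * cmod z ^ n \<le> (cmod (c n) * w n)\<^sup>2 + (cmod z ^ n / w n)\<^sup>2" by linarith
    thus "norm (c n * z ^ n) \<le> (cmod (c n))\<^sup>2 * (w n)\<^sup>2 + ((cmod z)\<^sup>2) ^ n / (w n)\<^sup>2"
      by (simp add: norm_mult norm_power power_mult_distrib power_divide mult.commute flip: power_mult)
  qed
  thus ?thesis using z by (simp add: disk_series_def summable_sums)
qed

lemma taylor_coeff_disk_series: "sq_summable w c \<Longrightarrow> taylor_coeff (disk_series c) = c"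
  by (rule taylor_coeff_unique) (rule sq_summable_sums)

lemma disk_series_mem: "sq_summable w c \<Longrightarrow> disk_series c \<in> elems (H2 w)"
proof -
  assume c: "sq_summable w c"
  have "disk_series c holomorphic_on ball 0 1"
    by (rule power_series_holomorphic[of 0 1 c]) (use sq_summable_sums[OF c] in auto)
  thus ?thesis using c
    by (simp add: H2_def taylor_coeff_disk_series sq_summable_def) (simp add: disk_series_def)
qed

lemma H2_sq_summable: "f \<in> elems (H2 w) \<Longrightarrow> sq_summable w (taylor_coeff f)"
  by (simp add: H2_def sq_summable_def)

lemma H2_sums: "f \<in> elems (H2 w) \<Longrightarrow> z \<in> ball 0 1 \<Longrightarrow> (\<lambda>n. taylor_coeff f n * z ^ n) sums f z"
  by (rule taylor_coeff_sums) (auto simp: H2_def)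

lemma H2_outside: "f \<in> elems (H2 w) \<Longrightarrow> z \<notin> ball 0 1 \<Longrightarrow> f z = 0"
  by (simp add: H2_def)

lemma H2_eq_disk_series: "f \<in> elems (H2 w) \<Longrightarrow> f = disk_series (taylor_coeff f)"
  using H2_sums[of f] H2_outside[of f] by (auto simp: disk_series_def fun_eq_iff sums_iff)

lemma H2_eqI: "\<lbrakk>f \<in> elems (H2 w); g \<in> elems (H2 w); \<And>n. taylor_coeff f n = taylor_coeff g n\<rbrakk> \<Longrightarrow> f = g"
  using H2_eq_disk_series[of f] H2_eq_disk_series[of g] by (metis ext)

lemma taylor_coeff_add: "\<lbrakk>f \<in> elems (H2 w); g \<in> elems (H2 w)\<rbrakk> \<Longrightarrow>
    taylor_coeff (f + g) = (\<lambda>n. taylor_coeff f n + taylor_coeff g n)"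
  by (rule taylor_coeff_unique) (use sums_add[OF H2_sums H2_sums] in \<open>auto simp: distrib_right\<close>)

lemma taylor_coeff_smul: "f \<in> elems (H2 w) \<Longrightarrow> taylor_coeff (c \<cdot> f) = (\<lambda>n. c * taylor_coeff f n)"
  by (rule taylor_coeff_unique) (use sums_mult[OF H2_sums] in \<open>auto simp: mult.assoc\<close>)

lemma sq_summable_add:
  assumes "sq_summable w c" "sq_summable w d"
  shows "sq_summable w (\<lambda>n. c n + d n)"
  unfolding sq_summable_def
proof (rule summable_comparison_test')
  show "summable (\<lambda>n. 2 * ((cmod (c n))\<^sup>2 * (w n)\<^sup>2) + 2 * ((cmod (d n))\<^sup>2 * (w n)\<^sup>2))"
    using assms unfolding sq_summable_def by (intro summable_add summable_mult)
  fix n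
  have "(cmod (c n + d n))\<^sup>2 \<le> (cmod (c n) + cmod (d n))\<^sup>2" by (intro power_mono norm_triangle_ineq) simp
  also have "\<dots> \<le> 2 * (cmod (c n))\<^sup>2 + 2 * (cmod (d n))\<^sup>2"
    using sum_squares_bound[of "cmod (c n)" "cmod (d n)"] by (simp add: power2_sum)
  finally have "(cmod (c n + d n))\<^sup>2 * (w n)\<^sup>2 \<le> (2 * (cmod (c n))\<^sup>2 + 2 * (cmod (d n))\<^sup>2) * (w n)\<^sup>2"
    by (rule mult_right_mono) simp
  thus "norm ((cmod (c n + d n))\<^sup>2 * (w n)\<^sup>2) \<le> 2 * ((cmod (c n))\<^sup>2 * (w n)\<^sup>2) + 2 * ((cmod (d n))\<^sup>2 * (w n)\<^sup>2)"
    by (simp add: algebra_simps)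
qed

lemma sq_summable_smul: "sq_summable w c \<Longrightarrow> sq_summable w (\<lambda>n. k * c n)"
  unfolding sq_summable_def
  by (drule summable_mult[of _ "(cmod k)\<^sup>2"]) (simp add: norm_mult power_mult_distrib mult_ac)

lemma H2_mem_iff: "f \<in> elems (H2 w) \<longleftrightarrow> (\<exists>c. sq_summable w c \<and> f = disk_series c)"
  using H2_sq_summable H2_eq_disk_series disk_series_mem by blast

lemma disk_series_add: "sq_summable w c \<Longrightarrow> sq_summable w d \<Longrightarrow>
   disk_series c + disk_series d = disk_series (\<lambda>n. c n + d n)"
proof
  fix z assume cd: "sq_summable w c" "sq_summable w d"
  show "(disk_series c + disk_series d) z = disk_series (\<lambda>n. c n + d n) z"
  proof (cases "z \<in> ball 0 1")
    case True
    from sums_add[OF cd[THEN sq_summable_sums, OF True]] sq_summable_sums[OF sq_summable_add[OF cd] True]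
    show ?thesis by (simp add: distrib_right sums_unique2)
  qed (simp add: disk_series_def)
qed

lemma disk_series_smul: "sq_summable w c \<Longrightarrow> k \<cdot> disk_series c = disk_series (\<lambda>n. k * c n)"
proof
  fix z assume c: "sq_summable w c"
  show "(k \<cdot> disk_series c) z = disk_series (\<lambda>n. k * c n) z"
  proof (cases "z \<in> ball 0 1")
    case True
    from sums_mult[OF sq_summable_sums[OF c True], of k] sq_summable_sums[OF sq_summable_smul[OF c, of k] True]
    show ?thesis by (simp add: mult.assoc sums_unique2)
  qed (simp add: disk_series_def)
qed

lemma H2_add_mem: "f \<in> elems (H2 w) \<Longrightarrow> g \<in> elems (H2 w) \<Longrightarrow> f + g \<in> elems (H2 w)"
  by (metis H2_mem_iff disk_series_add sq_summable_add)

lemma H2_smul_mem: "f \<in> elems (H2 w) \<Longrightarrow> c \<cdot> f \<in> elems (H2 w)"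
  by (metis H2_mem_iff disk_series_smul sq_summable_smul)

lemma ip_H2: "ip (H2 w) f g = (\<Sum>n. taylor_coeff f n * cnj (taylor_coeff g n) * of_real ((w n)\<^sup>2))"
  by (simp add: H2_def)

lemma ip_H2_sums:
  assumes "f \<in> elems (H2 w)" "g \<in> elems (H2 w)"
  shows "(\<lambda>n. taylor_coeff f n * cnj (taylor_coeff g n) * of_real ((w n)\<^sup>2)) sums ip (H2 w) f g"
proof -
  have "summable (\<lambda>n. taylor_coeff f n * cnj (taylor_coeff g n) * of_real ((w n)\<^sup>2))"
  proof (rule summable_comparison_test')
    show "summable (\<lambda>n. (cmod (taylor_coeff f n))\<^sup>2 * (w n)\<^sup>2 + (cmod (taylor_coeff g n))\<^sup>2 * (w n)\<^sup>2)"
      using assms[THEN H2_sq_summable] unfolding sq_summable_def by (intro summable_add)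
    fix n
    let ?x = "cmod (taylor_coeff f n)" and ?y = "cmod (taylor_coeff g n)"
    have "0 \<le> ?x * ?y" by simp
    hence "?x * ?y \<le> ?x\<^sup>2 + ?y\<^sup>2" using sum_squares_bound[of ?x ?y] by linarith
    hence "?x * ?y * (w n)\<^sup>2 \<le> (?x\<^sup>2 + ?y\<^sup>2) * (w n)\<^sup>2" by (rule mult_right_mono) simp
    thus "norm (taylor_coeff f n * cnj (taylor_coeff g n) * of_real ((w n)\<^sup>2)) \<le> ?x\<^sup>2 * (w n)\<^sup>2 + ?y\<^sup>2 * (w n)\<^sup>2"
      by (simp add: norm_mult norm_power distrib_right)
  qed
  thus ?thesis by (simp add: ip_H2 summable_sums)
qed

lemma ip_H2_nonneg: "0 \<le> Re (ip (H2 w) f f)" if "f \<in> elems (H2 w)"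
proof (rule sums_le[OF _ sums_zero sums_Re[OF ip_H2_sums[OF that that]]])
  show "0 \<le> Re (taylor_coeff f n * cnj (taylor_coeff f n) * of_real ((w n)\<^sup>2))" for n
    by (simp add: complex_mult_cnj del: of_real_power)
qed

lemma hnorm_H2_nonneg: "f \<in> elems (H2 w) \<Longrightarrow> 0 \<le> hnorm (H2 w) f"
  using ip_H2_nonneg by (simp add: hnorm_def)

lemma hnorm_H2_sums:
  assumes "f \<in> elems (H2 w)"
  shows "(\<lambda>n. (cmod (taylor_coeff f n))\<^sup>2 * (w n)\<^sup>2) sums (hnorm (H2 w) f)\<^sup>2"
proof -
  have "(\<lambda>n. Re (taylor_coeff f n * cnj (taylor_coeff f n) * of_real ((w n)\<^sup>2))) sums Re (ip (H2 w) f f)"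
    by (rule sums_Re[OF ip_H2_sums[OF assms assms]])
  moreover have "Re (taylor_coeff f n * cnj (taylor_coeff f n) * of_real ((w n)\<^sup>2)) =
      (cmod (taylor_coeff f n))\<^sup>2 * (w n)\<^sup>2" for n
    by (simp add: complex_mult_cnj cmod_power2 del: of_real_power)
  ultimately have s: "(\<lambda>n. (cmod (taylor_coeff f n))\<^sup>2 * (w n)\<^sup>2) sums Re (ip (H2 w) f f)" by simp
  thus ?thesis using ip_H2_nonneg[OF assms] by (simp add: hnorm_def)
qed

lemma taylor_coeff_diff: "\<lbrakk>f \<in> elems (H2 w); g \<in> elems (H2 w)\<rbrakk> \<Longrightarrow>
    taylor_coeff (f - g) = (\<lambda>n. taylor_coeff f n - taylor_coeff g n)"
  by (rule taylor_coeff_unique) (use sums_diff[OF H2_sums H2_sums] in \<open>auto simp: left_diff_distrib\<close>)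

lemma H2_diff_mem: "f \<in> elems (H2 w) \<Longrightarrow> g \<in> elems (H2 w) \<Longrightarrow> f - g \<in> elems (H2 w)"
proof -
  assume "f \<in> elems (H2 w)" "g \<in> elems (H2 w)"
  moreover have "f - g = f + (-1) \<cdot> g" by (simp add: fun_eq_iff)
  ultimately show ?thesis by (metis H2_add_mem H2_smul_mem)
qed

text \<open>
  The coefficients of a Cauchy sequence converge one by one. Finite partial sums of the norms pass to
  the limit, which bounds the distance to the coefficientwise limit.
\<close>

lemma H2_complete:
  assumes X: "\<And>n. X n \<in> elems (H2 w)"
    and cauchy: "\<And>e. e > 0 \<Longrightarrow> \<exists>N. \<forall>m\<ge>N. \<forall>n\<ge>N. hnorm (H2 w) (X m - X n) < e"
  shows "\<exists>f\<in>elems (H2 w). (\<lambda>n. hnorm (H2 w) (X n - f)) \<longlonglongrightarrow> 0"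
proof -
  let ?x = "\<lambda>n. taylor_coeff (X n)"
  have partial: "(\<Sum>k<K. (cmod (?x m k - ?x n k))\<^sup>2 * (w k)\<^sup>2) \<le> e\<^sup>2"
    if "hnorm (H2 w) (X m - X n) < e" for m n e K
  proof -
    have s: "(\<lambda>k. (cmod (?x m k - ?x n k))\<^sup>2 * (w k)\<^sup>2) sums (hnorm (H2 w) (X m - X n))\<^sup>2"
      using hnorm_H2_sums[OF H2_diff_mem[OF X X], of m n] by (simp add: taylor_coeff_diff[OF X X])
    have nn: "0 \<le> hnorm (H2 w) (X m - X n)" by (rule hnorm_H2_nonneg[OF H2_diff_mem[OF X X]])
    have "(\<Sum>k<K. (cmod (?x m k - ?x n k))\<^sup>2 * (w k)\<^sup>2) \<le> (hnorm (H2 w) (X m - X n))\<^sup>2"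
      using s sum_le_suminf[of "\<lambda>k. (cmod (?x m k - ?x n k))\<^sup>2 * (w k)\<^sup>2" "{..<K}"] by (simp add: sums_iff)
    also have "\<dots> \<le> e\<^sup>2" using that nn by (intro power_mono) auto
    finally show ?thesis .
  qed
  have "Cauchy (\<lambda>n. ?x n k)" for k
  proof (rule metric_CauchyI)
    fix e :: real assume "e > 0"
    hence "e * w k / 2 > 0" by simp
    then obtain N where N: "\<And>m n. m \<ge> N \<Longrightarrow> n \<ge> N \<Longrightarrow> hnorm (H2 w) (X m - X n) < e * w k / 2"
      using cauchy by blast
    have "dist (?x m k) (?x n k) < e" if "m \<ge> N" "n \<ge> N" for m n
    proof -
      have "(cmod (?x m k - ?x n k))\<^sup>2 * (w k)\<^sup>2 \<le> (\<Sum>j<Suc k. (cmod (?x m j - ?x n j))\<^sup>2 * (w j)\<^sup>2)"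
        by (rule member_le_sum) auto
      also have "\<dots> \<le> (e * w k / 2)\<^sup>2" by (rule partial[OF N[OF that]])
      finally have "(cmod (?x m k - ?x n k) * w k)\<^sup>2 \<le> (e * w k / 2)\<^sup>2" by (simp add: power_mult_distrib)
      hence "cmod (?x m k - ?x n k) * w k \<le> e * w k / 2"
        by (rule power2_le_imp_le) (use \<open>e > 0\<close> less_imp_le[OF weight_pos[of k]] in simp)
      hence "cmod (?x m k - ?x n k) \<le> e / 2" using weight_pos[of k] by (simp add: field_simps)
      thus ?thesis using \<open>e > 0\<close> by (simp add: dist_norm)
    qed
    thus "\<exists>M. \<forall>m\<ge>M. \<forall>n\<ge>M. dist (?x m k) (?x n k) < e" by blast
  qed
  hence "\<exists>l. (\<lambda>n. ?x n k) \<longlonglongrightarrow> l" for k by (simp add: Cauchy_convergent_iff convergent_def)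
  then obtain c where c: "\<And>k. (\<lambda>n. ?x n k) \<longlonglongrightarrow> c k" by metis
  have lim: "(\<Sum>k<K. (cmod (?x n k - c k))\<^sup>2 * (w k)\<^sup>2) \<le> e\<^sup>2"
    if N: "\<And>m n. m \<ge> N \<Longrightarrow> n \<ge> N \<Longrightarrow> hnorm (H2 w) (X m - X n) < e" and n: "n \<ge> N" for N e n K
  proof (rule LIMSEQ_le_const2)
    show "(\<lambda>m. \<Sum>k<K. (cmod (?x n k - ?x m k))\<^sup>2 * (w k)\<^sup>2) \<longlonglongrightarrow> (\<Sum>k<K. (cmod (?x n k - c k))\<^sup>2 * (w k)\<^sup>2)"
      by (intro tendsto_intros c)
    show "\<exists>M. \<forall>m\<ge>M. (\<Sum>k<K. (cmod (?x n k - ?x m k))\<^sup>2 * (w k)\<^sup>2) \<le> e\<^sup>2"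
      using partial N n by blast
  qed
  have sq: "sq_summable w (\<lambda>k. ?x n k - c k) \<and> (\<Sum>k. (cmod (?x n k - c k))\<^sup>2 * (w k)\<^sup>2) \<le> e\<^sup>2"
    if N: "\<And>m n. m \<ge> N \<Longrightarrow> n \<ge> N \<Longrightarrow> hnorm (H2 w) (X m - X n) < e" and n: "n \<ge> N" for N e n
  proof
    show s: "sq_summable w (\<lambda>k. ?x n k - c k)" unfolding sq_summable_def
      by (rule summableI_nonneg_bounded[where x = "e\<^sup>2"]) (use lim[OF that] in auto)
    show "(\<Sum>k. (cmod (?x n k - c k))\<^sup>2 * (w k)\<^sup>2) \<le> e\<^sup>2"
      by (rule suminf_le_const[OF s[unfolded sq_summable_def] lim[OF that]])
  qed
  obtain N1 where N1: "\<And>m n. m \<ge> N1 \<Longrightarrow> n \<ge> N1 \<Longrightarrow> hnorm (H2 w) (X m - X n) < 1"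
    using cauchy[of 1] by auto
  have "sq_summable w (\<lambda>k. ?x N1 k - c k)" using sq[OF N1, of N1] by simp
  from sq_summable_add[OF H2_sq_summable[OF X, of N1] sq_summable_smul[OF this, of "-1"]]
  have c_sq: "sq_summable w c" by simp
  define f where "f = disk_series c"
  have f: "f \<in> elems (H2 w)" unfolding f_def by (rule disk_series_mem[OF c_sq])
  have fc: "taylor_coeff f = c" unfolding f_def by (rule taylor_coeff_disk_series[OF c_sq])
  have "(\<lambda>n. hnorm (H2 w) (X n - f)) \<longlonglongrightarrow> 0"
  proof (rule LIMSEQ_I)
    fix e :: real assume "e > 0"
    hence "e / 2 > 0" by simp
    then obtain N where N: "\<And>m n. m \<ge> N \<Longrightarrow> n \<ge> N \<Longrightarrow> hnorm (H2 w) (X m - X n) < e / 2"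
      using cauchy by blast
    have "norm (hnorm (H2 w) (X n - f) - 0) < e" if n: "n \<ge> N" for n
    proof -
      have "(hnorm (H2 w) (X n - f))\<^sup>2 \<le> (e / 2)\<^sup>2"
        using sq[OF N n] hnorm_H2_sums[OF H2_diff_mem[OF X f], of n]
        by (simp add: taylor_coeff_diff[OF X f] fc sums_iff)
      hence "\<bar>hnorm (H2 w) (X n - f)\<bar> \<le> e / 2" using \<open>e > 0\<close> by (simp add: abs_le_square_iff[symmetric])
      thus ?thesis using \<open>e > 0\<close> by simp
    qed
    thus "\<exists>N. \<forall>n\<ge>N. norm (hnorm (H2 w) (X n - f) - 0) < e" by blast
  qed
  thus ?thesis using f by blast
qed

lemma zero_eq_disk_series: "0 = disk_series (\<lambda>n. 0)"
  by (simp add: disk_series_def fun_eq_iff)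

lemma H2_zero_mem: "0 \<in> elems (H2 w)"
  unfolding zero_eq_disk_series by (rule disk_series_mem) (simp add: sq_summable_def)

sublocale hilbert_space "H2 w"
proof
  show "ip (H2 w) (f + g) h = ip (H2 w) f h + ip (H2 w) g h"
    if "f \<in> elems (H2 w)" "g \<in> elems (H2 w)" "h \<in> elems (H2 w)" for f g h
    using sums_add[OF ip_H2_sums[OF that(1,3)] ip_H2_sums[OF that(2,3)]]
      ip_H2_sums[OF H2_add_mem[OF that(1,2)] that(3)]
    by (simp add: taylor_coeff_add that distrib_right sums_unique2)
  show "ip (H2 w) (c \<cdot> f) h = c * ip (H2 w) f h"
    if "f \<in> elems (H2 w)" "h \<in> elems (H2 w)" for f h c
    using sums_mult[OF ip_H2_sums[OF that], of c] ip_H2_sums[OF H2_smul_mem[OF that(1)] that(2), of c]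
    by (simp add: taylor_coeff_smul that mult.assoc sums_unique2)
  show "ip (H2 w) g f = cnj (ip (H2 w) f g)"
    if "f \<in> elems (H2 w)" "g \<in> elems (H2 w)" for f g
    using sums_cnj[THEN iffD2, OF ip_H2_sums[OF that]] ip_H2_sums[OF that(2,1)]
    by (simp add: mult_ac sums_unique2)
  show "f = 0" if f: "f \<in> elems (H2 w)" and 0: "ip (H2 w) f f = 0" for f
  proof (rule H2_eqI[OF f H2_zero_mem])
    fix n
    have s: "(\<lambda>n. (cmod (taylor_coeff f n))\<^sup>2 * (w n)\<^sup>2) sums 0"
      using hnorm_H2_sums[OF f] 0 by (simp add: hnorm_def)
    hence "(cmod (taylor_coeff f n))\<^sup>2 * (w n)\<^sup>2 = 0"
      using suminf_eq_zero_iff[of "\<lambda>n. (cmod (taylor_coeff f n))\<^sup>2 * (w n)\<^sup>2"] by (auto simp: sums_iff)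
    moreover have "taylor_coeff 0 n = 0"
      unfolding zero_eq_disk_series by (subst taylor_coeff_disk_series) (simp_all add: sq_summable_def)
    ultimately show "taylor_coeff f n = taylor_coeff 0 n" by simp
  qed
qed (use H2_zero_mem H2_add_mem H2_smul_mem H2_complete ip_H2_nonneg in auto)

subsection \<open>Monomials and reproducing kernels\<close>

text \<open>
  Pairing with monomials reads off Taylor coefficients, pairing with kernels reads off values; adjoints are
  computed in this way below.
\<close>

lemma disk_monom_eq: "disk_monom j = disk_series (\<lambda>n. if n = j then 1 else 0)"
proof
  fix z :: complex
  have "(\<Sum>n. (if n = j then 1 else 0) * z ^ n) = (\<Sum>n. if n = j then z ^ n else 0)"
    by (rule arg_cong[of _ _ suminf]) auto
  thus "disk_monom j z = disk_series (\<lambda>n. if n = j then 1 else 0) z"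
    using sums_unique[OF sums_single[of j "\<lambda>n. z ^ n"]]
    by (simp add: disk_monom_def disk_series_def)
qed

lemma sq_summable_single: "sq_summable w (\<lambda>n. if n = j then k else 0)"
  unfolding sq_summable_def by (rule summable_finite[of "{j}"]) auto

lemma disk_monom_mem [simp]: "disk_monom j \<in> elems (H2 w)"
  unfolding disk_monom_eq by (rule disk_series_mem[OF sq_summable_single])

lemma taylor_coeff_disk_monom: "taylor_coeff (disk_monom j) = (\<lambda>n. if n = j then 1 else 0)"
  unfolding disk_monom_eq by (rule taylor_coeff_disk_series[OF sq_summable_single])

lemma ip_disk_monom:
  assumes "f \<in> elems (H2 w)"
  shows "ip (H2 w) f (disk_monom j) = taylor_coeff f j * of_real ((w j)\<^sup>2)"
proof -
  have eq: "(\<lambda>n. taylor_coeff f n * cnj (taylor_coeff (disk_monom j) n) * of_real ((w n)\<^sup>2)) =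
      (\<lambda>n. if n = j then taylor_coeff f n * of_real ((w n)\<^sup>2) else 0)"
    by (auto simp: taylor_coeff_disk_monom)
  show ?thesis
    using ip_H2_sums[OF assms disk_monom_mem, of j, unfolded eq] sums_single by (rule sums_unique2)
qed

definition kernel :: "complex \<Rightarrow> complex \<Rightarrow> complex" where
  "kernel z = disk_series (\<lambda>n. cnj z ^ n / of_real ((w n)\<^sup>2))"

lemma kernel_sq_summable:
  assumes "z \<in> ball 0 1"
  shows "sq_summable w (\<lambda>n. cnj z ^ n / of_real ((w n)\<^sup>2))"
proof -
  have "cmod z ^ 2 < 1" using assms by (simp add: power_less_one_iff)
  from weight_summable[OF _ this] have "summable (\<lambda>n. ((cmod z)\<^sup>2) ^ n / (w n)\<^sup>2)" by simp
  moreover have "((cmod z)\<^sup>2) ^ n / (w n)\<^sup>2 = (cmod (cnj z ^ n / of_real ((w n)\<^sup>2)))\<^sup>2 * (w n)\<^sup>2" for n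
    by (simp add: norm_divide norm_mult norm_power power2_eq_square power_mult_distrib field_simps)
  ultimately show ?thesis by (simp add: sq_summable_def)
qed

lemma kernel_mem: "z \<in> ball 0 1 \<Longrightarrow> kernel z \<in> elems (H2 w)"
  unfolding kernel_def by (rule disk_series_mem[OF kernel_sq_summable])

lemma taylor_coeff_kernel: "z \<in> ball 0 1 \<Longrightarrow> taylor_coeff (kernel z) = (\<lambda>n. cnj z ^ n / of_real ((w n)\<^sup>2))"
  unfolding kernel_def by (rule taylor_coeff_disk_series[OF kernel_sq_summable])

lemma ip_kernel:
  assumes "f \<in> elems (H2 w)" "z \<in> ball 0 1"
  shows "ip (H2 w) f (kernel z) = f z"
  using ip_H2_sums[OF assms(1) kernel_mem[OF assms(2)]] H2_sums[OF assms]
  by (simp add: taylor_coeff_kernel[OF assms(2)] sums_unique2)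

end

text \<open>
  Bounds on finite partial sums suffice, so a matrix operator can be handled without
  rearranging infinite sums.
\<close>

lemma coefficient_operator:
  assumes "weight w" "weight w'"
    and add: "\<And>c d. A (\<lambda>n. c n + d n) = (\<lambda>n. A c n + A d n)"
    and smul: "\<And>k c. A (\<lambda>n. k * c n) = (\<lambda>n. k * A c n)"
    and bound: "\<And>c N. sq_summable w c \<Longrightarrow>
      (\<Sum>n<N. (cmod (A c n))\<^sup>2 * (w' n)\<^sup>2) \<le> M * (\<Sum>n. (cmod (c n))\<^sup>2 * (w n)\<^sup>2)"
  defines "T \<equiv> \<lambda>f\<in>elems (H2 w). disk_series (A (taylor_coeff f))"
  shows "T \<in> bounded_ops (H2 w) (H2 w')"
    and "\<And>f. f \<in> elems (H2 w) \<Longrightarrow> taylor_coeff (T f) = A (taylor_coeff f)"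
proof -
  interpret w: weight w by fact
  interpret w': weight w' by fact
  have sq: "sq_summable w' (A (taylor_coeff f))" if "f \<in> elems (H2 w)" for f
    unfolding sq_summable_def
    by (rule summableI_nonneg_bounded[OF _ bound[OF w.H2_sq_summable[OF that]]]) simp
  have mem: "T f \<in> elems (H2 w')" if "f \<in> elems (H2 w)" for f
    using w'.disk_series_mem[OF sq[OF that]] that by (simp add: T_def)
  show coeff: "taylor_coeff (T f) = A (taylor_coeff f)" if "f \<in> elems (H2 w)" for f
    using w'.taylor_coeff_disk_series[OF sq[OF that]] that by (simp add: T_def)
  show "T \<in> bounded_ops (H2 w) (H2 w')"
  proof (rule bounded_opsI[where M = "sqrt \<bar>M\<bar>"])
    fix f assume f: "f \<in> elems (H2 w)"
    have "(hnorm (H2 w') (T f))\<^sup>2 \<le> M * (hnorm (H2 w) f)\<^sup>2"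
    proof (rule LIMSEQ_le_const2)
      show "(\<lambda>N. \<Sum>n<N. (cmod (A (taylor_coeff f) n))\<^sup>2 * (w' n)\<^sup>2) \<longlonglongrightarrow> (hnorm (H2 w') (T f))\<^sup>2"
        using w'.hnorm_H2_sums[OF mem[OF f]] by (simp add: coeff[OF f] sums_def)
      show "\<exists>N. \<forall>n\<ge>N. (\<Sum>k<n. (cmod (A (taylor_coeff f) k))\<^sup>2 * (w' k)\<^sup>2) \<le> M * (hnorm (H2 w) f)\<^sup>2"
        using bound[OF w.H2_sq_summable[OF f]] w.hnorm_H2_sums[OF f] by (simp add: sums_iff)
    qed
    also have "\<dots> \<le> \<bar>M\<bar> * (hnorm (H2 w) f)\<^sup>2" by (intro mult_right_mono) auto
    also have "\<dots> = (sqrt \<bar>M\<bar> * hnorm (H2 w) f)\<^sup>2" by (simp add: power_mult_distrib)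
    finally show "hnorm (H2 w') (T f) \<le> sqrt \<bar>M\<bar> * hnorm (H2 w) f"
      by (rule power2_le_imp_le) (use f in simp)
  next
    fix f g assume f: "f \<in> elems (H2 w)" "g \<in> elems (H2 w)"
    show "T (f + g) = T f + T g"
      by (rule w'.H2_eqI) (use f mem in \<open>simp_all add: coeff w.taylor_coeff_add w'.taylor_coeff_add add\<close>)
  next
    fix c f assume f: "f \<in> elems (H2 w)"
    show "T (c \<cdot> f) = c \<cdot> T f"
      by (rule w'.H2_eqI) (use f mem in \<open>simp_all add: coeff w.taylor_coeff_smul w'.taylor_coeff_smul smul\<close>)
  qed (use mem in \<open>auto simp: T_def\<close>)
qed

section \<open>The Bergman weights and the shifted weights\<close>

text \<open>
  The generating function of \<open>1 / \<gamma>\<^sub>\<alpha>(n)\<^sup>2\<close>, for \<open>t = \<alpha> + 2\<close>.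
\<close>

lemma negative_binomial_series:
  fixes r t :: real
  assumes "0 \<le> r" "r < 1"
  shows "(\<lambda>n. pochhammer t n / fact n * r ^ n) sums (1 - r) powr (- t)"
proof -
  have "(\<lambda>n. ((-t) gchoose n) * (-r) ^ n) sums (1 + (-r)) powr (-t)"
    using assms by (intro gen_binomial_real) auto
  moreover have "((-t) gchoose n) * (-r) ^ n = pochhammer t n / fact n * r ^ n" for n
  proof -
    have "(-1 :: real) ^ n * (-r) ^ n = r ^ n" by (simp flip: power_mult_distrib)
    thus ?thesis by (simp add: gbinomial_pochhammer)
  qed
  ultimately show ?thesis by simp
qed

lemma gamma_wt_sq:
  assumes "\<alpha> > -1"
  shows "(gamma_wt \<alpha> n)\<^sup>2 = fact n / pochhammer (\<alpha> + 2) n"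
proof -
  have G: "Gamma (\<alpha> + 2) > 0" using assms by (intro Gamma_real_pos) auto
  have G': "Gamma (real n + \<alpha> + 2) > 0" using assms by (intro Gamma_real_pos) auto
  have "pochhammer (\<alpha> + 2) n = Gamma (\<alpha> + 2 + real n) / Gamma (\<alpha> + 2)"
    using assms by (intro pochhammer_Gamma) (auto elim!: nonpos_Ints_cases)
  moreover have "pochhammer (\<alpha> + 2) n > 0" using assms by (intro pochhammer_pos) auto
  ultimately show ?thesis using G G' by (simp add: gamma_wt_def field_simps)
qed

lemma gamma_wt_pos: "\<alpha> > -1 \<Longrightarrow> 0 < gamma_wt \<alpha> n"
  unfolding gamma_wt_def by (intro real_sqrt_gt_zero divide_pos_pos mult_pos_pos Gamma_real_pos) auto

lemma gamma_wt_Suc_sq: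
  assumes "\<alpha> > -1"
  shows "(gamma_wt \<alpha> (Suc n))\<^sup>2 = (gamma_wt \<alpha> n)\<^sup>2 * ((real n + 1) / (real n + \<alpha> + 2))"
  using assms by (simp add: gamma_wt_sq pochhammer_Suc field_simps)

lemma weight_gamma_wt:
  assumes "\<alpha> > -1"
  shows "weight (gamma_wt \<alpha>)"
proof
  show "0 < gamma_wt \<alpha> n" for n by (rule gamma_wt_pos[OF assms])
  show "summable (\<lambda>n. r ^ n / (gamma_wt \<alpha> n)\<^sup>2)" if "0 \<le> r" "r < 1" for r
    using sums_summable[OF negative_binomial_series[OF that, of "\<alpha> + 2"]]
    by (simp add: gamma_wt_sq[OF assms] mult.commute)
qed

lemma gamma_wt_sq_antimono:
  assumes "\<alpha> > -1"
  shows "(gamma_wt \<alpha> (Suc n))\<^sup>2 \<le> (gamma_wt \<alpha> n)\<^sup>2"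
  unfolding gamma_wt_Suc_sq[OF assms] using assms by (intro mult_left_le) (auto simp: field_simps)

lemma beta_wt_sq: "(beta_wt \<alpha> (Suc n))\<^sup>2 = 1 / (gamma_wt \<alpha> n)\<^sup>2"
  by (simp add: beta_wt_def power_divide)

lemma gamma_wt_0: "\<alpha> > -1 \<Longrightarrow> (gamma_wt \<alpha> 0)\<^sup>2 = 1"
  by (simp add: gamma_wt_sq)

lemma gamma_wt_sq_le_1: "\<alpha> > -1 \<Longrightarrow> (gamma_wt \<alpha> n)\<^sup>2 \<le> 1"
proof (induction n)
  case (Suc n)
  thus ?case using gamma_wt_sq_antimono[of \<alpha> n] by linarith
qed (simp add: gamma_wt_0)

lemma weight_beta_wt:
  assumes "\<alpha> > -1"
  shows "weight (beta_wt \<alpha>)"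
proof
  show "0 < beta_wt \<alpha> n" for n using gamma_wt_pos[OF assms] by (simp add: beta_wt_def)
  fix r :: real assume r: "0 \<le> r" "r < 1"
  show "summable (\<lambda>n. r ^ n / (beta_wt \<alpha> n)\<^sup>2)"
  proof (rule summable_comparison_test')
    show "summable (\<lambda>n. r ^ n)" using r by (simp add: summable_geometric)
    show "norm (r ^ n / (beta_wt \<alpha> n)\<^sup>2) \<le> r ^ n" for n
    proof (cases n)
      case (Suc m)
      thus ?thesis using r gamma_wt_sq_le_1[OF assms, of m]
        by (simp add: beta_wt_sq mult_left_le)
    qed (simp add: beta_wt_def)
  qed
qed

lemma beta_wt_sq_mono: "\<alpha> > -1 \<Longrightarrow> (beta_wt \<alpha> n)\<^sup>2 \<le> (beta_wt \<alpha> (Suc n))\<^sup>2"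
proof (cases n)
  case 0
  assume "\<alpha> > -1"
  thus ?thesis using 0 by (simp add: beta_wt_sq gamma_wt_0) (simp add: beta_wt_def)
next
  case (Suc m)
  assume "\<alpha> > -1"
  thus ?thesis using gamma_wt_sq_antimono[of \<alpha> m] gamma_wt_pos[of \<alpha> "Suc m"] Suc
    by (simp add: beta_wt_sq frac_le)
qed

lemma beta_wt_sq_Suc_le: "\<alpha> > -1 \<Longrightarrow> (beta_wt \<alpha> (Suc n))\<^sup>2 \<le> (\<alpha> + 2) * (beta_wt \<alpha> n)\<^sup>2"
proof (cases n)
  case 0
  assume "\<alpha> > -1"
  thus ?thesis using 0 by (simp add: beta_wt_sq gamma_wt_0) (simp add: beta_wt_def)
next
  case (Suc m)
  assume \<alpha>: "\<alpha> > -1"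
  have g: "0 < (gamma_wt \<alpha> m)\<^sup>2" using gamma_wt_pos[OF \<alpha>, of m] by simp
  have "(\<alpha> + 1) * 0 \<le> (\<alpha> + 1) * real m" using \<alpha> by (intro mult_left_mono) auto
  hence "(real m + \<alpha> + 2) / (real m + 1) \<le> \<alpha> + 2" by (simp add: field_simps)
  hence "(real m + \<alpha> + 2) / (real m + 1) / (gamma_wt \<alpha> m)\<^sup>2 \<le> (\<alpha> + 2) / (gamma_wt \<alpha> m)\<^sup>2"
    using g by (intro divide_right_mono) auto
  moreover have "(beta_wt \<alpha> (Suc n))\<^sup>2 = (real m + \<alpha> + 2) / (real m + 1) / (gamma_wt \<alpha> m)\<^sup>2"
    unfolding Suc beta_wt_sq[of \<alpha> "Suc m"] gamma_wt_Suc_sq[OF \<alpha>] by simp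
  ultimately show ?thesis unfolding Suc beta_wt_sq[of \<alpha> m] by simp
qed

text \<open>
  Multiplication by \<open>z\<close> and division by \<open>z\<close> shift the coefficients by one, and
  \<open>\<beta>(n) \<le> \<beta>(n+1) \<le> (\<alpha>+2)\<^bsup>1/2\<^esup> \<beta>(n)\<close> makes both shifts bounded.
\<close>

lemma zH2_elems:
  assumes \<alpha>: "\<alpha> > -1"
  shows "elems (zH2 (beta_wt \<alpha>)) = {f \<in> elems (H2 (beta_wt \<alpha>)). taylor_coeff f 0 = 0}"
proof -
  interpret weight "beta_wt \<alpha>" by (rule weight_beta_wt[OF \<alpha>])
  have "(\<lambda>z. z * f z) \<in> elems (H2 (beta_wt \<alpha>)) \<and> taylor_coeff (\<lambda>z. z * f z) 0 = 0"
    if f: "f \<in> elems (H2 (beta_wt \<alpha>))" for f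
  proof -
    define c where "c n = (case n of 0 \<Rightarrow> 0 | Suc m \<Rightarrow> taylor_coeff f m)" for n
    have "summable (\<lambda>n. (cmod (c (Suc n)))\<^sup>2 * (beta_wt \<alpha> (Suc n))\<^sup>2)"
    proof (rule summable_comparison_test')
      show "summable (\<lambda>n. (\<alpha> + 2) * ((cmod (taylor_coeff f n))\<^sup>2 * (beta_wt \<alpha> n)\<^sup>2))"
        using H2_sq_summable[OF f] unfolding sq_summable_def by (rule summable_mult)
      show "norm ((cmod (c (Suc n)))\<^sup>2 * (beta_wt \<alpha> (Suc n))\<^sup>2)
          \<le> (\<alpha> + 2) * ((cmod (taylor_coeff f n))\<^sup>2 * (beta_wt \<alpha> n)\<^sup>2)" for n
        using mult_left_mono[OF beta_wt_sq_Suc_le[OF \<alpha>, of n], of "(cmod (taylor_coeff f n))\<^sup>2"]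
        by (simp add: c_def mult_ac)
    qed
    hence c: "sq_summable (beta_wt \<alpha>) c" unfolding sq_summable_def by (subst (asm) summable_Suc_iff)
    have "(\<lambda>z. z * f z) = disk_series c"
    proof
      fix z
      show "z * f z = disk_series c z"
      proof (cases "z \<in> ball 0 1")
        case True
        have "(\<lambda>n. c (Suc n) * z ^ Suc n) sums (z * f z)"
          using sums_mult[OF H2_sums[OF f True], of z] by (simp add: c_def mult_ac)
        hence "(\<lambda>n. c n * z ^ n) sums (z * f z)" by (subst (asm) sums_Suc_iff) (simp add: c_def)
        thus ?thesis using sq_summable_sums[OF c True] sums_unique2 by blast
      qed (use H2_outside[OF f] in \<open>simp add: disk_series_def\<close>)
    qed
    thus ?thesis using disk_series_mem[OF c] taylor_coeff_disk_series[OF c] by (simp add: c_def)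
  qed
  moreover have "\<exists>g\<in>elems (H2 (beta_wt \<alpha>)). f = (\<lambda>z. z * g z)"
    if f: "f \<in> elems (H2 (beta_wt \<alpha>))" and 0: "taylor_coeff f 0 = 0" for f
  proof -
    define c where "c n = taylor_coeff f (Suc n)" for n
    have "summable (\<lambda>n. (cmod (c n))\<^sup>2 * (beta_wt \<alpha> n)\<^sup>2)"
    proof (rule summable_comparison_test')
      show "summable (\<lambda>n. (cmod (taylor_coeff f (Suc n)))\<^sup>2 * (beta_wt \<alpha> (Suc n))\<^sup>2)"
        using H2_sq_summable[OF f] unfolding sq_summable_def by (subst summable_Suc_iff)
      show "norm ((cmod (c n))\<^sup>2 * (beta_wt \<alpha> n)\<^sup>2) \<le> (cmod (taylor_coeff f (Suc n)))\<^sup>2 * (beta_wt \<alpha> (Suc n))\<^sup>2" for n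
        using mult_left_mono[OF beta_wt_sq_mono[OF \<alpha>, of n], of "(cmod (c n))\<^sup>2"] by (simp add: c_def)
    qed
    hence c: "sq_summable (beta_wt \<alpha>) c" unfolding sq_summable_def .
    have "f = (\<lambda>z. z * disk_series c z)"
    proof
      fix z
      show "f z = z * disk_series c z"
      proof (cases "z \<in> ball 0 1")
        case True
        have "(\<lambda>n. taylor_coeff f (Suc n) * z ^ Suc n) sums (z * disk_series c z)"
          using sums_mult[OF sq_summable_sums[OF c True], of z] by (simp add: c_def mult_ac)
        hence "(\<lambda>n. taylor_coeff f n * z ^ n) sums (z * disk_series c z)"
          by (subst (asm) sums_Suc_iff) (simp add: 0)
        thus ?thesis using H2_sums[OF f True] sums_unique2 by blast
      qed (use H2_outside[OF f] in \<open>simp add: disk_series_def\<close>)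
    qed
    thus ?thesis using disk_series_mem[OF c] by blast
  qed
  ultimately show ?thesis by (auto simp: zH2_def image_iff)
qed

lemma ip_zH2: "ip (zH2 w) = ip (H2 w)"
  by (simp add: zH2_def)

section \<open>The shift unitary\<close>

text \<open>
  The coefficient at \<open>j + 1\<close> is obtained by pairing \<open>V f\<close> with \<open>V z\<^sup>j\<close> and using that \<open>V\<close> is isometric.
  So the values on monomials determine \<open>V\<close> without a density argument.
\<close>

lemma shift_unitary_coeff:
  assumes \<alpha>: "\<alpha> > -1" and V: "shift_unitary \<alpha> V" and f: "f \<in> elems (H2 (gamma_wt \<alpha>))"
  shows "V f \<in> elems (H2 (beta_wt \<alpha>))" "taylor_coeff (V f) 0 = 0"
    "taylor_coeff (V f) (Suc j) = of_real ((gamma_wt \<alpha> j)\<^sup>2) * taylor_coeff f j"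
proof -
  interpret b: weight "beta_wt \<alpha>" by (rule weight_beta_wt[OF \<alpha>])
  interpret g: weight "gamma_wt \<alpha>" by (rule weight_gamma_wt[OF \<alpha>])
  have Vf: "V f \<in> elems (zH2 (beta_wt \<alpha>))"
    using V f bounded_ops_mem by (auto simp: shift_unitary_def unitary_ops_def)
  thus Vf': "V f \<in> elems (H2 (beta_wt \<alpha>))" "taylor_coeff (V f) 0 = 0"
    by (auto simp: zH2_elems[OF \<alpha>])
  let ?g = "of_real ((gamma_wt \<alpha> j)\<^sup>2) :: complex"
  have g: "?g \<noteq> 0" by simp
  have "V (disk_monom j) = (\<lambda>z. of_real (gamma_wt \<alpha> j / beta_wt \<alpha> (j + 1)) * disk_monom (j + 1) z)"
    using V unfolding shift_unitary_def by blast
  also have "\<dots> = ?g \<cdot> disk_monom (Suc j)"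
    by (simp add: fun_eq_iff beta_wt_def power2_eq_square)
  finally have Vj: "V (disk_monom j) = ?g \<cdot> disk_monom (Suc j)" .
  have "ip (H2 (beta_wt \<alpha>)) (V f) (V (disk_monom j)) = ip (H2 (gamma_wt \<alpha>)) f (disk_monom j)"
    using V f g.disk_monom_mem unfolding shift_unitary_def unitary_ops_def ip_zH2 by blast
  hence "?g * (taylor_coeff (V f) (Suc j) * of_real ((beta_wt \<alpha> (Suc j))\<^sup>2)) = taylor_coeff f j * ?g"
    unfolding Vj using Vf'(1) f
    by (simp only: b.ip_smul_right[OF b.disk_monom_mem] b.ip_disk_monom g.ip_disk_monom complex_cnj_complex_of_real)
  thus "taylor_coeff (V f) (Suc j) = ?g * taylor_coeff f j"
    using g by (simp add: beta_wt_sq field_simps)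
qed

lemma shift_unitary_unique:
  assumes \<alpha>: "\<alpha> > -1" and V: "shift_unitary \<alpha> V" and W: "shift_unitary \<alpha> W"
  shows "V = W"
proof (rule bounded_ops_eqI)
  interpret b: weight "beta_wt \<alpha>" by (rule weight_beta_wt[OF \<alpha>])
  show "V \<in> bounded_ops (H2 (gamma_wt \<alpha>)) (zH2 (beta_wt \<alpha>))"
    "W \<in> bounded_ops (H2 (gamma_wt \<alpha>)) (zH2 (beta_wt \<alpha>))"
    using V W by (auto simp: shift_unitary_def unitary_ops_def)
  fix f assume f: "f \<in> elems (H2 (gamma_wt \<alpha>))"
  show "V f = W f"
  proof (rule b.H2_eqI)
    show "taylor_coeff (V f) n = taylor_coeff (W f) n" for n
      using shift_unitary_coeff[OF \<alpha> V f] shift_unitary_coeff[OF \<alpha> W f] by (cases n) auto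
  qed (use shift_unitary_coeff[OF \<alpha> V f] shift_unitary_coeff[OF \<alpha> W f] in auto)
qed

lemma shift_unitary_exists:
  assumes \<alpha>: "\<alpha> > -1"
  shows "\<exists>V. shift_unitary \<alpha> V"
proof -
  let ?G = "H2 (gamma_wt \<alpha>)" and ?B = "H2 (beta_wt \<alpha>)" and ?N = "zH2 (beta_wt \<alpha>)"
  interpret b: weight "beta_wt \<alpha>" by (rule weight_beta_wt[OF \<alpha>])
  interpret g: weight "gamma_wt \<alpha>" by (rule weight_gamma_wt[OF \<alpha>])
  define A :: "(nat \<Rightarrow> complex) \<Rightarrow> nat \<Rightarrow> complex" where
    "A c n = (case n of 0 \<Rightarrow> 0 | Suc j \<Rightarrow> of_real ((gamma_wt \<alpha> j)\<^sup>2) * c j)" for c n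
  define V where "V = (\<lambda>f\<in>elems ?G. disk_series (A (taylor_coeff f)))"
  have term_eq: "(cmod (A c (Suc j)))\<^sup>2 * (beta_wt \<alpha> (Suc j))\<^sup>2 = (cmod (c j))\<^sup>2 * (gamma_wt \<alpha> j)\<^sup>2" for c j
  proof -
    have "(cmod (A c (Suc j)))\<^sup>2 = ((gamma_wt \<alpha> j)\<^sup>2)\<^sup>2 * (cmod (c j))\<^sup>2"
      by (simp add: A_def norm_mult norm_power power_mult_distrib)
    thus ?thesis unfolding beta_wt_sq by (simp add: power2_eq_square)
  qed
  have bound: "(\<Sum>n<N. (cmod (A c n))\<^sup>2 * (beta_wt \<alpha> n)\<^sup>2) \<le> 1 * (\<Sum>n. (cmod (c n))\<^sup>2 * (gamma_wt \<alpha> n)\<^sup>2)"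
    if c: "sq_summable (gamma_wt \<alpha>) c" for c N
  proof -
    have "(\<Sum>n<N. (cmod (A c n))\<^sup>2 * (beta_wt \<alpha> n)\<^sup>2) \<le> (\<Sum>n<Suc N. (cmod (A c n))\<^sup>2 * (beta_wt \<alpha> n)\<^sup>2)"
      by simp
    also have "\<dots> = (\<Sum>n<N. (cmod (c n))\<^sup>2 * (gamma_wt \<alpha> n)\<^sup>2)"
      unfolding sum.lessThan_Suc_shift term_eq by (simp add: A_def)
    also have "\<dots> \<le> (\<Sum>n. (cmod (c n))\<^sup>2 * (gamma_wt \<alpha> n)\<^sup>2)"
      using c unfolding sq_summable_def by (intro sum_le_suminf) auto
    finally show ?thesis by simp
  qed
  have A_add: "A (\<lambda>n. c n + d n) = (\<lambda>n. A c n + A d n)" for c d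
    by (auto simp: A_def fun_eq_iff distrib_left split: nat.splits)
  have A_smul: "A (\<lambda>n. k * c n) = (\<lambda>n. k * A c n)" for k c
    by (auto simp: A_def fun_eq_iff split: nat.splits)
  note co = coefficient_operator[OF g.weight_axioms b.weight_axioms, of A, OF A_add A_smul bound, folded V_def]
  have Vb: "V \<in> bounded_ops ?G ?B" using co(1) by blast
  have coeff: "taylor_coeff (V f) = A (taylor_coeff f)" if "f \<in> elems ?G" for f using co(2) that by blast
  note V_lin = bounded_ops_simps[OF Vb]
  have memN: "V f \<in> elems ?N" if "f \<in> elems ?G" for f
    using V_lin(1)[OF that] coeff[OF that] by (simp add: zH2_elems[OF \<alpha>] A_def)
  have iso: "ip ?B (V f) (V h) = ip ?G f h" if f: "f \<in> elems ?G" and h: "h \<in> elems ?G" for f h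
  proof -
    have "(\<lambda>j. A (taylor_coeff f) (Suc j) * cnj (A (taylor_coeff h) (Suc j)) * of_real ((beta_wt \<alpha> (Suc j))\<^sup>2))
        sums ip ?B (V f) (V h)"
      using b.ip_H2_sums[OF V_lin(1)[OF f] V_lin(1)[OF h]] unfolding coeff[OF f] coeff[OF h]
      by (subst sums_Suc_iff) (simp add: A_def)
    moreover have "A (taylor_coeff f) (Suc j) * cnj (A (taylor_coeff h) (Suc j)) * of_real ((beta_wt \<alpha> (Suc j))\<^sup>2) =
        taylor_coeff f j * cnj (taylor_coeff h j) * of_real ((gamma_wt \<alpha> j)\<^sup>2)" for j
    proof -
      have "of_real ((gamma_wt \<alpha> j)\<^sup>2) * of_real ((beta_wt \<alpha> (Suc j))\<^sup>2) = (1::complex)"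
        unfolding of_real_mult[symmetric] beta_wt_sq by simp
      thus ?thesis by (simp add: A_def mult_ac del: of_real_power)
    qed
    ultimately show ?thesis using g.ip_H2_sums[OF f h] sums_unique2 by simp
  qed
  have onto: "h \<in> V ` elems ?G" if h: "h \<in> elems ?N" for h
  proof -
    have hB: "h \<in> elems ?B" "taylor_coeff h 0 = 0" using h by (auto simp: zH2_elems[OF \<alpha>])
    define c where "c j = taylor_coeff h (Suc j) / of_real ((gamma_wt \<alpha> j)\<^sup>2)" for j
    have Ac: "A c = taylor_coeff h"
      using hB(2) by (auto simp: A_def c_def fun_eq_iff split: nat.splits)
    have "summable (\<lambda>j. (cmod (A c (Suc j)))\<^sup>2 * (beta_wt \<alpha> (Suc j))\<^sup>2)"
      using b.H2_sq_summable[OF hB(1)] unfolding sq_summable_def Ac by (subst summable_Suc_iff)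
    hence c: "sq_summable (gamma_wt \<alpha>) c" unfolding term_eq sq_summable_def .
    have m: "disk_series c \<in> elems ?G" by (rule g.disk_series_mem[OF c])
    have "V (disk_series c) = h"
      by (rule b.H2_eqI[OF V_lin(1)[OF m] hB(1)]) (simp add: coeff[OF m] g.taylor_coeff_disk_series[OF c] Ac)
    thus ?thesis using m by blast
  qed
  have VbN: "V \<in> bounded_ops ?G ?N"
  proof (rule bounded_opsI)
    show "V \<in> extensional (elems ?G)" by (simp add: V_def)
    show "hnorm ?N (V f) \<le> 1 * hnorm ?G f" if "f \<in> elems ?G" for f
      using iso[OF that that] by (simp add: hnorm_def ip_zH2)
  qed (use memN in \<open>simp_all add: V_lin\<close>)
  have mono: "V (disk_monom j) = (\<lambda>z. of_real (gamma_wt \<alpha> j / beta_wt \<alpha> (j + 1)) * disk_monom (j + 1) z)" for j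
  proof -
    have "V (disk_monom j) = of_real ((gamma_wt \<alpha> j)\<^sup>2) \<cdot> disk_monom (Suc j)"
    proof (rule b.H2_eqI)
      show "taylor_coeff (V (disk_monom j)) n = taylor_coeff (of_real ((gamma_wt \<alpha> j)\<^sup>2) \<cdot> disk_monom (Suc j)) n" for n
        by (auto simp: coeff g.taylor_coeff_disk_monom b.taylor_coeff_smul b.taylor_coeff_disk_monom A_def
            split: nat.splits)
    qed (simp_all add: V_lin(1))
    thus ?thesis by (simp add: fun_eq_iff beta_wt_def power2_eq_square)
  qed
  show ?thesis
    unfolding shift_unitary_def unitary_ops_def ip_zH2
    using VbN memN onto iso mono by (intro exI[of _ V]) blast
qed

section \<open>The composition operators and their Aluthge transforms\<close>

locale affine_composition =
  fixes a \<alpha> :: real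
  assumes a: "0 < a" "a < 1" and \<alpha>: "\<alpha> > -1"
begin

abbreviation "G \<equiv> H2 (gamma_wt \<alpha>)"
abbreviation "B \<equiv> H2 (beta_wt \<alpha>)"
abbreviation "N \<equiv> zH2 (beta_wt \<alpha>)"

sublocale g: weight "gamma_wt \<alpha>" by (rule weight_gamma_wt[OF \<alpha>])
sublocale b: weight "beta_wt \<alpha>" by (rule weight_beta_wt[OF \<alpha>])

lemma phi_map_ball: "z \<in> ball 0 1 \<Longrightarrow> phi_map a z \<in> ball 0 1"
proof -
  assume z: "z \<in> ball 0 1"
  have "cmod (phi_map a z) \<le> cmod (of_real a * z) + cmod (of_real (1 - a))"
    unfolding phi_map_def of_real_diff of_real_1 by (rule norm_triangle_ineq)
  also have "\<dots> = a * cmod z + (1 - a)" unfolding norm_mult norm_of_real using a by simp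
  also have "\<dots> < 1" using z a by simp
  finally show ?thesis by simp
qed

lemma sigma_map_ball: "z \<in> ball 0 1 \<Longrightarrow> sigma_map a z \<in> ball 0 1"
proof -
  assume z: "z \<in> ball 0 1"
  have "cmod (1::complex) \<le> cmod (- (1 - of_real a) * z + 1) + cmod (of_real (1 - a) * z)"
    using norm_triangle_ineq[of "- (1 - of_real a) * z + 1" "of_real (1 - a) * z"] by (simp add: algebra_simps)
  also have "cmod (of_real (1 - a) * z) = (1 - a) * cmod z" unfolding norm_mult norm_of_real using a by simp
  finally have "1 - (1 - a) * cmod z \<le> cmod (- (1 - of_real a) * z + 1)" by simp
  moreover have "a * cmod z < 1 - (1 - a) * cmod z" using z by (simp add: algebra_simps)
  moreover have "0 \<le> a * cmod z" using a by simp
  ultimately have "a * cmod z < cmod (- (1 - of_real a) * z + 1)" "0 < cmod (- (1 - of_real a) * z + 1)"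
    by linarith+
  thus ?thesis using a by (simp add: sigma_map_def norm_divide norm_mult)
qed

text \<open>
  The coefficient of \<open>z\<^sup>k\<close> in \<open>(a z + 1 - a)\<^sup>n\<close>, that is, the matrix of \<open>C\<^sub>\<phi>\<close> with respect to the monomials;
  also the binomial distribution.
\<close>

definition binom_wt :: "nat \<Rightarrow> nat \<Rightarrow> real" where
  "binom_wt n k = real (n choose k) * a ^ k * (1 - a) ^ (n - k)"

lemma binom_wt_nonneg: "0 \<le> binom_wt n k"
  using a by (simp add: binom_wt_def)

lemma binom_wt_row: "(\<Sum>k\<le>n. binom_wt n k * x ^ k) = (a * x + (1 - a)) ^ n"
  unfolding binomial_ring binom_wt_def by (simp add: power_mult_distrib mult_ac)

lemma binom_wt_row_complex:
  fixes z :: complex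
  shows "(\<Sum>k\<le>n. of_real (binom_wt n k) * z ^ k) = (of_real a * z + (1 - of_real a)) ^ n"
  unfolding binomial_ring binom_wt_def by (simp add: power_mult_distrib mult_ac)

text \<open>
  The infinite sum is a negative binomial series, whose value is exactly the right-hand side.
\<close>

lemma binom_wt_column:
  "(\<Sum>n<M. binom_wt n k / (gamma_wt \<alpha> n)\<^sup>2) \<le> a powr (- (\<alpha> + 2)) / (gamma_wt \<alpha> k)\<^sup>2"
proof -
  let ?s = "\<alpha> + 2"
  let ?f = "\<lambda>n. binom_wt n k / (gamma_wt \<alpha> n)\<^sup>2"
  have shift: "?f (m + k) = a ^ k / (gamma_wt \<alpha> k)\<^sup>2 * (pochhammer (?s + k) m / fact m * (1 - a) ^ m)" for m
  proof -
    have "real (m + k choose k) = fact (m + k) / (fact k * fact m)"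
      by (simp add: binomial_fact)
    moreover have "pochhammer ?s (m + k) = pochhammer ?s k * pochhammer (?s + k) m"
      using pochhammer_product'[of ?s k m] by (simp add: add.commute)
    ultimately show ?thesis by (simp add: binom_wt_def gamma_wt_sq[OF \<alpha>])
  qed
  have "(\<lambda>m. ?f (m + k)) sums (a ^ k / (gamma_wt \<alpha> k)\<^sup>2 * (1 - (1 - a)) powr (- (?s + k)))"
    unfolding shift using a by (intro sums_mult negative_binomial_series) auto
  also have "a ^ k / (gamma_wt \<alpha> k)\<^sup>2 * (1 - (1 - a)) powr (- (?s + k)) = a powr (- ?s) / (gamma_wt \<alpha> k)\<^sup>2"
  proof -
    have "a powr (- ?s) = a powr (real k) * a powr (- (?s + k))" by (simp flip: powr_add)
    thus ?thesis using a by (simp add: powr_realpow)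
  qed
  finally have "(\<lambda>m. ?f (m + k)) sums (a powr (- ?s) / (gamma_wt \<alpha> k)\<^sup>2)" .
  moreover have "(\<Sum>i<k. ?f i) = 0" by (rule sum.neutral) (simp add: binom_wt_def)
  ultimately have "?f sums (a powr (- ?s) / (gamma_wt \<alpha> k)\<^sup>2)"
    using sums_iff_shift[of ?f k] by simp
  thus ?thesis using sum_le_suminf[of ?f "{..<M}"] binom_wt_nonneg by (simp add: sums_iff)
qed

text \<open>
  The matrix of the adjoint of \<open>C\<^sub>\<phi>\<close>. It is lower triangular, so each coefficient is a finite sum,
  in contrast to the coefficients of \<open>f \<circ> \<phi>\<close>.
\<close>

definition adj_coeff :: "(nat \<Rightarrow> complex) \<Rightarrow> nat \<Rightarrow> complex" where
  "adj_coeff c n = (\<Sum>k\<le>n. of_real (binom_wt n k * (gamma_wt \<alpha> k)\<^sup>2) * c k) / of_real ((gamma_wt \<alpha> n)\<^sup>2)"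

definition phi_adj :: "complex fop" where
  "phi_adj = (\<lambda>f\<in>elems G. disk_series (adj_coeff (taylor_coeff f)))"

text \<open>
  The Schur test. The Cauchy--Schwarz inequality with respect to the probability weights \<open>binom_wt n\<close> bounds
  each row, and after exchanging the finite sums \<open>binom_wt_column\<close> bounds the columns.
\<close>

lemma adj_coeff_bound:
  "(\<Sum>n<M. (cmod (adj_coeff c n))\<^sup>2 * (gamma_wt \<alpha> n)\<^sup>2)
     \<le> a powr (- (\<alpha> + 2)) * (\<Sum>n<M. (cmod (c n))\<^sup>2 * (gamma_wt \<alpha> n)\<^sup>2)"
proof -
  define x where "x k = (gamma_wt \<alpha> k)\<^sup>2 * cmod (c k)" for k
  have row: "(cmod (adj_coeff c n))\<^sup>2 * (gamma_wt \<alpha> n)\<^sup>2 \<le> (\<Sum>k<M. binom_wt n k * (x k)\<^sup>2) / (gamma_wt \<alpha> n)\<^sup>2"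
    if "n < M" for n
  proof -
    have "cmod (\<Sum>k\<le>n. of_real (binom_wt n k * (gamma_wt \<alpha> k)\<^sup>2) * c k) \<le> (\<Sum>k\<le>n. binom_wt n k * x k)"
      by (rule sum_norm_le) (simp add: norm_mult norm_power x_def binom_wt_nonneg)
    hence "(cmod (\<Sum>k\<le>n. of_real (binom_wt n k * (gamma_wt \<alpha> k)\<^sup>2) * c k))\<^sup>2 \<le> (\<Sum>k\<le>n. binom_wt n k * x k)\<^sup>2"
      by (rule power_mono) simp
    also have "(\<Sum>k\<le>n. binom_wt n k * x k) = (\<Sum>k\<le>n. sqrt (binom_wt n k) * (sqrt (binom_wt n k) * x k))"
      by (simp add: binom_wt_nonneg flip: mult.assoc)
    also have "\<dots>\<^sup>2 \<le> (\<Sum>k\<le>n. (sqrt (binom_wt n k))\<^sup>2) * (\<Sum>k\<le>n. (sqrt (binom_wt n k) * x k)\<^sup>2)"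
      by (rule Cauchy_Schwarz_ineq_sum)
    also have "\<dots> = (\<Sum>k\<le>n. binom_wt n k) * (\<Sum>k\<le>n. binom_wt n k * (x k)\<^sup>2)"
      by (simp add: binom_wt_nonneg power_mult_distrib)
    also have "(\<Sum>k\<le>n. binom_wt n k) = 1" using binom_wt_row[of n 1] by simp
    also have "1 * (\<Sum>k\<le>n. binom_wt n k * (x k)\<^sup>2) \<le> (\<Sum>k<M. binom_wt n k * (x k)\<^sup>2)"
      using that binom_wt_nonneg unfolding mult_1_left by (intro sum_mono2) auto
    finally have le: "(cmod (\<Sum>k\<le>n. of_real (binom_wt n k * (gamma_wt \<alpha> k)\<^sup>2) * c k))\<^sup>2
        \<le> (\<Sum>k<M. binom_wt n k * (x k)\<^sup>2)" .
    let ?S = "\<Sum>k\<le>n. of_real (binom_wt n k * (gamma_wt \<alpha> k)\<^sup>2) * c k"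
    have "(cmod (adj_coeff c n))\<^sup>2 = (cmod ?S)\<^sup>2 / ((gamma_wt \<alpha> n)\<^sup>2)\<^sup>2"
      unfolding adj_coeff_def norm_divide norm_of_real power_divide by simp
    hence "(cmod (adj_coeff c n))\<^sup>2 * (gamma_wt \<alpha> n)\<^sup>2 = (cmod ?S)\<^sup>2 / (gamma_wt \<alpha> n)\<^sup>2"
      by (simp add: power2_eq_square)
    thus ?thesis using le by (simp add: divide_right_mono)
  qed
  have "(\<Sum>n<M. (cmod (adj_coeff c n))\<^sup>2 * (gamma_wt \<alpha> n)\<^sup>2)
      \<le> (\<Sum>n<M. (\<Sum>k<M. binom_wt n k * (x k)\<^sup>2) / (gamma_wt \<alpha> n)\<^sup>2)"
    by (rule sum_mono) (use row in auto)
  also have "\<dots> = (\<Sum>n<M. \<Sum>k<M. (x k)\<^sup>2 * (binom_wt n k / (gamma_wt \<alpha> n)\<^sup>2))"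
    by (simp add: sum_divide_distrib mult_ac)
  also have "\<dots> = (\<Sum>k<M. (x k)\<^sup>2 * (\<Sum>n<M. binom_wt n k / (gamma_wt \<alpha> n)\<^sup>2))"
    by (subst sum.swap) (simp add: sum_distrib_left)
  also have "\<dots> \<le> (\<Sum>k<M. (x k)\<^sup>2 * (a powr (- (\<alpha> + 2)) / (gamma_wt \<alpha> k)\<^sup>2))"
    by (intro sum_mono mult_left_mono binom_wt_column) simp
  also have "\<dots> = a powr (- (\<alpha> + 2)) * (\<Sum>n<M. (cmod (c n))\<^sup>2 * (gamma_wt \<alpha> n)\<^sup>2)"
    unfolding sum_distrib_left by (rule sum.cong) (auto simp: x_def power2_eq_square)
  finally show ?thesis .
qed

lemma phi_adj_spec:
  shows phi_adj_bounded: "phi_adj \<in> bounded_ops G G"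
    and taylor_coeff_phi_adj: "\<And>f. f \<in> elems G \<Longrightarrow> taylor_coeff (phi_adj f) = adj_coeff (taylor_coeff f)"
proof -
  have add: "adj_coeff (\<lambda>n. c n + d n) = (\<lambda>n. adj_coeff c n + adj_coeff d n)" for c d
    by (simp add: adj_coeff_def distrib_left sum.distrib add_divide_distrib fun_eq_iff)
  have smul: "adj_coeff (\<lambda>n. k * c n) = (\<lambda>n. k * adj_coeff c n)" for k c
    by (simp add: adj_coeff_def sum_distrib_left fun_eq_iff mult_ac)
  have bound: "(\<Sum>n<M. (cmod (adj_coeff c n))\<^sup>2 * (gamma_wt \<alpha> n)\<^sup>2)
      \<le> a powr (- (\<alpha> + 2)) * (\<Sum>n. (cmod (c n))\<^sup>2 * (gamma_wt \<alpha> n)\<^sup>2)"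
    if "sq_summable (gamma_wt \<alpha>) c" for c M
  proof -
    have "(\<Sum>n<M. (cmod (c n))\<^sup>2 * (gamma_wt \<alpha> n)\<^sup>2) \<le> (\<Sum>n. (cmod (c n))\<^sup>2 * (gamma_wt \<alpha> n)\<^sup>2)"
      using that unfolding sq_summable_def by (intro sum_le_suminf) auto
    from mult_left_mono[OF this, of "a powr (- (\<alpha> + 2))"] show ?thesis
      using adj_coeff_bound[of c M] by simp
  qed
  note co = coefficient_operator[OF g.weight_axioms g.weight_axioms, of adj_coeff, OF add smul bound, folded phi_adj_def]
  show "phi_adj \<in> bounded_ops G G" using co(1) by blast
  show "taylor_coeff (phi_adj f) = adj_coeff (taylor_coeff f)" if "f \<in> elems G" for f using co(2) that by blast
qed

text \<open>
  On the coefficients \<open>cnj z ^ k / \<gamma>(k)\<^sup>2\<close> of the kernel the weights cancel, and the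
  binomial theorem remains.
\<close>

lemma phi_adj_kernel:
  assumes z: "z \<in> ball 0 1"
  shows "phi_adj (g.kernel z) = g.kernel (phi_map a z)"
proof (rule g.H2_eqI)
  note phi = phi_map_ball[OF z]
  show "phi_adj (g.kernel z) \<in> elems G" by (rule bounded_ops_mem[OF phi_adj_bounded g.kernel_mem[OF z]])
  show "g.kernel (phi_map a z) \<in> elems G" by (rule g.kernel_mem[OF phi])
  fix n
  have "(\<Sum>k\<le>n. of_real (binom_wt n k * (gamma_wt \<alpha> k)\<^sup>2) * (cnj z ^ k / of_real ((gamma_wt \<alpha> k)\<^sup>2))) =
      (\<Sum>k\<le>n. of_real (binom_wt n k) * cnj z ^ k)"
    by (rule sum.cong) simp_all
  also have "\<dots> = cnj (phi_map a z) ^ n" unfolding binom_wt_row_complex by (simp add: phi_map_def)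
  finally show "taylor_coeff (phi_adj (g.kernel z)) n = taylor_coeff (g.kernel (phi_map a z)) n"
    by (simp only: taylor_coeff_phi_adj[OF g.kernel_mem[OF z]] g.taylor_coeff_kernel[OF z]
        g.taylor_coeff_kernel[OF phi] adj_coeff_def)
qed

text \<open>
  \<open>(S\<^sup>* f)(z) = \<langle>S\<^sup>* f, K\<^sub>z\<rangle> = \<langle>f, S K\<^sub>z\<rangle> = f (\<phi> z)\<close>. In particular \<open>f \<circ> \<phi>\<close> belongs to the space.
\<close>

lemma comp_op_phi: "comp_op G (phi_map a) = adj G G phi_adj"
proof (rule extensionalityI[of _ "elems G"])
  note adj = g.adj_bounded[OF g.hilbert_space_axioms phi_adj_bounded]
  show "adj G G phi_adj \<in> extensional (elems G)" using adj by (simp add: bounded_ops_def PiE_def)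
  fix f assume f: "f \<in> elems G"
  have m: "adj G G phi_adj f \<in> elems G" by (rule bounded_ops_mem[OF adj f])
  have "adj G G phi_adj f z = f (phi_map a z)" if z: "z \<in> ball 0 1" for z
    using g.ip_adj_left[OF g.hilbert_space_axioms phi_adj_bounded g.kernel_mem[OF z] f]
    unfolding g.ip_kernel[OF m z] phi_adj_kernel[OF z] g.ip_kernel[OF f phi_map_ball[OF z]] .
  thus "comp_op G (phi_map a) f = adj G G phi_adj f"
    using f g.H2_outside[OF m] by (auto simp: comp_op_def fun_eq_iff)
qed (simp add: comp_op_def)

lemma comp_op_phi_bounded: "comp_op G (phi_map a) \<in> bounded_ops G G"
  unfolding comp_op_phi by (rule g.adj_bounded[OF g.hilbert_space_axioms phi_adj_bounded])

lemma adj_comp_op_phi: "adj G G (comp_op G (phi_map a)) = phi_adj"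
  unfolding comp_op_phi
  by (rule g.adj_eqI[OF phi_adj_bounded]) (rule g.ip_adj_left[OF g.hilbert_space_axioms phi_adj_bounded])

lemma unitary_onto_subspace: "shift_unitary \<alpha> V \<Longrightarrow> unitary_onto_subspace B G N V"
  by unfold_locales (auto simp: zH2_elems[OF \<alpha>] ip_zH2 shift_unitary_def)

text \<open>
  Evaluating at \<open>z\<close> is pairing with the kernel \<open>K\<^sub>z\<close>, so it suffices that the adjoint of the right-hand side,
  the extension of \<open>a C\<^sub>\<phi>\<close>, maps \<open>K\<^sub>z\<close> to the kernel at \<open>\<sigma>(z)\<close>. The isometry pulls \<open>K\<^sub>z\<close> back to
  \<open>u(x) = cnj z / (1 - cnj z * x)\<close>, and \<open>a u(\<phi>(x)) = t / (1 - t x)\<close> for \<open>t = cnj (\<sigma>(z))\<close>.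
\<close>

lemma comp_op_sigma:
  assumes V: "shift_unitary \<alpha> V"
  shows "comp_op B (sigma_map a) = isometric_embedding.extend_op B G V (scale_op G (of_real a) phi_adj)"
proof -
  interpret unitary_onto_subspace B G N V by (rule unitary_onto_subspace[OF V])
  let ?C = "comp_op G (phi_map a)"
  let ?X = "scale_op G (of_real a) phi_adj" and ?Y = "scale_op G (of_real a) ?C"
  note C = comp_op_phi_bounded
  have X: "?X \<in> bounded_ops G G" by (rule scale_op_bounded[OF g.hilbert_space_axioms phi_adj_bounded])
  have Y: "?Y \<in> bounded_ops G G" by (rule scale_op_bounded[OF g.hilbert_space_axioms C])
  have XY: "ip G (?X f) h = ip G f (?Y h)" if "f \<in> elems G" "h \<in> elems G" for f h
    using g.ip_adj[OF g.hilbert_space_axioms phi_adj_bounded that] that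
    by (simp add: scale_op_eq comp_op_phi[symmetric] g.ip_linear bounded_ops_mem[OF phi_adj_bounded] bounded_ops_mem[OF C])
  have kernel: "extend_op ?Y (b.kernel z) = b.kernel (sigma_map a z)" if z: "z \<in> ball 0 1" for z
  proof (rule b.H2_eqI)
    note km = b.kernel_mem[OF z]
    define u where "u = J' (b.kernel z)"
    have u: "u \<in> elems G" unfolding u_def by (rule J'_lin(1)[OF km])
    have Yu: "?Y u \<in> elems G" by (rule bounded_ops_mem[OF Y u])
    define t where "t = cnj (sigma_map a z)"
    have t1: "cmod t < 1" using sigma_map_ball[OF z] by (simp add: t_def)
    have t: "t = of_real a * cnj z / (1 - (1 - of_real a) * cnj z)"
      by (simp add: t_def sigma_map_def left_diff_distrib)
    have den: "1 - (1 - of_real a) * cnj z \<noteq> 0"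
    proof
      assume "1 - (1 - of_real a) * cnj z = 0"
      hence "cmod (of_real (1 - a) * cnj z) = 1" by simp
      moreover have "(1 - a) * cmod z \<le> (1 - a) * 1" using z a by (intro mult_left_mono) auto
      ultimately show False using a unfolding norm_mult norm_of_real by simp
    qed
    have u_coeff: "taylor_coeff u = (\<lambda>j. cnj z ^ Suc j)"
    proof
      fix j
      let ?g = "of_real ((gamma_wt \<alpha> j)\<^sup>2) :: complex"
      have Vj: "V (disk_monom j) z = ?g * z ^ Suc j"
        using V z unfolding shift_unitary_def
        by (simp add: disk_monom_def beta_wt_def power2_eq_square)
      have "taylor_coeff u j * ?g = ip G u (disk_monom j)" by (rule g.ip_disk_monom[OF u, symmetric])
      also have "\<dots> = ip B (b.kernel z) (V (disk_monom j))"
        unfolding u_def by (rule ip_J'[OF g.disk_monom_mem km])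
      also have "\<dots> = cnj (ip B (V (disk_monom j)) (b.kernel z))"
        by (rule b.ip_commute[OF J_lin(1)[OF g.disk_monom_mem] km])
      also have "\<dots> = ?g * cnj z ^ Suc j"
        unfolding b.ip_kernel[OF J_lin(1)[OF g.disk_monom_mem] z] Vj by simp
      finally have "?g * taylor_coeff u j = ?g * cnj z ^ Suc j" by (simp only: mult.commute)
      thus "taylor_coeff u j = cnj z ^ Suc j" by simp
    qed
    have u_val: "u x = cnj z / (1 - cnj z * x)" if x: "x \<in> ball 0 1" for x
    proof -
      have "cmod z * cmod x \<le> cmod z * 1" using x by (intro mult_left_mono) auto
      hence "cmod (cnj z * x) < 1" using z by (simp add: norm_mult)
      hence "(\<lambda>n. cnj z * (cnj z * x) ^ n) sums (cnj z * (1 / (1 - cnj z * x)))"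
        by (intro sums_mult geometric_sums)
      moreover have "(\<lambda>n. cnj z * (cnj z * x) ^ n) sums u x"
        using g.H2_sums[OF u x] by (simp add: u_coeff power_mult_distrib mult_ac)
      ultimately show ?thesis using sums_unique2 by fastforce
    qed
    have Y_coeff: "taylor_coeff (?Y u) = (\<lambda>j. t ^ Suc j)"
    proof (rule taylor_coeff_unique)
      fix x :: complex assume x: "x \<in> ball 0 1"
      have tx: "cmod (t * x) < 1"
      proof -
        have "cmod t * cmod x \<le> cmod t * 1" using x by (intro mult_left_mono) auto
        thus ?thesis using t1 by (simp add: norm_mult)
      qed
      have "?Y u x = of_real a * (cnj z / (1 - cnj z * phi_map a x))"
        using u x u_val[OF phi_map_ball[OF x]] by (simp add: scale_op_eq comp_op_def)
      \<comment> \<open>The factorisation that turns composition with the affine map into the Moebius map sigma.\<close>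
      also have "1 - cnj z * phi_map a x = (1 - (1 - of_real a) * cnj z) * (1 - t * x)"
        using den by (simp add: phi_map_def t field_simps)
      also have "of_real a * (cnj z / ((1 - (1 - of_real a) * cnj z) * (1 - t * x))) = t * (1 / (1 - t * x))"
        by (simp add: t)
      finally have val: "?Y u x = t * (1 / (1 - t * x))" .
      have "(\<lambda>n. t * (t * x) ^ n) sums (t * (1 / (1 - t * x)))"
        by (intro sums_mult geometric_sums tx)
      thus "(\<lambda>n. t ^ Suc n * x ^ n) sums ?Y u x" unfolding val by (simp add: power_mult_distrib mult_ac)
    qed
    have ext: "extend_op ?Y (b.kernel z) = b.kernel z + V (?Y u - u)"
      using km by (simp add: extend_op_def u_def)
    have d: "?Y u - u \<in> elems G" using Yu u by simp
    show "extend_op ?Y (b.kernel z) \<in> elems B" by (rule bounded_ops_mem[OF extend_op_bounded[OF Y] km])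
    show "b.kernel (sigma_map a z) \<in> elems B" by (rule b.kernel_mem[OF sigma_map_ball[OF z]])
    fix n
    note coeffs = b.taylor_coeff_add[OF km J_lin(1)[OF d]] b.taylor_coeff_kernel[OF z]
      b.taylor_coeff_kernel[OF sigma_map_ball[OF z]]
    show "taylor_coeff (extend_op ?Y (b.kernel z)) n = taylor_coeff (b.kernel (sigma_map a z)) n"
    proof (cases n)
      case 0
      thus ?thesis unfolding ext coeffs by (simp add: shift_unitary_coeff(2)[OF \<alpha> V d])
    next
      case (Suc j)
      have "taylor_coeff (V (?Y u - u)) (Suc j) = of_real ((gamma_wt \<alpha> j)\<^sup>2) * (t ^ Suc j - cnj z ^ Suc j)"
        unfolding shift_unitary_coeff(3)[OF \<alpha> V d] g.taylor_coeff_diff[OF Yu u] Y_coeff u_coeff ..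
      thus ?thesis unfolding ext coeffs Suc beta_wt_sq t_def by (simp add: algebra_simps)
    qed
  qed
  show ?thesis
  proof (rule extensionalityI[of _ "elems B"])
    note E = extend_op_bounded[OF X]
    show "extend_op ?X \<in> extensional (elems B)" by (simp add: extend_op_def)
    fix f assume f: "f \<in> elems B"
    have m: "extend_op ?X f \<in> elems B" by (rule bounded_ops_mem[OF E f])
    have "extend_op ?X f z = f (sigma_map a z)" if z: "z \<in> ball 0 1" for z
    proof -
      have "ip B (extend_op ?X f) (b.kernel z) = ip B f (extend_op ?Y (b.kernel z))"
        by (rule ip_extend_op[OF X Y _ f b.kernel_mem[OF z]]) (rule XY)
      thus ?thesis
        unfolding kernel[OF z] b.ip_kernel[OF m z] b.ip_kernel[OF f sigma_map_ball[OF z]] .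
    qed
    thus "comp_op B (sigma_map a) f = extend_op ?X f"
      using f b.H2_outside[OF m] by (auto simp: comp_op_def fun_eq_iff)
  qed (simp add: comp_op_def)
qed

lemma iter_aluthge_comp_op_sigma:
  assumes V: "shift_unitary \<alpha> V"
  shows "iter_aluthge B n (comp_op B (sigma_map a)) =
    direct_sum_op B (ortho B (elems N)) (elems N) (id_op (ortho B (elems N)))
      (compose (elems N) V (compose (elems N)
        (scale_op G (of_real a) (iter_aluthge G n (adj G G (comp_op G (phi_map a))))) (adj G N V)))"
proof -
  interpret unitary_onto_subspace B G N V by (rule unitary_onto_subspace[OF V])
  have X: "scale_op G (of_real a) phi_adj \<in> bounded_ops G G"
    by (rule scale_op_bounded[OF g.hilbert_space_axioms phi_adj_bounded])
  have Y: "scale_op G (of_real a) (iter_aluthge G n phi_adj) \<in> bounded_ops G G"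
    by (rule scale_op_bounded[OF g.hilbert_space_axioms g.iter_aluthge_bounded[OF phi_adj_bounded]])
  show ?thesis
    unfolding adj_comp_op_phi direct_sum_op_eq_extend_op[OF Y] comp_op_sigma[OF V]
      iter_aluthge_extend_op[OF X] g.iter_aluthge_scale_op[OF phi_adj_bounded a(1)] ..
qed

end

theorem theorem4p1:
  fixes a \<alpha> :: real
  assumes "0 < a" and "a < 1" and "\<alpha> > -1"
  shows "phi_map a ` ball 0 1 \<subseteq> ball 0 1 \<and> sigma_map a ` ball 0 1 \<subseteq> ball 0 1 \<and>
    (\<exists>!V. shift_unitary \<alpha> V) \<and>
    (\<forall>V. shift_unitary \<alpha> V \<longrightarrow>
      (\<forall>n. iter_aluthge (H2 (beta_wt \<alpha>)) n (comp_op (H2 (beta_wt \<alpha>)) (sigma_map a)) =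
        direct_sum_op (H2 (beta_wt \<alpha>))
          (ortho (H2 (beta_wt \<alpha>)) (elems (zH2 (beta_wt \<alpha>)))) (elems (zH2 (beta_wt \<alpha>)))
          (id_op (ortho (H2 (beta_wt \<alpha>)) (elems (zH2 (beta_wt \<alpha>)))))
          (compose (elems (zH2 (beta_wt \<alpha>))) V
            (compose (elems (zH2 (beta_wt \<alpha>)))
              (scale_op (H2 (gamma_wt \<alpha>)) (of_real a)
                (iter_aluthge (H2 (gamma_wt \<alpha>)) n
                  (adj (H2 (gamma_wt \<alpha>)) (H2 (gamma_wt \<alpha>))
                    (comp_op (H2 (gamma_wt \<alpha>)) (phi_map a)))))
              (adj (H2 (gamma_wt \<alpha>)) (zH2 (beta_wt \<alpha>)) V)))))"
proof -
  interpret affine_composition a \<alpha> by unfold_locales (use assms in auto)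
  show ?thesis
    using phi_map_ball sigma_map_ball shift_unitary_exists[OF assms(3)] shift_unitary_unique[OF assms(3)]
      iter_aluthge_comp_op_sigma by blast
qed

end
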